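(* Let $P$ be a precubical set with boundary operators $d_i^k$, let $a\in\{1,2\}$, $b\in\{0,1\}$, and let $x\in P_2$ be a regular element such that (i) no element of $P_2\setminus\{x\}$ has $d_a^{1-b}x$ or $d_{3-a}^bx$ in its boundary, (ii) there is no element $y\in P_1\setminus\{d_a^{1-b}x\}$ such that $d_1^by=d_1^bd_a^{1-b}x$, (iii) no element of the set $Y=\{y\in P_1\setminus\{d_{3-a}^bx\}\mid d_1^{1-b}y=d_1^{1-b}d_{3-a}^bx\}$ is in the boundary of some element in $P_2$. Then a precubical subset $Q$ of $P$ and a precubical subset $R$ of $Q$ such that the inclusion $\iota:|Q|\hookrightarrow|P|$ is a dihomotopy equivalence relative to $|R|$ are given by $Q_0=P_0$, $Q_1=P_1\setminus\{d_{3-a}^bx\}$, $Q_2=P_2\setminus\{x\}$, $Q_r=P_r$ $(r>2)$, $R_0=Q_0\setminus\{d_1^{1-b}d_{3-a}^bx\}$, $R_1=Q_1\setminus(\{d_a^{1-b}x\}\cup Y)$, and $R_r=Q_r$ $(r\ge 2)$. Moreover, if $Y\neq\emptyset$, then $\mathrm{Extrl}(P)=\mathrm{Extrl}(Q)\subseteq R$, and $\iota$ induces an isomorphism of fundamental bipartite graphs $\vec\pi_1(|Q|,\mathrm{Extrl}(|Q|))\to\vec\pi_1(|P|,\mathrm{Extrl}(|P|))$ and, for each pair of extremal elements $v,w\in\mathrm{Extrl}(P)$, a homotopy equivalence of d-path spaces $\vec{\mathcal P}(|Q|)([v,()],[w,()])\to\vec{\mathcal P}(|P|)([v,()],[w,()])$,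 $\omega\mapsto\iota\circ\omega$.
   Context: Precubical sets. $I=[0,1]$. A precubical set is a graded set $P=(P_n)_{n\ge 0}$ with boundary operators $d_i^k: P_n \to P_{n-1}$ ($n>0$, $k=0,1$, $i=1,\dots,n$) satisfying $d_i^k\circ d_j^l = d_{j-1}^l\circ d_i^k$ ($k,l=0,1$, $i<j$). Elements of $P_0$ are called vertices. An element is in the boundary of $z$ if it is obtained from $z$ by applying one or more boundary operators. A morphism of precubical sets is a morphism of graded sets compatible with the boundary operators. A precubical subset of $P$ is a precubical set $Q$ with $Q_n\subseteq P_n$ for all $n$ whose boundary operators coincide with those of $P$ on $Q$. Regular elements. Let $\Box$ be the category whose objects are the standard cubes $I^n$ ($n\geq 0$, $I^0=\{()\}$) and whose non-identity morphisms are composites of the maps $\delta_i^k: I^n\to I^{n+1}$ ($i\in\{1,\dots,n+1\}$, $k\in\{0,1\}$), $\delta_i^k(u_1,\dots,u_n)=(u_1,\dots,u_{i-1},k,u_i,\dots,u_n)$. Precubical sets are the presheaves on $\Box$. Let $\mathbb I^n=\Box(-,I^n)$. For $x\in P_n$ let $x_\sharp:\mathbb I^n\to P$ be the unique morphism with $x_\sharp(\mathrm{id}_{I^n})=x$; $x$ is regular if $x_\sharp$ is injective. d-spaces. A d-space is a topological space $X$ with a set $dX\subseteq X^I$ of paths (called d-paths) containing all constant paths and closed under composition with (not necessarily strictly) increasing continuous maps $I\to I$ and under concatenation. A d-map is a continuous map $f$ between d-spaces such that $f\circ\omega$ is a d-path for each d-path $\omega$. A d-subspace $A$ of $X$ is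 a subspace with $dA=\{\omega\in A^I \mid \omega \text{ is a d-path when regarded as a path in } X\}$. Geometric realization. $|P|=(\coprod_{n\ge 0}P_n\times I^n)/\sim$ with $P_n$ discrete and $\sim$ generated by $(d_i^kx,u)\sim(x,\delta_i^k(u))$; classes are written $[x,u]$. Its d-paths are the increasing reparametrizations of finite concatenations of paths of the form $t\mapsto[x,\alpha(t)]$, where $x\in P_n$ and $\alpha:I\to I^n$ is continuous and order-preserving (componentwise order on $I^n$). If $Q$ is a precubical subset of $P$, then $|Q|$ is regarded as a d-subspace of $|P|$. Dihomotopy. For d-maps $f,g:X\to Y$ coinciding on a d-subspace $A$ of $X$, a dihomotopy relative to $A$ from $f$ to $g$ is a homotopy $H:X\times I\to Y$ from $f$ to $g$ such that each $H(-,t)$ is a d-map which coincides with $f$ and $g$ on $A$; $f,g$ are then called dihomotopic relative to $A$. If $X$ and $Y$ are d-spaces with a common d-subspace $A$, a d-map $f:X\to Y$ with $f(a)=a$ for all $a\in A$ is a dihomotopy equivalence relative to $A$ if there is a d-map $g:Y\to X$ with $g(a)=a$ for all $a\in A$ such that $g\circ f$ and $f\circ g$ are dihomotopic relative to $A$ to the identities. Extremal elements and fundamental bipartite graph. A vertex $v\in P_0$ is minimal (maximal) if there is no $x\in P_1$ with $d_1^1x=v$ ($d_1^0x=v$); it is extremal if it is minimal or maximal. $\mathrm{Extrl}(P)$ is the $0$-dimensional precubical subset of extremal elements. The fundamental category $\vec\pi_1(X)$ of a d-space $X$ has the points of $X$ as objects and, as morphisms from $x$ to $y$, the dihomotopy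 classes relative to $\{0,1\}$ (endpoints fixed) of d-paths from $x$ to $y$ (composition by concatenation); it is functorial in d-maps. A point $a\in X$ is minimal (maximal) if any morphism in $\vec\pi_1(X)$ with target (source) $a$ has source (target) $a$, and extremal if it is minimal or maximal; $\mathrm{Extrl}(X)$ is the d-subspace of extremal points. The fundamental bipartite graph of $X$ is the full subcategory $\vec\pi_1(X,\mathrm{Extrl}(X))$ of $\vec\pi_1(X)$ on $\mathrm{Extrl}(X)$. For $a,b\in X$, the d-path space $\vec{\mathcal P}(X)(a,b)$ is the subspace of $X^I$ (compact-open topology) of d-paths from $a$ to $b$. *)

theory Defs
  imports "HOL-Analysis.Analysis"
begin

section \<open>Precubical sets\<close>

text \<open>A graded set is a family of sets indexed by the degree. The sets in different degrees
  need not be disjoint as sets, so the degree is always passed along explicitly.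
  \<open>bd P n i k\<close> is the boundary operator $d_i^k$ from degree \<open>n\<close> to degree \<open>n - 1\<close>;
  its values are only meaningful for \<open>n > 0\<close>, \<open>1 \<le> i \<le> n\<close>, \<open>k \<in> {0, 1}\<close> on \<open>cells P n\<close>.\<close>

record 'a precubical =
  cells :: "nat \<Rightarrow> 'a set"
  bd :: "nat \<Rightarrow> nat \<Rightarrow> nat \<Rightarrow> 'a \<Rightarrow> 'a"

definition precubical_set :: "'a precubical \<Rightarrow> bool" where
  "precubical_set P \<longleftrightarrow>
     (\<forall>n>0. \<forall>i\<in>{1..n}. \<forall>k\<in>{0,1}. \<forall>x\<in>cells P n. bd P n i k x \<in> cells P (n - 1)) \<and>
     (\<forall>n. \<forall>i j. \<forall>k\<in>{0,1}. \<forall>l\<in>{0,1}. \<forall>x\<in>cells P n. 1 \<le> i \<and> i < j \<and> j \<le> n \<longrightarrow>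
        bd P (n - 1) i k (bd P n j l x) = bd P (n - 1) (j - 1) l (bd P n i k x))"

definition precubical_morphism ::
    "'a precubical \<Rightarrow> 'b precubical \<Rightarrow> (nat \<Rightarrow> 'a \<Rightarrow> 'b) \<Rightarrow> bool" where
  "precubical_morphism P Q f \<longleftrightarrow>
     (\<forall>n. f n \<in> cells P n \<rightarrow> cells Q n) \<and>
     (\<forall>n>0. \<forall>i\<in>{1..n}. \<forall>k\<in>{0,1}. \<forall>x\<in>cells P n.
        f (n - 1) (bd P n i k x) = bd Q n i k (f n x))"

definition precubical_subset :: "'a precubical \<Rightarrow> 'a precubical \<Rightarrow> bool" where
  "precubical_subset Q P \<longleftrightarrow>
     precubical_set Q \<and> (\<forall>n. cells Q n \<subseteq> cells P n) \<and>
     (\<forall>n>0. \<forall>i\<in>{1..n}. \<forall>k\<in>{0,1}. \<forall>x\<in>cells Q n. bd Q n i k x = bd P n i k x)"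

text \<open>\<open>in_boundary P n z m y\<close>: the element \<open>y\<close> of degree \<open>m\<close> is in the boundary of the
  element \<open>z\<close> of degree \<open>n\<close>.\<close>

inductive in_boundary :: "'a precubical \<Rightarrow> nat \<Rightarrow> 'a \<Rightarrow> nat \<Rightarrow> 'a \<Rightarrow> bool"
  for P :: "'a precubical" and n :: nat and z :: 'a where
  face: "n > 0 \<Longrightarrow> i \<in> {1..n} \<Longrightarrow> k \<in> {0,1} \<Longrightarrow> in_boundary P n z (n - 1) (bd P n i k z)"
| step: "in_boundary P n z m y \<Longrightarrow> m > 0 \<Longrightarrow> i \<in> {1..m} \<Longrightarrow> k \<in> {0,1} \<Longrightarrow>
           in_boundary P n z (m - 1) (bd P m i k y)"

definition min_vertex :: "'a precubical \<Rightarrow> 'a \<Rightarrow> bool" where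
  "min_vertex P v \<longleftrightarrow> v \<in> cells P 0 \<and> \<not> (\<exists>x\<in>cells P 1. bd P 1 1 1 x = v)"

definition max_vertex :: "'a precubical \<Rightarrow> 'a \<Rightarrow> bool" where
  "max_vertex P v \<longleftrightarrow> v \<in> cells P 0 \<and> \<not> (\<exists>x\<in>cells P 1. bd P 1 1 0 x = v)"

definition extrl :: "'a precubical \<Rightarrow> 'a precubical" where
  "extrl P = P\<lparr>cells := (\<lambda>n. if n = 0 then {v. min_vertex P v \<or> max_vertex P v} else {})\<rparr>"


section \<open>Standard cubes and regular elements\<close>

text \<open>Points of $I^n$ are functions on \<open>{1..n}\<close>, extended by \<open>undefined\<close> outside;
  the unique point of $I^0$ is \<open>\<lambda>_. undefined\<close>.\<close>

definition Icube :: "nat \<Rightarrow> (nat \<Rightarrow> real) set" where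
  "Icube n = (\<Pi>\<^sub>E i\<in>{1..n}. {0..1})"

definition pt0 :: "nat \<Rightarrow> real" where
  "pt0 = (\<lambda>_. undefined)"

definition face_map :: "nat \<Rightarrow> nat \<Rightarrow> nat \<Rightarrow> (nat \<Rightarrow> real) \<Rightarrow> (nat \<Rightarrow> real)" where
  "face_map n i k = (\<lambda>u\<in>Icube n. \<lambda>j\<in>{1..Suc n}.
     if j < i then u j else if j = i then real k else u (j - 1))"

text \<open>\<open>box_mor m n f\<close>: \<open>f\<close> is a morphism $I^m \to I^n$ of the category $\Box$.\<close>

inductive box_mor :: "nat \<Rightarrow> nat \<Rightarrow> ((nat \<Rightarrow> real) \<Rightarrow> (nat \<Rightarrow> real)) \<Rightarrow> bool" where
  ident: "box_mor n n (\<lambda>u\<in>Icube n. u)"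
| face: "i \<in> {1..Suc n} \<Longrightarrow> k \<in> {0,1} \<Longrightarrow> box_mor n (Suc n) (face_map n i k)"
| comp: "box_mor l m f \<Longrightarrow> box_mor m n g \<Longrightarrow> box_mor l n (compose (Icube l) g f)"

text \<open>The representable presheaf $\Box(-,I^n)$.\<close>

definition std_cube :: "nat \<Rightarrow> ((nat \<Rightarrow> real) \<Rightarrow> (nat \<Rightarrow> real)) precubical" where
  "std_cube n = \<lparr>cells = (\<lambda>m. {f. box_mor m n f}),
     bd = (\<lambda>m i k f. compose (Icube (m - 1)) f (face_map (m - 1) i k))\<rparr>"

text \<open>The morphism $x_\sharp$ is unique only as a family of functions on the cells of the
  standard cube (see \<open>sharp_unique\<close> below), hence the existential quantifier.\<close>

definition regular_element :: "'a precubical \<Rightarrow> nat \<Rightarrow> 'a \<Rightarrow> bool" where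
  "regular_element P n x \<longleftrightarrow> x \<in> cells P n \<and>
     (\<exists>f. precubical_morphism (std_cube n) P f \<and> f n (\<lambda>u\<in>Icube n. u) = x \<and>
          (\<forall>m. inj_on (f m) (cells (std_cube n) m)))"


section \<open>d-spaces\<close>

abbreviation unit_top :: "real topology" where
  "unit_top \<equiv> top_of_set {0..1}"

text \<open>The set of continuous maps; maps are made extensional so that equality
  of maps is equality of functions.\<close>

definition cont_maps :: "'x topology \<Rightarrow> 'y topology \<Rightarrow> ('x \<Rightarrow> 'y) set" where
  "cont_maps X Y = {f \<in> extensional (topspace X). continuous_map X Y f}"

definition increasing_map :: "(real \<Rightarrow> real) \<Rightarrow> bool" where
  "increasing_map \<phi> \<longleftrightarrow> continuous_map unit_top unit_top \<phi> \<and> mono_on {0..1} \<phi>"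

definition const_path :: "'p \<Rightarrow> real \<Rightarrow> 'p" where
  "const_path p = (\<lambda>t\<in>{0..1}. p)"

definition concat_path :: "(real \<Rightarrow> 'p) \<Rightarrow> (real \<Rightarrow> 'p) \<Rightarrow> real \<Rightarrow> 'p" where
  "concat_path \<omega> \<nu> = (\<lambda>t\<in>{0..1}. if t \<le> 1/2 then \<omega> (2 * t) else \<nu> (2 * t - 1))"

text \<open>The composite $f \circ \omega$ of a path with a map.\<close>

definition dpath_comp :: "('p \<Rightarrow> 'q) \<Rightarrow> (real \<Rightarrow> 'p) \<Rightarrow> real \<Rightarrow> 'q" where
  "dpath_comp f \<omega> = (\<lambda>t\<in>{0..1}. f (\<omega> t))"

record 'p dspace =
  dtop :: "'p topology"
  dpaths :: "(real \<Rightarrow> 'p) set"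

definition is_dspace :: "'p dspace \<Rightarrow> bool" where
  "is_dspace X \<longleftrightarrow>
     dpaths X \<subseteq> cont_maps unit_top (dtop X) \<and>
     (\<forall>p\<in>topspace (dtop X). const_path p \<in> dpaths X) \<and>
     (\<forall>\<omega>\<in>dpaths X. \<forall>\<phi>. increasing_map \<phi> \<longrightarrow> (\<lambda>t\<in>{0..1}. \<omega> (\<phi> t)) \<in> dpaths X) \<and>
     (\<forall>\<omega>\<in>dpaths X. \<forall>\<nu>\<in>dpaths X. \<omega> 1 = \<nu> 0 \<longrightarrow> concat_path \<omega> \<nu> \<in> dpaths X)"

definition dmap :: "'p dspace \<Rightarrow> 'q dspace \<Rightarrow> ('p \<Rightarrow> 'q) \<Rightarrow> bool" where
  "dmap X Y f \<longleftrightarrow> is_dspace X \<and> is_dspace Y \<and>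
     continuous_map (dtop X) (dtop Y) f \<and> (\<forall>\<omega>\<in>dpaths X. dpath_comp f \<omega> \<in> dpaths Y)"

definition dsub :: "'p dspace \<Rightarrow> 'p set \<Rightarrow> 'p dspace" where
  "dsub X S = \<lparr>dtop = subtopology (dtop X) S, dpaths = {\<omega> \<in> dpaths X. \<omega> ` {0..1} \<subseteq> S}\<rparr>"

definition dsubspace :: "'p dspace \<Rightarrow> 'p dspace \<Rightarrow> bool" where
  "dsubspace A X \<longleftrightarrow> is_dspace X \<and> (\<exists>S \<subseteq> topspace (dtop X). A = dsub X S)"

definition dihomotopic_rel ::
    "'p dspace \<Rightarrow> 'p dspace \<Rightarrow> 'q dspace \<Rightarrow> ('p \<Rightarrow> 'q) \<Rightarrow> ('p \<Rightarrow> 'q) \<Rightarrow> bool" where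
  "dihomotopic_rel A X Y f g \<longleftrightarrow>
     dsubspace A X \<and> dmap X Y f \<and> dmap X Y g \<and> (\<forall>p\<in>topspace (dtop A). f p = g p) \<and>
     (\<exists>H. continuous_map (prod_topology (dtop X) unit_top) (dtop Y) H \<and>
          (\<forall>p\<in>topspace (dtop X). H (p, 0) = f p \<and> H (p, 1) = g p) \<and>
          (\<forall>t\<in>{0..1}. dmap X Y (\<lambda>p. H (p, t)) \<and> (\<forall>p\<in>topspace (dtop A). H (p, t) = f p)))"

definition dihomotopy_equivalence_rel ::
    "'p dspace \<Rightarrow> 'p dspace \<Rightarrow> 'p dspace \<Rightarrow> ('p \<Rightarrow> 'p) \<Rightarrow> bool" where
  "dihomotopy_equivalence_rel A X Y f \<longleftrightarrow>
     dsubspace A X \<and> dsubspace A Y \<and> dmap X Y f \<and> (\<forall>p\<in>topspace (dtop A). f p = p) \<and>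
     (\<exists>g. dmap Y X g \<and> (\<forall>p\<in>topspace (dtop A). g p = p) \<and>
          dihomotopic_rel A X X (g \<circ> f) id \<and> dihomotopic_rel A Y Y (f \<circ> g) id)"


section \<open>Fundamental category and fundamental bipartite graph\<close>

text \<open>The unit interval with the increasing paths; d-paths in \<open>X\<close> are the d-maps from it
  to \<open>X\<close>, so that dihomotopy relative to the endpoints makes sense for them.\<close>

definition dinterval :: "real dspace" where
  "dinterval = \<lparr>dtop = unit_top,
     dpaths = {\<phi> \<in> cont_maps unit_top unit_top. mono_on {0..1} \<phi>}\<rparr>"

definition dclass :: "'p dspace \<Rightarrow> (real \<Rightarrow> 'p) \<Rightarrow> (real \<Rightarrow> 'p) set" where
  "dclass X \<omega> = {\<nu> \<in> dpaths X. dihomotopic_rel (dsub dinterval {0,1}) dinterval X \<omega> \<nu>}"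

text \<open>\<open>Comp\<close> is composition in diagrammatic order.\<close>

record ('o, 'm) cat =
  Ob :: "'o set"
  Hom :: "'o \<Rightarrow> 'o \<Rightarrow> 'm set"
  Ident :: "'o \<Rightarrow> 'm"
  Comp :: "'m \<Rightarrow> 'm \<Rightarrow> 'm"

definition full_subcat :: "('o, 'm) cat \<Rightarrow> 'o set \<Rightarrow> ('o, 'm) cat" where
  "full_subcat C S = C\<lparr>Ob := Ob C \<inter> S\<rparr>"

definition is_functor ::
    "('o, 'm) cat \<Rightarrow> ('o2, 'm2) cat \<Rightarrow> ('o \<Rightarrow> 'o2) \<Rightarrow> ('m \<Rightarrow> 'm2) \<Rightarrow> bool" where
  "is_functor C D F G \<longleftrightarrow>
     F \<in> Ob C \<rightarrow> Ob D \<and>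
     (\<forall>p\<in>Ob C. \<forall>q\<in>Ob C. G \<in> Hom C p q \<rightarrow> Hom D (F p) (F q)) \<and>
     (\<forall>p\<in>Ob C. G (Ident C p) = Ident D (F p)) \<and>
     (\<forall>p\<in>Ob C. \<forall>q\<in>Ob C. \<forall>r\<in>Ob C. \<forall>\<alpha>\<in>Hom C p q. \<forall>\<beta>\<in>Hom C q r.
        G (Comp C \<alpha> \<beta>) = Comp D (G \<alpha>) (G \<beta>))"

definition is_cat_iso ::
    "('o, 'm) cat \<Rightarrow> ('o2, 'm2) cat \<Rightarrow> ('o \<Rightarrow> 'o2) \<Rightarrow> ('m \<Rightarrow> 'm2) \<Rightarrow> bool" where
  "is_cat_iso C D F G \<longleftrightarrow> is_functor C D F G \<and>
     (\<exists>F' G'. is_functor D C F' G' \<and>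
        (\<forall>p\<in>Ob C. F' (F p) = p) \<and> (\<forall>p\<in>Ob D. F (F' p) = p) \<and>
        (\<forall>p\<in>Ob C. \<forall>q\<in>Ob C. \<forall>\<alpha>\<in>Hom C p q. G' (G \<alpha>) = \<alpha>) \<and>
        (\<forall>p\<in>Ob D. \<forall>q\<in>Ob D. \<forall>\<alpha>\<in>Hom D p q. G (G' \<alpha>) = \<alpha>))"

text \<open>The composite of two classes is written as the union of the classes of the
  concatenations of all representatives; these classes all coincide.\<close>

definition fund_cat :: "'p dspace \<Rightarrow> ('p, (real \<Rightarrow> 'p) set) cat" where
  "fund_cat X = \<lparr>Ob = topspace (dtop X),
     Hom = (\<lambda>p q. {dclass X \<omega> | \<omega>. \<omega> \<in> dpaths X \<and> \<omega> 0 = p \<and> \<omega> 1 = q}),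
     Ident = (\<lambda>p. dclass X (const_path p)),
     Comp = (\<lambda>\<alpha> \<beta>. \<Union>\<omega>\<in>\<alpha>. \<Union>\<nu>\<in>\<beta>. dclass X (concat_path \<omega> \<nu>))\<rparr>"

text \<open>The functor induced by a d-map \<open>f\<close> is \<open>f\<close> on objects and \<open>fund_mor X Y f\<close> on morphisms.\<close>

definition fund_mor ::
    "'p dspace \<Rightarrow> 'q dspace \<Rightarrow> ('p \<Rightarrow> 'q) \<Rightarrow> (real \<Rightarrow> 'p) set \<Rightarrow> (real \<Rightarrow> 'q) set" where
  "fund_mor X Y f \<alpha> = (\<Union>\<omega>\<in>\<alpha>. dclass Y (dpath_comp f \<omega>))"

definition min_point :: "'p dspace \<Rightarrow> 'p \<Rightarrow> bool" where
  "min_point X a \<longleftrightarrow> a \<in> topspace (dtop X) \<and>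
     (\<forall>p\<in>Ob (fund_cat X). Hom (fund_cat X) p a \<noteq> {} \<longrightarrow> p = a)"

definition max_point :: "'p dspace \<Rightarrow> 'p \<Rightarrow> bool" where
  "max_point X a \<longleftrightarrow> a \<in> topspace (dtop X) \<and>
     (\<forall>p\<in>Ob (fund_cat X). Hom (fund_cat X) a p \<noteq> {} \<longrightarrow> p = a)"

definition dextrl :: "'p dspace \<Rightarrow> 'p dspace" where
  "dextrl X = dsub X {a. min_point X a \<or> max_point X a}"

definition fund_bipartite_graph :: "'p dspace \<Rightarrow> ('p, (real \<Rightarrow> 'p) set) cat" where
  "fund_bipartite_graph X = full_subcat (fund_cat X) (topspace (dtop (dextrl X)))"


section \<open>d-path spaces\<close>

definition compact_open_topology :: "'x topology \<Rightarrow> 'y topology \<Rightarrow> ('x \<Rightarrow> 'y) topology" where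
  "compact_open_topology X Y = topology_generated_by
     {{f \<in> cont_maps X Y. f ` K \<subseteq> U} | K U. compactin X K \<and> openin Y U}"

definition dpath_space :: "'p dspace \<Rightarrow> 'p \<Rightarrow> 'p \<Rightarrow> (real \<Rightarrow> 'p) topology" where
  "dpath_space X p q = subtopology (compact_open_topology unit_top (dtop X))
     {\<omega> \<in> dpaths X. \<omega> 0 = p \<and> \<omega> 1 = q}"

definition homotopy_equivalence_map ::
    "'x topology \<Rightarrow> 'y topology \<Rightarrow> ('x \<Rightarrow> 'y) \<Rightarrow> bool" where
  "homotopy_equivalence_map X Y f \<longleftrightarrow> continuous_map X Y f \<and>
     (\<exists>g. continuous_map Y X g \<and>
        homotopic_with (\<lambda>_. True) X X (g \<circ> f) id \<and> homotopic_with (\<lambda>_. True) Y Y (f \<circ> g) id)"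


section \<open>Geometric realization\<close>

definition quotient_topology :: "'x topology \<Rightarrow> ('x \<Rightarrow> 'y) \<Rightarrow> 'y topology" where
  "quotient_topology X q =
     topology (\<lambda>U. U \<subseteq> q ` topspace X \<and> openin X {x \<in> topspace X. q x \<in> U})"

definition cube_topology :: "nat \<Rightarrow> (nat \<Rightarrow> real) topology" where
  "cube_topology n = product_topology (\<lambda>_. unit_top) {1..n}"

text \<open>The disjoint union of the spaces $P_n \times I^n$; its points are triples \<open>(n, x, u)\<close>.\<close>

definition prerealization :: "'a precubical \<Rightarrow> (nat \<times> 'a \<times> (nat \<Rightarrow> real)) topology" where
  "prerealization P =
     sum_topology (\<lambda>n. prod_topology (discrete_topology (cells P n)) (cube_topology n)) UNIV"

inductive glue :: "'a precubical \<Rightarrow> (nat \<times> 'a \<times> (nat \<Rightarrow> real)) \<Rightarrow>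
    (nat \<times> 'a \<times> (nat \<Rightarrow> real)) \<Rightarrow> bool" for P :: "'a precubical" where
  "x \<in> cells P (Suc n) \<Longrightarrow> i \<in> {1..Suc n} \<Longrightarrow> k \<in> {0,1} \<Longrightarrow> u \<in> Icube n \<Longrightarrow>
     glue P (n, bd P (Suc n) i k x, u) (Suc n, x, face_map n i k u)"

text \<open>The class $[x,u]$ of a pair with \<open>x\<close> of degree \<open>n\<close>.\<close>

definition point_class ::
    "'a precubical \<Rightarrow> nat \<Rightarrow> 'a \<Rightarrow> (nat \<Rightarrow> real) \<Rightarrow> (nat \<times> 'a \<times> (nat \<Rightarrow> real)) set" where
  "point_class P n x u = {p. equivclp (glue P) (n, x, u) p}"

definition realization_top ::
    "'a precubical \<Rightarrow> (nat \<times> 'a \<times> (nat \<Rightarrow> real)) set topology" where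
  "realization_top P =
     quotient_topology (prerealization P) (\<lambda>(n, x, u). point_class P n x u)"

text \<open>Finite concatenations of paths $t \mapsto [x,\alpha(t)]$.\<close>

inductive_set cube_path_concats ::
    "'a precubical \<Rightarrow> (real \<Rightarrow> (nat \<times> 'a \<times> (nat \<Rightarrow> real)) set) set" for P :: "'a precubical" where
  cube_path: "x \<in> cells P n \<Longrightarrow> continuous_map unit_top (cube_topology n) \<alpha> \<Longrightarrow>
     (\<And>s t i. 0 \<le> s \<Longrightarrow> s \<le> t \<Longrightarrow> t \<le> 1 \<Longrightarrow> i \<in> {1..n} \<Longrightarrow> \<alpha> s i \<le> \<alpha> t i) \<Longrightarrow>
     (\<lambda>t\<in>{0..1}. point_class P n x (\<alpha> t)) \<in> cube_path_concats P"
| concat: "\<omega> \<in> cube_path_concats P \<Longrightarrow> \<nu> \<in> cube_path_concats P \<Longrightarrow> \<omega> 1 = \<nu> 0 \<Longrightarrow>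
     concat_path \<omega> \<nu> \<in> cube_path_concats P"

definition realization :: "'a precubical \<Rightarrow> (nat \<times> 'a \<times> (nat \<Rightarrow> real)) set dspace" where
  "realization P = \<lparr>dtop = realization_top P,
     dpaths = {(\<lambda>t\<in>{0..1}. \<omega> (\<phi> t)) | \<omega> \<phi>. \<omega> \<in> cube_path_concats P \<and> increasing_map \<phi>}\<rparr>"

text \<open>For a precubical subset \<open>Q\<close> of \<open>P\<close>, the realization of \<open>Q\<close> regarded as a d-subspace of
  the realization of \<open>P\<close>. In particular the points are classes with respect to \<open>P\<close>, and
  inclusions between such d-subspaces are restrictions of the identity.\<close>

definition sub_realization ::
    "'a precubical \<Rightarrow> 'a precubical \<Rightarrow> (nat \<times> 'a \<times> (nat \<Rightarrow> real)) set dspace" where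
  "sub_realization P Q = dsub (realization P)
     {point_class P n x u | n x u. x \<in> cells Q n \<and> u \<in> Icube n}"


section \<open>Basic facts\<close>

lemma istopology_quotient:
  "istopology (\<lambda>U. U \<subseteq> q ` topspace X \<and> openin X {x \<in> topspace X. q x \<in> U})"
  unfolding istopology_def
proof (intro conjI allI impI)
  fix S T
  assume S: "S \<subseteq> q ` topspace X \<and> openin X {x \<in> topspace X. q x \<in> S}"
    and T: "T \<subseteq> q ` topspace X \<and> openin X {x \<in> topspace X. q x \<in> T}"
  show "S \<inter> T \<subseteq> q ` topspace X"
    using S by blast
  have "{x \<in> topspace X. q x \<in> S \<inter> T} = {x \<in> topspace X. q x \<in> S} \<inter> {x \<in> topspace X. q x \<in> T}"
    by blast
  moreover have "openin X ({x \<in> topspace X. q x \<in> S} \<inter> {x \<in> topspace X. q x \<in> T})"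
    using S T by (intro openin_Int) (rule conjunct2, assumption)+
  ultimately show "openin X {x \<in> topspace X. q x \<in> S \<inter> T}"
    by (simp only:)
next
  fix K
  assume K: "\<forall>U\<in>K. U \<subseteq> q ` topspace X \<and> openin X {x \<in> topspace X. q x \<in> U}"
  show "\<Union>K \<subseteq> q ` topspace X"
    using K by blast
  have "{x \<in> topspace X. q x \<in> \<Union>K} = (\<Union>U\<in>K. {x \<in> topspace X. q x \<in> U})"
    by blast
  moreover have "openin X (\<Union>U\<in>K. {x \<in> topspace X. q x \<in> U})"
    using K by (intro openin_Union) blast
  ultimately show "openin X {x \<in> topspace X. q x \<in> \<Union>K}"
    by (simp only:)
qed

lemma openin_quotient_topology:
  "openin (quotient_topology X q) U \<longleftrightarrow>
     U \<subseteq> q ` topspace X \<and> openin X {x \<in> topspace X. q x \<in> U}"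
  by (simp only: quotient_topology_def topology_inverse'[OF istopology_quotient])

lemma topspace_quotient_topology: "topspace (quotient_topology X q) = q ` topspace X"
proof
  have "openin (quotient_topology X q) (topspace (quotient_topology X q))"
    by (rule openin_topspace)
  then show "topspace (quotient_topology X q) \<subseteq> q ` topspace X"
    by (simp only: openin_quotient_topology)
  have "{x \<in> topspace X. q x \<in> q ` topspace X} = topspace X"
    by blast
  then have "openin (quotient_topology X q) (q ` topspace X)"
    by (simp only: openin_quotient_topology openin_topspace subset_refl simp_thms)
  then show "q ` topspace X \<subseteq> topspace (quotient_topology X q)"
    by (rule openin_subset)
qed

lemma quotient_map_quotient_topology: "quotient_map X (quotient_topology X q) q"
  by (simp only: quotient_map_def topspace_quotient_topology openin_quotient_topology) simp

lemma topspace_cube_topology: "topspace (cube_topology n) = Icube n"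
  by (simp add: cube_topology_def Icube_def)

lemma topspace_realization:
  "topspace (dtop (realization P)) = {point_class P n x u | n x u. x \<in> cells P n \<and> u \<in> Icube n}"
proof -
  have "topspace (prerealization P) = (SIGMA n:UNIV. cells P n \<times> Icube n)"
    by (simp add: prerealization_def topspace_cube_topology o_def)
  moreover have "(\<lambda>(n, x, u). f n x u) ` (SIGMA n:UNIV. cells P n \<times> Icube n) =
      {f n x u | n x u. x \<in> cells P n \<and> u \<in> Icube n}" for f :: "nat \<Rightarrow> 'a \<Rightarrow> (nat \<Rightarrow> real) \<Rightarrow> 'b"
    by (fastforce simp: image_def)
  ultimately show ?thesis
    by (simp only: realization_def realization_top_def topspace_quotient_topology dspace.simps)
qed

lemma dtop_sub_realization_self: "dtop (sub_realization P P) = dtop (realization P)"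
  unfolding sub_realization_def dsub_def topspace_realization[symmetric] by simp

lemma topspace_compact_open: "topspace (compact_open_topology X Y) = cont_maps X Y"
proof -
  have "cont_maps X Y \<in> {{f \<in> cont_maps X Y. f ` K \<subseteq> U} | K U. compactin X K \<and> openin Y U}"
    by (rule CollectI, rule exI[of _ "{}"], rule exI[of _ "{}"]) auto
  then show ?thesis
    unfolding compact_open_topology_def topology_generated_by_topspace by blast
qed

lemma face_map_in: "u \<in> Icube n \<Longrightarrow> i \<in> {1..Suc n} \<Longrightarrow> k \<in> {0,1} \<Longrightarrow> face_map n i k u \<in> Icube (Suc n)"
proof -
  assume u: "u \<in> Icube n" and i: "i \<in> {1..Suc n}" and k: "k \<in> {0,1}"
  have "(if j < i then u j else if j = i then real k else u (j - 1)) \<in> {0..1}"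
    if j: "j \<in> {1..Suc n}" for j
  proof -
    have "u l \<in> {0..1}" if "l \<in> {1..n}" for l
      using u that unfolding Icube_def by (rule PiE_mem)
    moreover have "j < i \<Longrightarrow> j \<in> {1..n}" "i < j \<Longrightarrow> j - 1 \<in> {1..n}"
      using i j by auto
    moreover have "real k \<in> {0..1}"
      using k by auto
    ultimately show ?thesis by (metis linorder_neqE_nat)
  qed
  then show ?thesis
    using u unfolding face_map_def Icube_def by (simp add: restrict_PiE_iff)
qed

lemma box_mor_in:
  assumes "box_mor m n f" shows "f \<in> Icube m \<rightarrow>\<^sub>E Icube n"
  using assms
proof induction
  case (ident n) then show ?case by auto
next
  case (face i n k)
  then have "\<And>u. u \<in> Icube n \<Longrightarrow> face_map n i k u \<in> Icube (Suc n)"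
    using face_map_in by blast
  moreover have "face_map n i k \<in> extensional (Icube n)"
    unfolding face_map_def by (rule restrict_extensional)
  ultimately show ?case
    by (simp add: PiE_iff)
next
  case (comp l m f n g)
  have "f \<in> Icube l \<rightarrow> Icube m" "g \<in> Icube m \<rightarrow> Icube n"
    using comp.IH unfolding PiE_def by blast+
  then have "compose (Icube l) g f \<in> Icube l \<rightarrow> Icube n"
    by (rule funcset_compose)
  moreover have "compose (Icube l) g f \<in> extensional (Icube l)"
    by (rule compose_extensional)
  ultimately show ?case
    unfolding PiE_def by blast
qed

text \<open>Any two morphisms with the same value on the identity agree (uniqueness of $x_\sharp$).\<close>

lemma sharp_unique:
  assumes f: "precubical_morphism (std_cube n) P f" and g: "precubical_morphism (std_cube n) P g"
    and eq: "f n (\<lambda>u\<in>Icube n. u) = g n (\<lambda>u\<in>Icube n. u)"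
    and h: "h \<in> cells (std_cube n) m"
  shows "f m h = g m h"
proof -
  have *: "box_mor m l h \<Longrightarrow>
       \<forall>e. box_mor l n e \<and> f l e = g l e \<longrightarrow> f m (compose (Icube m) e h) = g m (compose (Icube m) e h)"
    for m l h
  proof (induction rule: box_mor.induct)
    case (ident m)
    have "compose (Icube m) e (\<lambda>u\<in>Icube m. u) = e" if "box_mor m n e" for e
      using box_mor_in[OF that] by (intro ext) (auto simp: compose_def PiE_def extensional_def)
    then show ?case by metis
  next
    case (face i m k)
    show ?case
    proof (intro allI impI)
      fix e assume "box_mor (Suc m) n e \<and> f (Suc m) e = g (Suc m) e"
      moreover have "bd (std_cube n) (Suc m) i k e = compose (Icube m) e (face_map m i k)"
        by (simp add: std_cube_def)
      moreover have "e \<in> cells (std_cube n) (Suc m)" if "box_mor (Suc m) n e"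
        using that by (simp add: std_cube_def)
      ultimately show "f m (compose (Icube m) e (face_map m i k)) = g m (compose (Icube m) e (face_map m i k))"
        using f g face unfolding precubical_morphism_def
        by (metis diff_Suc_1 zero_less_Suc)
    qed
  next
    case (comp l m f' q g')
    show ?case
    proof (intro allI impI)
      fix e assume e: "box_mor q n e \<and> f q e = g q e"
      have "compose (Icube l) e (compose (Icube l) g' f') = compose (Icube l) (compose (Icube m) e g') f'"
        using box_mor_in[OF comp.hyps(1)] by (intro ext) (auto simp: compose_def)
      moreover have "box_mor m n (compose (Icube m) e g')"
        using e comp.hyps box_mor.comp by blast
      ultimately show "f l (compose (Icube l) e (compose (Icube l) g' f')) =
                       g l (compose (Icube l) e (compose (Icube l) g' f'))"
        using comp.IH e by simp
    qed
  qed
  have h': "box_mor m n h"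
    using h by (simp add: std_cube_def)
  have "compose (Icube m) (\<lambda>u\<in>Icube n. u) h = h"
    using box_mor_in[OF h'] by (intro ext) (auto simp: compose_def PiE_def extensional_def)
  then show ?thesis
    using *[OF h'] eq box_mor.ident by metis
qed

end

theory Submission
  imports Defs "HOL-Library.Confluence"
begin

text \<open>Choose coordinates \<open>(s, t)\<close> on the square \<open>x\<close> (reversed if \<open>b = 1\<close>) such that $d_a^{1-b}x$ is the
  edge \<open>s = 1\<close> and $d_{3-a}^bx$ is the edge \<open>t = 0\<close>. The d-space $|P|$ is deformed through d-maps by
  pushing the square linearly onto the edges \<open>s = 0\<close> and \<open>t = 1\<close>. The corner \<open>(1, 0)\<close> thereby slides
  along the edge \<open>s = 1\<close> to its other end, which collapses this edge and stretches the edges in \<open>Y\<close>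
  over it. By the hypotheses (i)-(iii), no other cell has to move, so at each time the
  deformation is the identity on $|R|$ and preserves $|Q|$, and it ends in $|Q|$. This yields the
  dihomotopy equivalence, and the statements on fundamental bipartite graphs and d-path spaces follow
  formally once the extremal points of both realizations are identified with the extremal vertices,
  all of which lie in $|R|$. For the latter, every point has a unique representative in an open cube
  because the face relation is confluent.\<close>

section \<open>d-spaces and dihomotopies\<close>

text \<open>Two demands on the deformation compete. It must preserve the order in
  \<open>(s, t)\<close>, so that d-paths stay d-paths, and it must keep $|Q|$ inside itself although
  $|Q|$ contains the edge \<open>s = 1\<close> but not the interior of the square. Sliding
  diagonally onto \<open>s = 0\<close> and \<open>t = 1\<close> respects the order but drags the
  edge \<open>s = 1\<close> through the interior. So this edge slides inside itself to
  \<open>(1, 1)\<close>, and the edge \<open>t = 0\<close> has to run over \<open>s = 0\<close> and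
  then over \<open>t = 1\<close>; hence the factors 2 in \<open>def_s\<close> and
  \<open>def_t\<close>. The moving corner also explains hypothesis (ii): for \<open>b = 0\<close>,
  an edge ending at the corner can be prolonged along \<open>s = 1\<close>, but a further edge
  starting there would first have to run backwards along \<open>s = 1\<close>. Another difficulty is
  that the image of one cube path may need two cubes, an edge of \<open>Y\<close> and then
  \<open>right\<close>. Therefore d-paths are described by subdivisions of an interval instead of by
  concatenations with fixed speed.\<close>

lemma dpath_comp_apply [simp]: "t \<in> {0..1} \<Longrightarrow> dpath_comp f \<omega> t = f (\<omega> t)"
  by (simp add: dpath_comp_def)

lemma dpaths_continuous: "is_dspace X \<Longrightarrow> \<omega> \<in> dpaths X \<Longrightarrow> continuous_map unit_top (dtop X) \<omega>"
  by (auto simp: is_dspace_def cont_maps_def)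

lemma dpaths_extensional: "is_dspace X \<Longrightarrow> \<omega> \<in> dpaths X \<Longrightarrow> \<omega> \<in> extensional {0..1}"
  by (auto simp: is_dspace_def cont_maps_def)

lemma dpaths_in_topspace:
  "is_dspace X \<Longrightarrow> \<omega> \<in> dpaths X \<Longrightarrow> t \<in> {0..1} \<Longrightarrow> \<omega> t \<in> topspace (dtop X)"
  using dpaths_continuous[of X \<omega>] by (auto simp: continuous_map_def)

lemma dpaths_reparam:
  "is_dspace X \<Longrightarrow> \<omega> \<in> dpaths X \<Longrightarrow> increasing_map \<phi> \<Longrightarrow> (\<lambda>t\<in>{0..1}. \<omega> (\<phi> t)) \<in> dpaths X"
  by (auto simp: is_dspace_def)

lemma dpaths_concat:
  "is_dspace X \<Longrightarrow> \<omega> \<in> dpaths X \<Longrightarrow> \<nu> \<in> dpaths X \<Longrightarrow> \<omega> 1 = \<nu> 0 \<Longrightarrow> concat_path \<omega> \<nu> \<in> dpaths X"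
  by (auto simp: is_dspace_def)

lemma dpaths_const: "is_dspace X \<Longrightarrow> p \<in> topspace (dtop X) \<Longrightarrow> const_path p \<in> dpaths X"
  by (auto simp: is_dspace_def)

lemma concat_path_in: "\<omega> ` {0..1} \<subseteq> S \<Longrightarrow> \<nu> ` {0..1} \<subseteq> S \<Longrightarrow> concat_path \<omega> \<nu> ` {0..1} \<subseteq> S"
  by (fastforce simp: concat_path_def)

lemma increasing_map_in: "increasing_map \<phi> \<Longrightarrow> t \<in> {0..1} \<Longrightarrow> \<phi> t \<in> {0..1}"
  by (force simp: increasing_map_def continuous_map_def)

lemma is_dspace_dsub:
  assumes "is_dspace X" shows "is_dspace (dsub X S)"
proof -
  have "(\<lambda>t\<in>{0..1}. \<omega> (\<phi> t)) ` {0..1} \<subseteq> S" if "\<omega> ` {0..1} \<subseteq> S" "increasing_map \<phi>"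
    for \<omega> and \<phi> :: "real \<Rightarrow> real"
    using increasing_map_in[OF that(2)] that(1) by fastforce
  moreover have "const_path p ` {0..1} \<subseteq> S" if "p \<in> S" for p
    using that by (auto simp: const_path_def)
  moreover have "continuous_map unit_top (subtopology (dtop X) S) \<omega>"
    if "\<omega> \<in> dpaths X" "\<omega> ` {0..1} \<subseteq> S" for \<omega>
    using dpaths_continuous[OF assms that(1)] that(2) by (auto simp: continuous_map_in_subtopology)
  ultimately show ?thesis
    using assms concat_path_in[of _ S] dpaths_extensional[OF assms]
    unfolding is_dspace_def dsub_def cont_maps_def by auto
qed

lemma dtop_dsub: "dtop (dsub X S) = subtopology (dtop X) S"
  and dpaths_dsub: "dpaths (dsub X S) = {\<omega> \<in> dpaths X. \<omega> ` {0..1} \<subseteq> S}"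
  by (simp_all add: dsub_def)

lemma topspace_dsub: "topspace (dtop (dsub X S)) = topspace (dtop X) \<inter> S"
  by (simp add: dsub_def)

lemma dsub_dsub: "A \<subseteq> S \<Longrightarrow> dsub (dsub X S) A = dsub X A"
  by (auto simp: dsub_def subtopology_subtopology Int_absorb1)

lemma dmap_cong:
  assumes "dmap X Y f" "\<And>p. p \<in> topspace (dtop X) \<Longrightarrow> f p = g p" shows "dmap X Y g"
proof -
  have "dpath_comp f \<omega> = dpath_comp g \<omega>" if "\<omega> \<in> dpaths X" for \<omega>
    using assms dpaths_in_topspace[of X \<omega>] that by (auto simp: dpath_comp_def dmap_def)
  then show ?thesis
    using assms continuous_map_eq[of "dtop X" "dtop Y" f g] unfolding dmap_def by auto
qed

lemma dmap_dsub:
  assumes "dmap X Y f" "\<And>p. p \<in> S \<Longrightarrow> p \<in> topspace (dtop X) \<Longrightarrow> f p \<in> T"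
  shows "dmap (dsub X S) (dsub Y T) f"
proof -
  have X: "is_dspace X" and Y: "is_dspace Y" using assms(1) by (auto simp: dmap_def)
  have "continuous_map (subtopology (dtop X) S) (subtopology (dtop Y) T) f"
    using assms by (auto simp: dmap_def continuous_map_in_subtopology
        intro: continuous_map_from_subtopology)
  moreover have "dpath_comp f \<omega> ` {0..1} \<subseteq> T" if "\<omega> \<in> dpaths X" "\<omega> ` {0..1} \<subseteq> S" for \<omega>
    using that assms(2) dpaths_in_topspace[OF X that(1)] by force
  ultimately show ?thesis
    using assms is_dspace_dsub[OF X] is_dspace_dsub[OF Y] unfolding dmap_def by (auto simp: dtop_dsub dpaths_dsub)
qed

lemma dsub_topspace: "is_dspace X \<Longrightarrow> dsub X (topspace (dtop X)) = X"
  using dpaths_in_topspace[of X] by (intro dspace.equality) (auto simp: dsub_def image_subset_iff)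

lemma dmap_id: "is_dspace X \<Longrightarrow> dmap X X id"
  using dpaths_extensional[of X]
  by (auto simp: dmap_def dpath_comp_def extensional_restrict simp flip: restrict_def)

lemma continuous_map_slice:
  assumes "continuous_map (prod_topology X unit_top) Y H" "t \<in> {0..1}"
  shows "continuous_map X Y (\<lambda>p. H (p, t))"
proof -
  have "continuous_map X (prod_topology X unit_top) (\<lambda>p. (p, t))"
    using assms(2) by (simp add: continuous_map_paired)
  then show ?thesis
    using continuous_map_compose[OF _ assms(1)] by (force simp: o_def)
qed

text \<open>Continuity of each stage follows from that of \<open>H\<close> by slicing, and
  \<open>f\<close> and \<open>g\<close> are d-maps as the stages at 0 and 1; only the effect of the
  stages on d-paths remains to be checked.\<close>

lemma dihomotopic_relI:
  assumes A: "dsubspace A X" and Y: "is_dspace Y"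
    and cont: "continuous_map (prod_topology (dtop X) unit_top) (dtop Y) H"
    and f: "\<And>p. p \<in> topspace (dtop X) \<Longrightarrow> H (p, 0) = f p"
    and g: "\<And>p. p \<in> topspace (dtop X) \<Longrightarrow> H (p, 1) = g p"
    and dp: "\<And>t \<omega>. t \<in> {0..1} \<Longrightarrow> \<omega> \<in> dpaths X \<Longrightarrow> dpath_comp (\<lambda>p. H (p, t)) \<omega> \<in> dpaths Y"
    and rel: "\<And>t p. t \<in> {0..1} \<Longrightarrow> p \<in> topspace (dtop A) \<Longrightarrow> H (p, t) = f p"
  shows "dihomotopic_rel A X Y f g"
proof -
  have X: "is_dspace X" using A by (simp add: dsubspace_def)
  have H: "dmap X Y (\<lambda>p. H (p, t))" if "t \<in> {0..1}" for t
    using X Y dp[OF that] continuous_map_slice[OF cont that] by (simp add: dmap_def)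
  have "dmap X Y f" "dmap X Y g"
    using dmap_cong[OF H[of 0]] dmap_cong[OF H[of 1]] f g by auto
  moreover have "f p = g p" if "p \<in> topspace (dtop A)" for p
  proof -
    have "p \<in> topspace (dtop X)"
      using that A by (auto simp: dsubspace_def topspace_dsub)
    then show ?thesis using rel[of 1 p] g that by simp
  qed
  ultimately show ?thesis
    using A cont f g H rel unfolding dihomotopic_rel_def by blast
qed

lemma dsubspace_topspace: "dsubspace A X \<Longrightarrow> topspace (dtop A) \<subseteq> topspace (dtop X)"
  by (auto simp: dsubspace_def topspace_dsub)

lemma dihomotopic_relE:
  assumes "dihomotopic_rel A X Y f g"
  obtains H where "continuous_map (prod_topology (dtop X) unit_top) (dtop Y) H"
    "\<And>p. p \<in> topspace (dtop X) \<Longrightarrow> H (p, 0) = f p" "\<And>p. p \<in> topspace (dtop X) \<Longrightarrow> H (p, 1) = g p"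
    "\<And>t. t \<in> {0..1} \<Longrightarrow> dmap X Y (\<lambda>p. H (p, t))"
    "\<And>t p. t \<in> {0..1} \<Longrightarrow> p \<in> topspace (dtop A) \<Longrightarrow> H (p, t) = f p"
  using assms unfolding dihomotopic_rel_def by blast

text \<open>The stage of \<open>K\<close> at time 1 is a dihomotopy inverse of the inclusion of
  \<open>S\<close>: \<open>K\<close> connects it with the identity of \<open>X\<close>, and since
  \<open>K\<close> never leaves \<open>S\<close>, its restriction does the same on
  \<open>S\<close>.\<close>

lemma deformation_dihomotopy_equivalence:
  assumes X: "is_dspace X" and S: "S \<subseteq> topspace (dtop X)" and AS: "A \<subseteq> S"
    and cont: "continuous_map (prod_topology (dtop X) unit_top) (dtop X) K"
    and dm: "\<And>t. t \<in> {0..1} \<Longrightarrow> dmap X X (\<lambda>p. K (p, t))"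
    and K0: "\<And>p. p \<in> topspace (dtop X) \<Longrightarrow> K (p, 0) = p"
    and KA: "\<And>p t. p \<in> A \<Longrightarrow> t \<in> {0..1} \<Longrightarrow> K (p, t) = p"
    and KS: "\<And>p t. p \<in> S \<Longrightarrow> t \<in> {0..1} \<Longrightarrow> K (p, t) \<in> S"
    and K1: "\<And>p. p \<in> topspace (dtop X) \<Longrightarrow> K (p, 1) \<in> S"
  shows "dihomotopy_equivalence_rel (dsub X A) (dsub X S) X id"
proof -
  let ?g = "\<lambda>p. K (p, 1)"
  \<comment> \<open>Time is reversed because the dihomotopies have to run from the composites to the
    identity.\<close>
  define H where "H = K \<circ> (\<lambda>(p, t). (p, 1 - t))"
  have "continuous_map (prod_topology (dtop X) unit_top) unit_top (\<lambda>q. 1 - snd q)"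
    by (auto simp: continuous_map_in_subtopology Pi_iff
        intro!: continuous_intros continuous_map_into_fulltopology[OF continuous_map_snd])
  then have "continuous_map (prod_topology (dtop X) unit_top) (prod_topology (dtop X) unit_top)
      (\<lambda>(p, t). (p, 1 - t))"
    unfolding case_prod_beta by (intro continuous_map_pairedI continuous_map_fst)
  from continuous_map_compose[OF this cont]
  have contH: "continuous_map (prod_topology (dtop X) unit_top) (dtop X) H"
    unfolding H_def .
  have Hdm: "dmap X X (\<lambda>p. H (p, t))" if "t \<in> {0..1}" for t
    using dm[of "1 - t"] that by (simp add: H_def)
  have sub: "dsubspace (dsub X A) X" "dsubspace (dsub X A) (dsub X S)"
    using X S AS is_dspace_dsub[OF X] unfolding dsubspace_def
    by (auto simp: topspace_dsub dsub_dsub intro!: exI[of _ A])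
  have "dihomotopic_rel (dsub X A) X X (id \<circ> ?g) id"
    using X contH Hdm K0 KA S AS
    by (intro dihomotopic_relI[where H = H]) (auto simp: sub H_def dmap_def topspace_dsub)
  moreover have "dihomotopic_rel (dsub X A) (dsub X S) (dsub X S) (?g \<circ> id) id"
  proof (rule dihomotopic_relI[where H = H])
    show "continuous_map (prod_topology (dtop (dsub X S)) unit_top) (dtop (dsub X S)) H"
    proof -
      have "prod_topology (subtopology (dtop X) S) unit_top
          = subtopology (prod_topology (dtop X) unit_top) (S \<times> {0..1})"
        using prod_topology_subtopology(1)[of "dtop X" S unit_top] by simp
      then show ?thesis
        using contH KS by (auto simp: dtop_dsub continuous_map_in_subtopology
          H_def simp del: prod_topology_subtopology intro!: continuous_map_from_subtopology)
    qed
    show "dpath_comp (\<lambda>p. H (p, t)) \<omega> \<in> dpaths (dsub X S)"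
      if "t \<in> {0..1}" "\<omega> \<in> dpaths (dsub X S)" for t \<omega>
    proof -
      have "dmap (dsub X S) (dsub X S) (\<lambda>p. H (p, t))"
        using Hdm[OF that(1)] KS[of _ "1 - t"] that(1) by (intro dmap_dsub) (auto simp: H_def)
      then show ?thesis using that(2) by (simp add: dmap_def)
    qed
  qed (use sub is_dspace_dsub[OF X] K0 KA S AS in \<open>auto simp: H_def topspace_dsub\<close>)
  moreover have "dmap X (dsub X S) ?g"
    using dmap_dsub[OF dm[of 1], of "topspace (dtop X)" S] K1 by (simp add: dsub_topspace X)
  moreover have "dmap (dsub X S) X id"
    using dmap_dsub[OF dmap_id[OF X], of S "topspace (dtop X)"] by (simp add: dsub_topspace X)
  ultimately show ?thesis
    unfolding dihomotopy_equivalence_rel_def using sub KA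
    by (auto simp: topspace_dsub intro!: exI[of _ ?g])
qed

section \<open>The fundamental category\<close>

lemma is_dspace_dinterval: "is_dspace dinterval"
proof -
  have "continuous_map unit_top unit_top (concat_path \<omega> \<nu>)"
    if "continuous_map unit_top unit_top \<omega>" "continuous_map unit_top unit_top \<nu>" "\<omega> 1 = \<nu> 0"
    for \<omega> \<nu> :: "real \<Rightarrow> real"
  proof -
    have "continuous_on {0..1} (\<omega> +++ \<nu>)" 
      using that continuous_on_joinpaths[of \<omega> \<nu>] 
      by (auto simp: path_def pathstart_def pathfinish_def path_join)
    then have "continuous_on {0..1} (concat_path \<omega> \<nu>)"
      by (rule continuous_on_eq) (auto simp: concat_path_def joinpaths_def)
    then show ?thesis
      using that concat_path_in[of \<omega> "{0..1}" \<nu>] by (auto simp: image_subset_iff_funcset)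
  qed
  moreover have "mono_on {0..1} (concat_path \<omega> \<nu>)"
    if "\<omega> \<in> {0..1} \<rightarrow> {0..1}" "\<nu> \<in> {0..1} \<rightarrow> {0..1}"
      "mono_on {0..1} \<omega>" "mono_on {0..1} \<nu>" "\<omega> 1 = \<nu> 0" for \<omega> \<nu> :: "real \<Rightarrow> real"
  proof (rule mono_onI)
    fix r s :: real assume *: "r \<in> {0..1}" "s \<in> {0..1}" "r \<le> s"
    \<comment> \<open>The common value at the joint separates the values of the two paths; this
      settles the case in which \<open>r\<close> and \<open>s\<close> lie in different
      halves.\<close>
    have "\<omega> u \<le> \<nu> v" if "u \<in> {0..1}" "v \<in> {0..1}" for u v
    proof -
      have "\<omega> u \<le> \<omega> 1" "\<nu> 0 \<le> \<nu> v"
        using that \<open>mono_on {0..1} \<omega>\<close> \<open>mono_on {0..1} \<nu>\<close> by (auto simp: mono_on_def)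
      then show ?thesis using \<open>\<omega> 1 = \<nu> 0\<close> by simp
    qed
    then show "concat_path \<omega> \<nu> r \<le> concat_path \<omega> \<nu> s"
      using * that(3,4) by (auto simp: concat_path_def mono_on_def)
  qed
  ultimately have "concat_path \<omega> \<nu> \<in> dpaths dinterval"
    if "\<omega> \<in> dpaths dinterval" "\<nu> \<in> dpaths dinterval" "\<omega> 1 = \<nu> 0" for \<omega> \<nu>
    using that by (auto simp: dinterval_def cont_maps_def concat_path_def)
  moreover have "(\<lambda>t\<in>{0..1}. \<omega> (\<phi> t)) \<in> dpaths dinterval"
    if "\<omega> \<in> dpaths dinterval" "increasing_map \<phi>" for \<omega> \<phi>
  proof -
    have "continuous_map unit_top unit_top (\<omega> \<circ> \<phi>)"
      using that by (auto simp: dinterval_def cont_maps_def increasing_map_def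
          o_def intro: continuous_on_compose2[of "{0..1}" \<omega>])
    then have "continuous_map unit_top unit_top (\<lambda>t\<in>{0..1}. \<omega> (\<phi> t))"
      by (rule continuous_map_eq) auto
    moreover have "mono_on {0..1} (\<lambda>t\<in>{0..1}. \<omega> (\<phi> t))"
      using that increasing_map_in[OF that(2)]
      by (auto simp: dinterval_def increasing_map_def mono_on_def)
    ultimately show ?thesis
      by (auto simp: dinterval_def cont_maps_def)
  qed
  moreover have "const_path p \<in> dpaths dinterval" if "p \<in> {0..1}" for p
    using that by (auto simp: dinterval_def cont_maps_def const_path_def mono_on_def
        intro: continuous_on_eq[OF continuous_on_const[of _ p]])
  ultimately show ?thesis
    unfolding is_dspace_def by (auto simp: dinterval_def)
qed

lemma dpaths_dintervalD: "\<phi> \<in> dpaths dinterval \<Longrightarrow> increasing_map \<phi>"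
  by (auto simp: dinterval_def cont_maps_def increasing_map_def)

lemma dtop_dinterval: "dtop dinterval = unit_top"
  by (simp add: dinterval_def)

text \<open>A d-map on the interval is recovered as the image of the identity path, which is
  increasing and hence a d-path.\<close>

lemma dpaths_dmap: "dmap dinterval X f \<Longrightarrow> (\<lambda>t\<in>{0..1}. f t) \<in> dpaths X"
proof -
  assume *: "dmap dinterval X f"
  have "(\<lambda>t\<in>{0..1}. t) \<in> dpaths dinterval"
    by (auto simp: dinterval_def cont_maps_def mono_on_def
        intro: continuous_on_eq[OF continuous_on_id])
  then have "dpath_comp f (\<lambda>t\<in>{0..1}. t) \<in> dpaths X"
    using * by (auto simp: dmap_def)
  then show ?thesis
    by (simp add: dpath_comp_def cong: restrict_cong)
qed

section \<open>Dihomotopy of paths relative to the endpoints\<close>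

abbreviation path_dihomotopic :: "'p dspace \<Rightarrow> (real \<Rightarrow> 'p) \<Rightarrow> (real \<Rightarrow> 'p) \<Rightarrow> bool" where
  "path_dihomotopic X \<equiv> dihomotopic_rel (dsub dinterval {0,1}) dinterval X"

text \<open>The d-paths of the interval are increasing maps and d-paths are closed under increasing
  reparametrization, so it is enough that every stage of \<open>H\<close> is itself a
  d-path.\<close>

lemma path_dihomotopicI:
  assumes X: "is_dspace X"
    and cont: "continuous_map (prod_topology unit_top unit_top) (dtop X) H"
    and dp: "\<And>t. t \<in> {0..1} \<Longrightarrow> (\<lambda>s\<in>{0..1}. H (s, t)) \<in> dpaths X"
    and 0: "\<And>s. s \<in> {0..1} \<Longrightarrow> H (s, 0) = \<omega> s"
    and 1: "\<And>s. s \<in> {0..1} \<Longrightarrow> H (s, 1) = \<nu> s"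
    and ends: "\<And>t. t \<in> {0..1} \<Longrightarrow> H (0, t) = \<omega> 0" "\<And>t. t \<in> {0..1} \<Longrightarrow> H (1, t) = \<omega> 1"
  shows "path_dihomotopic X \<omega> \<nu>"
proof (rule dihomotopic_relI[where H = H])
  show "dsubspace (dsub dinterval {0, 1}) dinterval"
    using is_dspace_dinterval unfolding dsubspace_def
    by (auto simp: dtop_dinterval intro!: exI[of _ "{0,1}"])
  show "dpath_comp (\<lambda>p. H (p, t)) \<phi> \<in> dpaths X" if "t \<in> {0..1}" "\<phi> \<in> dpaths dinterval" for t \<phi>
  proof -
    have \<phi>: "increasing_map \<phi>"
      using that dpaths_dintervalD by blast
    have "dpath_comp (\<lambda>p. H (p, t)) \<phi> = (\<lambda>s\<in>{0..1}. (\<lambda>s\<in>{0..1}. H (s, t)) (\<phi> s))"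
      using increasing_map_in[OF \<phi>] by (auto simp: dpath_comp_def)
    then show ?thesis
      using dpaths_reparam[OF X dp[OF that(1)] \<phi>] by simp
  qed
qed (use assms in \<open>auto simp: dtop_dinterval topspace_dsub\<close>)

lemma path_dihomotopicE:
  assumes "path_dihomotopic X \<omega> \<nu>"
  obtains H where "continuous_map (prod_topology unit_top unit_top) (dtop X) H"
    "\<And>t. t \<in> {0..1} \<Longrightarrow> (\<lambda>s\<in>{0..1}. H (s, t)) \<in> dpaths X"
    "\<And>s. s \<in> {0..1} \<Longrightarrow> H (s, 0) = \<omega> s" "\<And>s. s \<in> {0..1} \<Longrightarrow> H (s, 1) = \<nu> s"
    "\<And>t. t \<in> {0..1} \<Longrightarrow> H (0, t) = \<omega> 0" "\<And>t. t \<in> {0..1} \<Longrightarrow> H (1, t) = \<omega> 1"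
proof -
  obtain H where "continuous_map (prod_topology unit_top unit_top) (dtop X) H"
    "\<And>s. s \<in> {0..1} \<Longrightarrow> H (s, 0) = \<omega> s" "\<And>s. s \<in> {0..1} \<Longrightarrow> H (s, 1) = \<nu> s"
    "\<And>t. t \<in> {0..1} \<Longrightarrow> dmap dinterval X (\<lambda>p. H (p, t))"
    "\<And>t p. t \<in> {0..1} \<Longrightarrow> p \<in> {0,1} \<Longrightarrow> H (p, t) = \<omega> p"
    by (rule dihomotopic_relE[OF assms]) (auto simp: dtop_dinterval topspace_dsub)
  then show ?thesis
    using dpaths_dmap by (intro that[of H]) blast+
qed

lemma path_dihomotopic_dspace: "path_dihomotopic X \<omega> \<nu> \<Longrightarrow> is_dspace X"
  by (auto simp: dihomotopic_rel_def dmap_def)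

lemma path_dihomotopic_ends: "path_dihomotopic X \<omega> \<nu> \<Longrightarrow> \<omega> 0 = \<nu> 0 \<and> \<omega> 1 = \<nu> 1"
  by (auto simp: dihomotopic_rel_def topspace_dsub dtop_dinterval)

lemma path_dihomotopic_refl:
  assumes "is_dspace X" "\<omega> \<in> dpaths X" shows "path_dihomotopic X \<omega> \<omega>"
proof (rule path_dihomotopicI[where H = "\<omega> \<circ> fst"])
  show "continuous_map (prod_topology unit_top unit_top) (dtop X) (\<omega> \<circ> fst)"
    using dpaths_continuous[OF assms] continuous_map_compose[OF continuous_map_fst] by blast
  show "(\<lambda>s\<in>{0..1}. (\<omega> \<circ> fst) (s, t)) \<in> dpaths X" for t
    using assms dpaths_extensional[OF assms] by (simp add: extensional_restrict)
qed (use assms in auto)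

lemma continuous_map_unit_square:
  assumes "continuous_on ({0..1} \<times> {0..1}) f" "f ` ({0..1} \<times> {0..1}) \<subseteq> {0..1} \<times> {0..1}"
  shows "continuous_map (prod_topology unit_top unit_top) (prod_topology unit_top unit_top) 
           (f :: real \<times> real \<Rightarrow> real \<times> real)"
  using assms by (simp add: prod_topology_subtopology_eu image_subset_iff_funcset)

lemma path_dihomotopic_sym:
  assumes "path_dihomotopic X \<omega> \<nu>" shows "path_dihomotopic X \<nu> \<omega>"
proof -
  obtain H where H: "continuous_map (prod_topology unit_top unit_top) (dtop X) H"
    "\<And>t. t \<in> {0..1} \<Longrightarrow> (\<lambda>s\<in>{0..1}. H (s, t)) \<in> dpaths X"
    "\<And>s. s \<in> {0..1} \<Longrightarrow> H (s, 0) = \<omega> s" "\<And>s. s \<in> {0..1} \<Longrightarrow> H (s, 1) = \<nu> s"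
    "\<And>t. t \<in> {0..1} \<Longrightarrow> H (0, t) = \<omega> 0" "\<And>t. t \<in> {0..1} \<Longrightarrow> H (1, t) = \<omega> 1"
    using path_dihomotopicE[OF assms] by blast
  show ?thesis
  proof (rule path_dihomotopicI[where H = "H \<circ> (\<lambda>(s, t). (s, 1 - t))"])
    show "continuous_map (prod_topology unit_top unit_top) (dtop X) (H \<circ> (\<lambda>(s, t). (s, 1 - t)))"
      by (rule continuous_map_compose[OF continuous_map_unit_square H(1)])
        (auto simp: case_prod_beta intro!: continuous_intros)
  qed (use H path_dihomotopic_dspace[OF assms] path_dihomotopic_ends[OF assms] in auto)
qed

text \<open>Pasting of two squares. The cut is made where \<open>c\<close> equals 1/2: in the
  deformation parameter for transitivity, in the path parameter for concatenation.\<close>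

lemma continuous_map_unit_square_cases:
  assumes F: "continuous_map (prod_topology unit_top unit_top) X F"
    and G: "continuous_map (prod_topology unit_top unit_top) X G"
    and f: "continuous_on UNIV f" "\<And>p. p \<in> {0..1} \<times> {0..1} \<Longrightarrow> c p \<le> 1/2 \<Longrightarrow> f p \<in> {0..1} \<times> {0..1}"
    and g: "continuous_on UNIV g" "\<And>p. p \<in> {0..1} \<times> {0..1} \<Longrightarrow> 1/2 \<le> c p \<Longrightarrow> g p \<in> {0..1} \<times> {0..1}"
    and c: "continuous_on UNIV (c :: real \<times> real \<Rightarrow> real)"
    and eq: "\<And>p. p \<in> {0..1} \<times> {0..1} \<Longrightarrow> 2 * c p = 1 \<Longrightarrow> F (f p) = G (g p)"
  shows "continuous_map (prod_topology unit_top unit_top) X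
           (\<lambda>p. if c p \<le> 1/2 then F (f p) else G (g p))"
proof -
  let ?S = "{0..1} \<times> {0..1} :: (real \<times> real) set"
  have *: "continuous_map (subtopology (top_of_set ?S) T) X (\<lambda>p. F (f p))"
    if "continuous_map (top_of_set ?S) X F" "continuous_on UNIV f" "\<And>p. p \<in> ?S \<Longrightarrow> p \<in> T \<Longrightarrow> f p \<in> ?S"
    for F and f :: "real \<times> real \<Rightarrow> real \<times> real" and T
  proof -
    have "continuous_map (subtopology (top_of_set ?S) T) (top_of_set ?S) f"
      using that(2,3) by (auto simp: subtopology_subtopology intro: continuous_on_subset)
    from continuous_map_compose[OF this that(1)] show ?thesis by (simp add: o_def)
  qed
  show ?thesis
    unfolding prod_topology_subtopology_eu
  proof (rule continuous_map_cases_le)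
    show "continuous_map (top_of_set ?S) euclideanreal c"
      using c by (auto intro: continuous_on_subset)
  qed (use F G f g eq in \<open>auto simp: prod_topology_subtopology_eu intro!: *\<close>)
qed

lemma path_dihomotopic_trans:
  assumes "path_dihomotopic X \<omega> \<nu>" "path_dihomotopic X \<nu> \<mu>" shows "path_dihomotopic X \<omega> \<mu>"
proof -
  obtain H where H: "continuous_map (prod_topology unit_top unit_top) (dtop X) H"
    "\<And>t. t \<in> {0..1} \<Longrightarrow> (\<lambda>s\<in>{0..1}. H (s, t)) \<in> dpaths X"
    "\<And>s. s \<in> {0..1} \<Longrightarrow> H (s, 0) = \<omega> s" "\<And>s. s \<in> {0..1} \<Longrightarrow> H (s, 1) = \<nu> s"
    "\<And>t. t \<in> {0..1} \<Longrightarrow> H (0, t) = \<omega> 0" "\<And>t. t \<in> {0..1} \<Longrightarrow> H (1, t) = \<omega> 1"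
    using path_dihomotopicE[OF assms(1)] by blast
  obtain K where K: "continuous_map (prod_topology unit_top unit_top) (dtop X) K"
    "\<And>t. t \<in> {0..1} \<Longrightarrow> (\<lambda>s\<in>{0..1}. K (s, t)) \<in> dpaths X"
    "\<And>s. s \<in> {0..1} \<Longrightarrow> K (s, 0) = \<nu> s" "\<And>s. s \<in> {0..1} \<Longrightarrow> K (s, 1) = \<mu> s"
    "\<And>t. t \<in> {0..1} \<Longrightarrow> K (0, t) = \<nu> 0" "\<And>t. t \<in> {0..1} \<Longrightarrow> K (1, t) = \<nu> 1"
    using path_dihomotopicE[OF assms(2)] by blast
  let ?J = "\<lambda>p. if snd p \<le> 1/2 then H (fst p, 2 * snd p) else K (fst p, 2 * snd p - 1)"
  show ?thesis
  proof (rule path_dihomotopicI[where H = ?J])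
    show "continuous_map (prod_topology unit_top unit_top) (dtop X) ?J"
      by (rule continuous_map_unit_square_cases[OF H(1) K(1), where c = snd
            and f = "\<lambda>p. (fst p, 2 * snd p)" and g = "\<lambda>p. (fst p, 2 * snd p - 1)"])
        (use H(4) K(3) in \<open>auto simp: case_prod_beta intro!: continuous_intros\<close>)
    show "(\<lambda>s\<in>{0..1}. ?J (s, t)) \<in> dpaths X" if "t \<in> {0..1}" for t
      using H(2)[of "2 * t"] K(2)[of "2 * t - 1"] that by (cases "t \<le> 1/2") auto
  qed (use H K path_dihomotopic_dspace[OF assms(1)] path_dihomotopic_ends[OF assms(1)] in auto)
qed

lemma path_dihomotopic_concat:
  assumes "path_dihomotopic X \<omega> \<omega>'" "path_dihomotopic X \<nu> \<nu>'" and eq: "\<omega> 1 = \<nu> 0"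
  shows "path_dihomotopic X (concat_path \<omega> \<nu>) (concat_path \<omega>' \<nu>')"
proof -
  obtain H where H: "continuous_map (prod_topology unit_top unit_top) (dtop X) H"
    "\<And>t. t \<in> {0..1} \<Longrightarrow> (\<lambda>s\<in>{0..1}. H (s, t)) \<in> dpaths X"
    "\<And>s. s \<in> {0..1} \<Longrightarrow> H (s, 0) = \<omega> s" "\<And>s. s \<in> {0..1} \<Longrightarrow> H (s, 1) = \<omega>' s"
    "\<And>t. t \<in> {0..1} \<Longrightarrow> H (0, t) = \<omega> 0" "\<And>t. t \<in> {0..1} \<Longrightarrow> H (1, t) = \<omega> 1"
    using path_dihomotopicE[OF assms(1)] by blast
  obtain K where K: "continuous_map (prod_topology unit_top unit_top) (dtop X) K"
    "\<And>t. t \<in> {0..1} \<Longrightarrow> (\<lambda>s\<in>{0..1}. K (s, t)) \<in> dpaths X"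
    "\<And>s. s \<in> {0..1} \<Longrightarrow> K (s, 0) = \<nu> s" "\<And>s. s \<in> {0..1} \<Longrightarrow> K (s, 1) = \<nu>' s"
    "\<And>t. t \<in> {0..1} \<Longrightarrow> K (0, t) = \<nu> 0" "\<And>t. t \<in> {0..1} \<Longrightarrow> K (1, t) = \<nu> 1"
    using path_dihomotopicE[OF assms(2)] by blast
  let ?J = "\<lambda>p. if fst p \<le> 1/2 then H (2 * fst p, snd p) else K (2 * fst p - 1, snd p)"
  have X: "is_dspace X"
    using path_dihomotopic_dspace[OF assms(1)] .
  show ?thesis
  proof (rule path_dihomotopicI[OF X, where H = ?J])
    show "continuous_map (prod_topology unit_top unit_top) (dtop X) ?J"
      by (rule continuous_map_unit_square_cases[OF H(1) K(1), where c = fst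
            and f = "\<lambda>p. (2 * fst p, snd p)" and g = "\<lambda>p. (2 * fst p - 1, snd p)"])
        (use H(6) K(5) eq in \<open>auto simp: case_prod_beta intro!: continuous_intros\<close>)
    show "(\<lambda>s\<in>{0..1}. ?J (s, t)) \<in> dpaths X" if "t \<in> {0..1}" for t
    proof -
      have "concat_path (\<lambda>s\<in>{0..1}. H (s, t)) (\<lambda>s\<in>{0..1}. K (s, t)) \<in> dpaths X"
        using H(2,6) K(2,5) eq that by (intro dpaths_concat X) auto
      also have "concat_path (\<lambda>s\<in>{0..1}. H (s, t)) (\<lambda>s\<in>{0..1}. K (s, t)) = (\<lambda>s\<in>{0..1}. ?J (s, t))"
        by (auto simp: concat_path_def)
      finally show ?thesis .
    qed
  qed (use H K in \<open>auto simp: concat_path_def\<close>)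
qed

section \<open>Composition of classes and induced functors\<close>

lemma dclass_eq:
  "path_dihomotopic X \<omega> \<nu> \<Longrightarrow> dclass X \<omega> = dclass X \<nu>"
  unfolding dclass_def using path_dihomotopic_sym path_dihomotopic_trans by blast

lemma dclass_self: "is_dspace X \<Longrightarrow> \<omega> \<in> dpaths X \<Longrightarrow> \<omega> \<in> dclass X \<omega>"
  by (simp add: dclass_def path_dihomotopic_refl)

text \<open>Concatenation respects dihomotopy, so the union over all representatives is a nonempty
  union of copies of one class.\<close>

lemma Comp_dclass:
  assumes X: "is_dspace X" and "\<omega> \<in> dpaths X" "\<nu> \<in> dpaths X" "\<omega> 1 = \<nu> 0"
  shows "Comp (fund_cat X) (dclass X \<omega>) (dclass X \<nu>) = dclass X (concat_path \<omega> \<nu>)"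
proof -
  have "dclass X (concat_path \<omega>' \<nu>') = dclass X (concat_path \<omega> \<nu>)"
    if "\<omega>' \<in> dclass X \<omega>" "\<nu>' \<in> dclass X \<nu>" for \<omega>' \<nu>'
  proof -
    have "path_dihomotopic X \<omega> \<omega>'" "path_dihomotopic X \<nu> \<nu>'"
      using that by (simp_all add: dclass_def)
    from path_dihomotopic_concat[OF this assms(4)] show ?thesis
      by (rule dclass_eq[symmetric])
  qed
  then have "Comp (fund_cat X) (dclass X \<omega>) (dclass X \<nu>) =
      (\<Union>\<omega>'\<in>dclass X \<omega>. \<Union>\<nu>'\<in>dclass X \<nu>. dclass X (concat_path \<omega> \<nu>))"
    unfolding fund_cat_def cat.simps by (intro SUP_cong refl)
  then show ?thesis
    using dclass_self[OF X assms(2)] dclass_self[OF X assms(3)] by auto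
qed

lemma path_dihomotopic_dpath_comp:
  assumes f: "dmap X Y f" and "path_dihomotopic X \<omega> \<nu>"
  shows "path_dihomotopic Y (dpath_comp f \<omega>) (dpath_comp f \<nu>)"
proof -
  obtain H where H: "continuous_map (prod_topology unit_top unit_top) (dtop X) H"
    "\<And>t. t \<in> {0..1} \<Longrightarrow> (\<lambda>s\<in>{0..1}. H (s, t)) \<in> dpaths X"
    "\<And>s. s \<in> {0..1} \<Longrightarrow> H (s, 0) = \<omega> s" "\<And>s. s \<in> {0..1} \<Longrightarrow> H (s, 1) = \<nu> s"
    "\<And>t. t \<in> {0..1} \<Longrightarrow> H (0, t) = \<omega> 0" "\<And>t. t \<in> {0..1} \<Longrightarrow> H (1, t) = \<omega> 1"
    using path_dihomotopicE[OF assms(2)] by blast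
  show ?thesis
  proof (rule path_dihomotopicI[where H = "f \<circ> H"])
    show "continuous_map (prod_topology unit_top unit_top) (dtop Y) (f \<circ> H)"
      using f H(1) by (auto simp: dmap_def intro: continuous_map_compose)
    show "(\<lambda>s\<in>{0..1}. (f \<circ> H) (s, t)) \<in> dpaths Y" if "t \<in> {0..1}" for t
    proof -
      have "dpath_comp f (\<lambda>s\<in>{0..1}. H (s, t)) \<in> dpaths Y"
        using f H(2)[OF that] by (auto simp: dmap_def)
      then show ?thesis
        by (simp add: dpath_comp_def cong: restrict_cong)
    qed
  qed (use f H in \<open>auto simp: dmap_def\<close>)
qed

lemma fund_mor_dclass:
  assumes f: "dmap X Y f" and "\<omega> \<in> dpaths X"
  shows "fund_mor X Y f (dclass X \<omega>) = dclass Y (dpath_comp f \<omega>)"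
proof -
  have "dclass Y (dpath_comp f \<omega>') = dclass Y (dpath_comp f \<omega>)" if "\<omega>' \<in> dclass X \<omega>" for \<omega>'
    using dclass_eq[OF path_dihomotopic_dpath_comp[OF f]] that unfolding dclass_def by blast
  then have "fund_mor X Y f (dclass X \<omega>) = (\<Union>\<omega>'\<in>dclass X \<omega>. dclass Y (dpath_comp f \<omega>))"
    unfolding fund_mor_def by (rule SUP_cong[OF refl])
  moreover have "is_dspace X"
    using f by (auto simp: dmap_def)
  ultimately show ?thesis
    using dclass_self[OF _ assms(2)] by auto
qed

text \<open>The dihomotopy is evaluated along \<open>\<omega>\<close>. The ends of the intermediate
  paths stay fixed because those of \<open>\<omega>\<close> lie in \<open>A\<close>.\<close>

lemma path_dihomotopic_along:
  assumes "dihomotopic_rel A X Y f g" "\<omega> \<in> dpaths X" "\<omega> 0 \<in> topspace (dtop A)" "\<omega> 1 \<in> topspace (dtop A)"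
  shows "path_dihomotopic Y (dpath_comp f \<omega>) (dpath_comp g \<omega>)"
proof -
  obtain H where H: "continuous_map (prod_topology (dtop X) unit_top) (dtop Y) H"
    "\<And>p. p \<in> topspace (dtop X) \<Longrightarrow> H (p, 0) = f p" "\<And>p. p \<in> topspace (dtop X) \<Longrightarrow> H (p, 1) = g p"
    "\<And>t. t \<in> {0..1} \<Longrightarrow> dmap X Y (\<lambda>p. H (p, t))"
    "\<And>t p. t \<in> {0..1} \<Longrightarrow> p \<in> topspace (dtop A) \<Longrightarrow> H (p, t) = f p"
    using dihomotopic_relE[OF assms(1)] by blast
  have X: "is_dspace X" and Y: "is_dspace Y"
    using assms(1) by (auto simp: dihomotopic_rel_def dmap_def)
  show ?thesis
  proof (rule path_dihomotopicI[OF Y, where H = "H \<circ> (\<lambda>p. (\<omega> (fst p), snd p))"])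
    have "continuous_map (prod_topology unit_top unit_top) (dtop X) (\<omega> \<circ> fst)"
      using continuous_map_compose[OF continuous_map_fst dpaths_continuous[OF X assms(2)]] .
    then have "continuous_map (prod_topology unit_top unit_top) (prod_topology (dtop X) unit_top)
        (\<lambda>p. (\<omega> (fst p), snd p))"
      by (intro continuous_map_pairedI continuous_map_snd) (simp add: o_def)
    from continuous_map_compose[OF this H(1)]
    show "continuous_map (prod_topology unit_top unit_top) (dtop Y) (H \<circ> (\<lambda>p. (\<omega> (fst p), snd p)))" .
    show "(\<lambda>s\<in>{0..1}. (H \<circ> (\<lambda>p. (\<omega> (fst p), snd p))) (s, t)) \<in> dpaths Y" if "t \<in> {0..1}" for t
    proof -
      have "dpath_comp (\<lambda>p. H (p, t)) \<omega> \<in> dpaths Y"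
        using H(4)[OF that] assms(2) by (auto simp: dmap_def)
      then show ?thesis
        by (simp add: dpath_comp_def)
    qed
  qed (use H assms dpaths_in_topspace[OF X assms(2)] in auto)
qed

lemma fund_cat_simps [simp]:
  "Ob (fund_cat X) = topspace (dtop X)"
  "Hom (fund_cat X) p q = {dclass X \<omega> | \<omega>. \<omega> \<in> dpaths X \<and> \<omega> 0 = p \<and> \<omega> 1 = q}"
  "Ident (fund_cat X) p = dclass X (const_path p)"
  by (simp_all add: fund_cat_def)

lemma full_subcat_simps [simp]:
  "Ob (full_subcat C S) = Ob C \<inter> S" "Hom (full_subcat C S) = Hom C"
  "Ident (full_subcat C S) = Ident C" "Comp (full_subcat C S) = Comp C"
  by (simp_all add: full_subcat_def)

lemma is_functor_fund_mor:
  assumes f: "dmap X Y f" and ST: "\<And>p. p \<in> S \<Longrightarrow> p \<in> topspace (dtop X) \<Longrightarrow> f p \<in> T"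
  shows "is_functor (full_subcat (fund_cat X) S) (full_subcat (fund_cat Y) T) f (fund_mor X Y f)"
proof -
  have X: "is_dspace X" and Y: "is_dspace Y" and fp: "\<And>\<omega>. \<omega> \<in> dpaths X \<Longrightarrow> dpath_comp f \<omega> \<in> dpaths Y"
    and ft: "\<And>p. p \<in> topspace (dtop X) \<Longrightarrow> f p \<in> topspace (dtop Y)"
    using f by (auto simp: dmap_def continuous_map_def)
  have "fund_mor X Y f (dclass X \<omega>) \<in> Hom (fund_cat Y) (f (\<omega> 0)) (f (\<omega> 1))" if "\<omega> \<in> dpaths X" for \<omega>
    using fp[OF that] by (auto simp: fund_mor_dclass[OF f that] intro!: exI[of _ "dpath_comp f \<omega>"])
  moreover have "fund_mor X Y f (dclass X (const_path p)) = dclass Y (const_path (f p))"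
    if "p \<in> topspace (dtop X)" for p
  proof -
    have "dpath_comp f (const_path p) = const_path (f p)"
      by (auto simp: dpath_comp_def const_path_def)
    then show ?thesis
      using fund_mor_dclass[OF f dpaths_const[OF X that]] by simp
  qed
  moreover have "fund_mor X Y f (Comp (fund_cat X) (dclass X \<omega>) (dclass X \<nu>)) =
      Comp (fund_cat Y) (fund_mor X Y f (dclass X \<omega>)) (fund_mor X Y f (dclass X \<nu>))"
    if *: "\<omega> \<in> dpaths X" "\<nu> \<in> dpaths X" "\<omega> 1 = \<nu> 0" for \<omega> \<nu>
  proof -
    have "dpath_comp f (concat_path \<omega> \<nu>) = concat_path (dpath_comp f \<omega>) (dpath_comp f \<nu>)"
      by (auto simp: dpath_comp_def concat_path_def)
    then show ?thesis
      using * by (simp add: Comp_dclass[OF X] Comp_dclass[OF Y] fp fund_mor_dclass[OF f]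
          dpaths_concat[OF X])
  qed
  ultimately have
    mor: "\<And>\<omega>. \<omega> \<in> dpaths X \<Longrightarrow> fund_mor X Y f (dclass X \<omega>) \<in> Hom (fund_cat Y) (f (\<omega> 0)) (f (\<omega> 1))"
    and idt: "\<And>p. p \<in> topspace (dtop X) \<Longrightarrow> fund_mor X Y f (dclass X (const_path p)) = dclass Y (const_path (f p))"
    and cmp: "\<And>\<omega> \<nu>. \<omega> \<in> dpaths X \<Longrightarrow> \<nu> \<in> dpaths X \<Longrightarrow> \<omega> 1 = \<nu> 0 \<Longrightarrow>
      fund_mor X Y f (Comp (fund_cat X) (dclass X \<omega>) (dclass X \<nu>)) =
      Comp (fund_cat Y) (fund_mor X Y f (dclass X \<omega>)) (fund_mor X Y f (dclass X \<nu>))"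
    by blast+
  show ?thesis
    unfolding is_functor_def full_subcat_simps
  proof (intro conjI ballI funcsetI)
    fix p assume "p \<in> Ob (fund_cat X) \<inter> S"
    then show "f p \<in> Ob (fund_cat Y) \<inter> T" using ft ST by auto
  next
    fix p q \<alpha> assume "\<alpha> \<in> Hom (fund_cat X) p q"
    then obtain \<omega> where "\<alpha> = dclass X \<omega>" "\<omega> \<in> dpaths X" "\<omega> 0 = p" "\<omega> 1 = q"
      by auto
    then show "fund_mor X Y f \<alpha> \<in> Hom (fund_cat Y) (f p) (f q)"
      using mor by blast
  next
    fix p assume "p \<in> Ob (fund_cat X) \<inter> S"
    then show "fund_mor X Y f (Ident (fund_cat X) p) = Ident (fund_cat Y) (f p)"
      using idt by simp
  next
    fix p q r \<alpha> \<beta> assume "\<alpha> \<in> Hom (fund_cat X) p q" "\<beta> \<in> Hom (fund_cat X) q r"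
    then obtain \<omega> \<nu> where "\<alpha> = dclass X \<omega>" "\<omega> \<in> dpaths X" "\<omega> 0 = p" "\<omega> 1 = q"
      "\<beta> = dclass X \<nu>" "\<nu> \<in> dpaths X" "\<nu> 0 = q"
      unfolding fund_cat_simps by blast
    then show "fund_mor X Y f (Comp (fund_cat X) \<alpha> \<beta>)
        = Comp (fund_cat Y) (fund_mor X Y f \<alpha>) (fund_mor X Y f \<beta>)"
      using cmp by simp
  qed
qed

text \<open>Both maps of the equivalence fix \<open>A\<close> pointwise, hence are the identity on
  extremal points. A dihomotopy relative to \<open>A\<close> fixes the ends of d-paths between such
  points, so the induced maps on classes are mutually inverse.\<close>

lemma fund_bipartite_graph_iso:
  assumes eq: "dihomotopy_equivalence_rel A X Y f"
    and XY: "topspace (dtop (dextrl X)) = topspace (dtop (dextrl Y))"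
    and XA: "topspace (dtop (dextrl X)) \<subseteq> topspace (dtop A)"
  shows "is_cat_iso (fund_bipartite_graph X) (fund_bipartite_graph Y) f (fund_mor X Y f)"
proof -
  let ?E = "topspace (dtop (dextrl X))"
  obtain g where f: "dmap X Y f" "\<And>p. p \<in> topspace (dtop A) \<Longrightarrow> f p = p"
    and g: "dmap Y X g" "\<And>p. p \<in> topspace (dtop A) \<Longrightarrow> g p = p"
    and gf: "dihomotopic_rel A X X (g \<circ> f) id" and fg: "dihomotopic_rel A Y Y (f \<circ> g) id"
    using eq unfolding dihomotopy_equivalence_rel_def by blast
  \<comment> \<open>Stated for arbitrary \<open>X\<close>, \<open>Y\<close>, \<open>f\<close>,
    \<open>g\<close> so as to serve for both composites; \<open>?E\<close> is still the fixed set of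
    extremal points.\<close>
  have inv: "fund_mor Y X g (fund_mor X Y f \<alpha>) = \<alpha>"
    if "dmap X Y f" "dmap Y X g" "dihomotopic_rel A X X (g \<circ> f) id"
      "\<alpha> \<in> Hom (fund_cat X) p q" "p \<in> ?E" "q \<in> ?E" for X Y f g \<alpha> p q
  proof -
    obtain \<omega> where \<omega>: "\<alpha> = dclass X \<omega>" "\<omega> \<in> dpaths X" "\<omega> 0 = p" "\<omega> 1 = q"
      using \<open>\<alpha> \<in> _\<close> by auto
    have X: "is_dspace X"
      using \<open>dmap X Y f\<close> by (auto simp: dmap_def)
    have "dpath_comp g (dpath_comp f \<omega>) = dpath_comp (g \<circ> f) \<omega>" "dpath_comp id \<omega> = \<omega>"
      using dpaths_extensional[OF X \<omega>(2)] by (auto simp: dpath_comp_def extensional_def)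
    moreover have "path_dihomotopic X (dpath_comp (g \<circ> f) \<omega>) (dpath_comp id \<omega>)"
      using path_dihomotopic_along[OF that(3) \<omega>(2)] \<omega> that XA by auto
    moreover have "dpath_comp f \<omega> \<in> dpaths Y"
      using that(1) \<omega>(2) by (auto simp: dmap_def)
    ultimately show ?thesis
      using \<omega> dclass_eq[of X] by (simp add: fund_mor_dclass[OF that(1)] fund_mor_dclass[OF that(2)])
  qed
  have "is_functor (fund_bipartite_graph X) (fund_bipartite_graph Y) f (fund_mor X Y f)"
    unfolding fund_bipartite_graph_def using f XA XY by (intro is_functor_fund_mor) auto
  moreover have "is_functor (fund_bipartite_graph Y) (fund_bipartite_graph X) g (fund_mor Y X g)"
    unfolding fund_bipartite_graph_def using g XA XY by (intro is_functor_fund_mor) auto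
  ultimately show ?thesis
    unfolding is_cat_iso_def
  proof (intro conjI exI[of _ g] exI[of _ "fund_mor Y X g"] ballI)
    have Ob: "Ob (fund_bipartite_graph X) = ?E" "Ob (fund_bipartite_graph Y) = ?E"
      using XY by (auto simp: fund_bipartite_graph_def topspace_dsub dextrl_def)
    have Hom: "Hom (fund_bipartite_graph Z) = Hom (fund_cat Z)" for Z :: "'a dspace"
      by (simp add: fund_bipartite_graph_def)
    fix p q
    show "p \<in> Ob (fund_bipartite_graph X) \<Longrightarrow> g (f p) = p"
      "p \<in> Ob (fund_bipartite_graph Y) \<Longrightarrow> f (g p) = p"
      using f g XA unfolding Ob by auto
    show "fund_mor Y X g (fund_mor X Y f \<alpha>) = \<alpha>"
      if "p \<in> Ob (fund_bipartite_graph X)" "q \<in> Ob (fund_bipartite_graph X)"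
        "\<alpha> \<in> Hom (fund_bipartite_graph X) p q" for \<alpha>
      using inv[OF f(1) g(1) gf] that unfolding Ob Hom by blast
    show "fund_mor X Y f (fund_mor Y X g \<alpha>) = \<alpha>"
      if "p \<in> Ob (fund_bipartite_graph Y)" "q \<in> Ob (fund_bipartite_graph Y)"
        "\<alpha> \<in> Hom (fund_bipartite_graph Y) p q" for \<alpha>
      using inv[OF g(1) f(1) fg] that unfolding Ob Hom by blast
  qed
qed

section \<open>Spaces of d-paths\<close>

lemma topspace_dpath_space:
  assumes "is_dspace X"
  shows "topspace (dpath_space X p q) = {\<omega> \<in> dpaths X. \<omega> 0 = p \<and> \<omega> 1 = q}"
  using assms by (auto simp: dpath_space_def topspace_compact_open is_dspace_def)

lemma openin_dpath_space:
  assumes "compactin unit_top K" "openin (dtop X) U"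
  shows "openin (dpath_space X p q) {\<omega> \<in> topspace (dpath_space X p q). \<omega> ` K \<subseteq> U}"
proof -
  have "openin (compact_open_topology unit_top (dtop X)) {\<omega> \<in> cont_maps unit_top (dtop X). \<omega> ` K \<subseteq> U}"
    unfolding compact_open_topology_def using assms by (intro topology_generated_by_Basis) auto
  then show ?thesis
    unfolding dpath_space_def openin_subtopology by (auto simp: topspace_compact_open)
qed

text \<open>The sets of paths that map \<open>K\<close> into \<open>U\<close> generate the
  compact-open topology, so continuity need only be tested on them, locally at each point.\<close>

lemma continuous_map_into_dpath_space:
  assumes Y: "is_dspace Y"
    and F: "\<And>z. z \<in> topspace Z \<Longrightarrow> F z \<in> topspace (dpath_space Y p q)"
    and nb: "\<And>z K U. z \<in> topspace Z \<Longrightarrow> compact K \<Longrightarrow> K \<subseteq> {0..1} \<Longrightarrow> openin (dtop Y) U \<Longrightarrow> F z ` K \<subseteq> U \<Longrightarrow>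
      \<exists>N. openin Z N \<and> z \<in> N \<and> (\<forall>z'\<in>N. F z' ` K \<subseteq> U)"
  shows "continuous_map Z (dpath_space Y p q) F"
proof -
  have cm: "F z \<in> cont_maps unit_top (dtop Y)" if "z \<in> topspace Z" for z
    using F[OF that] by (auto simp: dpath_space_def topspace_compact_open)
  have "openin Z (F -` W \<inter> topspace Z)"
    if W: "W \<in> {{f \<in> cont_maps unit_top (dtop Y). f ` K \<subseteq> U} | K U. compactin unit_top K \<and> openin (dtop Y) U}" for W
  proof -
    obtain K U where W: "W = {f \<in> cont_maps unit_top (dtop Y). f ` K \<subseteq> U}"
      and K: "compact K" "K \<subseteq> {0..1}" and U: "openin (dtop Y) U"
      using W by (auto simp: compactin_subtopology)
    show ?thesis
    proof (subst openin_subopen, intro ballI)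
      fix z assume "z \<in> F -` W \<inter> topspace Z"
      then obtain N where "openin Z N" "z \<in> N" "\<forall>z'\<in>N. F z' ` K \<subseteq> U"
        using nb[OF _ K U, of z] unfolding W by blast
      then show "\<exists>T. openin Z T \<and> z \<in> T \<and> T \<subseteq> F -` W \<inter> topspace Z"
        using cm openin_subset[of Z N] by (intro exI[of _ N]) (auto simp: W)
    qed
  qed
  moreover have "F ` topspace Z \<subseteq> \<Union>{{f \<in> cont_maps unit_top (dtop Y). f ` K \<subseteq> U} | K U. compactin unit_top K \<and> openin (dtop Y) U}"
    using topspace_compact_open[of unit_top "dtop Y"] cm
    unfolding compact_open_topology_def topology_generated_by_topspace by blast
  ultimately have "continuous_map Z (compact_open_topology unit_top (dtop Y)) F"
    unfolding compact_open_topology_def continuous_on_generated_topo_iff by blast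
  then show ?thesis
    using F by (auto simp: dpath_space_def continuous_map_in_subtopology)
qed

text \<open>The homotopy applies all stages of the dihomotopy to a d-path. Its ends do not move,
  since \<open>p\<close> and \<open>q\<close> lie in \<open>A\<close>. The work lies in joint
  continuity in time and path, which is obtained by covering \<open>K\<close> with finitely many
  small intervals.\<close>

lemma homotopic_dpath_comp:
  assumes fg: "dihomotopic_rel A X Y f g" and p: "p \<in> topspace (dtop A)" and q: "q \<in> topspace (dtop A)"
  shows "homotopic_with (\<lambda>_. True) (dpath_space X p q) (dpath_space Y (f p) (f q)) (dpath_comp f) (dpath_comp g)"
proof -
  obtain H where H: "continuous_map (prod_topology (dtop X) unit_top) (dtop Y) H"
    "\<And>p. p \<in> topspace (dtop X) \<Longrightarrow> H (p, 0) = f p" "\<And>p. p \<in> topspace (dtop X) \<Longrightarrow> H (p, 1) = g p"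
    "\<And>t. t \<in> {0..1} \<Longrightarrow> dmap X Y (\<lambda>p. H (p, t))"
    "\<And>t p. t \<in> {0..1} \<Longrightarrow> p \<in> topspace (dtop A) \<Longrightarrow> H (p, t) = f p"
    using dihomotopic_relE[OF fg] by blast
  have X: "is_dspace X" and Y: "is_dspace Y"
    using fg by (auto simp: dihomotopic_rel_def dmap_def)
  let ?X = "dpath_space X p q" and ?Y = "dpath_space Y (f p) (f q)"
  define F where "F = (\<lambda>z. dpath_comp (\<lambda>p. H (p, fst z)) (snd z))"
  have "continuous_map (prod_topology unit_top ?X) ?Y F"
  proof (rule continuous_map_into_dpath_space[OF Y])
    fix z assume z: "z \<in> topspace (prod_topology unit_top ?X)"
    then obtain t \<omega> where t: "z = (t, \<omega>)" "t \<in> {0..1}" and \<omega>: "\<omega> \<in> dpaths X" "\<omega> 0 = p" "\<omega> 1 = q"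
      by (auto simp: topspace_dpath_space[OF X])
    show "F z \<in> topspace ?Y"
      using H(4)[OF t(2)] H(5)[OF t(2)] t \<omega> p q by (auto simp: F_def topspace_dpath_space[OF Y] dmap_def)
    fix K U assume K: "compact K" "K \<subseteq> {0..1}" and U: "openin (dtop Y) U" and KU: "F z ` K \<subseteq> U"
    have open_pre: "openin (prod_topology (dtop X) unit_top) {w \<in> topspace (prod_topology (dtop X) unit_top). H w \<in> U}"
      using H(1) U by (rule openin_continuous_map_preimage)
    \<comment> \<open>The neighbourhood of \<open>s\<close> comes in two versions: a compact one,
      \<open>C\<close>, because only compact sets yield open conditions on paths, and an open one,
      \<open>D\<close>, for the covering of \<open>K\<close>.\<close>
    have "\<exists>V W C. openin (dtop X) V \<and> openin unit_top W \<and> t \<in> W \<and> compact C \<and> C \<subseteq> {0..1} \<and>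
        (\<exists>D. open D \<and> s \<in> D \<and> D \<inter> {0..1} \<subseteq> C) \<and> \<omega> ` C \<subseteq> V \<and> H ` (V \<times> W) \<subseteq> U" if s: "s \<in> K" for s
    proof -
      have "s \<in> {0..1}" using s K by auto
      then have "H (\<omega> s, t) \<in> U"
        using KU s t by (auto simp: F_def)
      then have "(\<omega> s, t) \<in> {w \<in> topspace (prod_topology (dtop X) unit_top). H w \<in> U}"
        using dpaths_in_topspace[OF X \<omega>(1) \<open>s \<in> {0..1}\<close>] t by auto
      from open_pre[unfolded openin_prod_topology_alt, rule_format, OF this]
      obtain V W where VW: "openin (dtop X) V" "openin unit_top W" "\<omega> s \<in> V" "t \<in> W"
        "V \<times> W \<subseteq> {w \<in> topspace (prod_topology (dtop X) unit_top). H w \<in> U}"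
        by (elim exE conjE)
      have "openin unit_top {r \<in> topspace unit_top. \<omega> r \<in> V}"
        using dpaths_continuous[OF X \<omega>(1)] VW(1) by (rule openin_continuous_map_preimage)
      then obtain G where G: "open G" "{r \<in> {0..1}. \<omega> r \<in> V} = {0..1} \<inter> G"
        by (auto simp: openin_open)
      then have "s \<in> G"
        using VW(3) \<open>s \<in> {0..1}\<close> by auto
      then obtain e where e: "e > 0" "cball s e \<subseteq> G"
        using G(1) open_contains_cball by blast
      have "\<omega> ` (cball s e \<inter> {0..1}) \<subseteq> V"
        using e(2) G(2) by blast
      moreover have "H ` (V \<times> W) \<subseteq> U"
        using VW(5) by blast
      moreover have "ball s e \<inter> {0..1} \<subseteq> cball s e \<inter> {0..1}" "s \<in> ball s e"
        using e(1) by auto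
      moreover have "compact (cball s e \<inter> {0..1})" "cball s e \<inter> {0..1} \<subseteq> {0..1}"
        by (simp_all add: compact_Int)
      ultimately show ?thesis
        using VW(1,2,4) open_ball by metis
    qed
    then obtain V W C D where VWCD: "\<And>s. s \<in> K \<Longrightarrow> openin (dtop X) (V s) \<and> openin unit_top (W s) \<and> t \<in> W s \<and>
        compact (C s) \<and> C s \<subseteq> {0..1} \<and> open (D s) \<and> s \<in> D s \<and> D s \<inter> {0..1} \<subseteq> C s \<and>
        \<omega> ` C s \<subseteq> V s \<and> H ` (V s \<times> W s) \<subseteq> U"
      by metis
    obtain J where J: "J \<subseteq> K" "finite J" "K \<subseteq> \<Union>(D ` J)"
      by (rule compactE_image[OF K(1), of K D]) (use VWCD in blast)+
    \<comment> \<open>The factors \<open>{0..1}\<close> and \<open>topspace ?X\<close> keep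
      \<open>N\<close> open in the right space even if the finite cover is empty.\<close>
    define N where "N = ({0..1} \<inter> (\<Inter>s\<in>J. W s)) \<times> (topspace ?X \<inter> (\<Inter>s\<in>J. {\<nu> \<in> topspace ?X. \<nu> ` C s \<subseteq> V s}))"
    have "openin unit_top ({0..1} \<inter> (\<Inter>s\<in>J. W s))"
      using openin_Int_Inter[of "W ` J" unit_top "{0..1}"] J VWCD by auto
    moreover have "openin ?X (topspace ?X \<inter> (\<Inter>s\<in>J. {\<nu> \<in> topspace ?X. \<nu> ` C s \<subseteq> V s}))"
      using J VWCD by (intro openin_Int_Inter[of "(\<lambda>s. {\<nu> \<in> topspace ?X. \<nu> ` C s \<subseteq> V s}) ` J"])
        (auto intro!: openin_dpath_space simp: compactin_subtopology)
    ultimately have "openin (prod_topology unit_top ?X) N"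
      unfolding N_def by (simp add: openin_prod_Times_iff)
    moreover have "z \<in> N"
      using z t VWCD J(1) by (auto simp: N_def)
    moreover have "F z' ` K \<subseteq> U" if "z' \<in> N" for z'
    proof
      fix y assume "y \<in> F z' ` K"
      then obtain s where s: "s \<in> K" "y = F z' s" by blast
      then obtain j where j: "j \<in> J" "s \<in> D j" using J by blast
      then have "s \<in> C j" using VWCD[of j] J s K by blast
      moreover have "snd z' ` C j \<subseteq> V j" "fst z' \<in> W j"
        using that j unfolding N_def mem_Times_iff by blast+
      ultimately have "snd z' s \<in> V j" "fst z' \<in> W j"
        by auto
      then have "H (snd z' s, fst z') \<in> U"
        using VWCD[of j] J j by blast
      then show "y \<in> U"
        using s K by (auto simp: F_def dpath_comp_def)
    qed
    ultimately show "\<exists>N. openin (prod_topology unit_top ?X) N \<and> z \<in> N \<and> (\<forall>z'\<in>N. F z' ` K \<subseteq> U)"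
      by blast
  qed
  moreover have "dpath_comp (\<lambda>p. H (p, 0)) \<omega> = dpath_comp f \<omega>"
    "dpath_comp (\<lambda>p. H (p, 1)) \<omega> = dpath_comp g \<omega>" if "\<omega> \<in> dpaths X" for \<omega>
    using H(2,3) dpaths_in_topspace[OF X that] by (auto simp: dpath_comp_def)
  ultimately show ?thesis
    by (subst homotopic_with) (auto simp: F_def topspace_dpath_space[OF X] intro!: exI[of _ F])
qed

lemma dihomotopic_rel_refl: "dsubspace A X \<Longrightarrow> dmap X Y f \<Longrightarrow> dihomotopic_rel A X Y f f"
  by (rule dihomotopic_relI[where H = "f \<circ> fst"])
    (auto simp: dmap_def o_def intro: continuous_map_compose[OF continuous_map_fst, unfolded o_def])

text \<open>This is the case of the constant dihomotopy, taken relative to all of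
  \<open>X\<close>.\<close>

lemma continuous_map_dpath_comp:
  assumes f: "dmap X Y f" and p: "p \<in> topspace (dtop X)" "q \<in> topspace (dtop X)"
  shows "continuous_map (dpath_space X p q) (dpath_space Y (f p) (f q)) (dpath_comp f)"
proof -
  have "is_dspace X" using f by (simp add: dmap_def)
  then have "dsubspace X X"
    by (auto simp: dsubspace_def dsub_topspace intro!: exI[of _ "topspace (dtop X)"])
  then show ?thesis
    using homotopic_with_imp_continuous_maps[OF homotopic_dpath_comp[OF dihomotopic_rel_refl[OF _ f]]] p
    by blast
qed

lemma dpath_space_homotopy_equivalence:
  assumes eq: "dihomotopy_equivalence_rel A X Y f"
    and p: "p \<in> topspace (dtop A)" "q \<in> topspace (dtop A)"
  shows "homotopy_equivalence_map (dpath_space X p q) (dpath_space Y p q) (dpath_comp f)"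
proof -
  obtain g where f: "dmap X Y f" "\<And>p. p \<in> topspace (dtop A) \<Longrightarrow> f p = p"
    and g: "dmap Y X g" "\<And>p. p \<in> topspace (dtop A) \<Longrightarrow> g p = p"
    and gf: "dihomotopic_rel A X X (g \<circ> f) id" and fg: "dihomotopic_rel A Y Y (f \<circ> g) id"
    and A: "dsubspace A X" "dsubspace A Y"
    using eq unfolding dihomotopy_equivalence_rel_def by blast
  have *: "homotopic_with (\<lambda>_. True) (dpath_space X p q) (dpath_space X p q) (dpath_comp g \<circ> dpath_comp f) id"
    if "dihomotopic_rel A X X (g \<circ> f) id" "g (f p) = p" "g (f q) = q" for X f g
  proof -
    have X: "is_dspace X"
      using that by (auto simp: dihomotopic_rel_def dmap_def)
    have "dpath_comp g (dpath_comp f \<omega>) = dpath_comp (g \<circ> f) \<omega>" "dpath_comp id \<omega> = \<omega>"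
      if "\<omega> \<in> dpaths X" for \<omega>
      using dpaths_extensional[OF X that] by (auto simp: dpath_comp_def extensional_def)
    moreover have "homotopic_with (\<lambda>_. True) (dpath_space X p q) (dpath_space X p q)
        (dpath_comp (g \<circ> f)) (dpath_comp id)"
      using homotopic_dpath_comp[OF that(1) p] that(2,3) by simp
    ultimately show ?thesis
      by (elim homotopic_with_eq) (auto simp: topspace_dpath_space[OF X])
  qed
  have pX: "p \<in> topspace (dtop X)" "q \<in> topspace (dtop X)" "p \<in> topspace (dtop Y)" "q \<in> topspace (dtop Y)"
    using A p dsubspace_topspace by blast+
  show ?thesis
    unfolding homotopy_equivalence_map_def
    using continuous_map_dpath_comp[OF f(1) pX(1,2)] continuous_map_dpath_comp[OF g(1) pX(3,4)]
      *[OF gf] *[OF fg] f(2)[OF p(1)] f(2)[OF p(2)] g(2)[OF p(1)] g(2)[OF p(2)] by auto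
qed

section \<open>Normal forms in the geometric realization\<close>

lemma Icube_le: "u \<in> Icube n \<Longrightarrow> i \<in> {1..n} \<Longrightarrow> 0 \<le> u i \<and> u i \<le> 1"
  unfolding Icube_def by (auto dest: PiE_mem)

lemma Icube_eqI: "u \<in> Icube n \<Longrightarrow> v \<in> Icube n \<Longrightarrow> (\<And>i. i \<in> {1..n} \<Longrightarrow> u i = v i) \<Longrightarrow> u = v"
  unfolding Icube_def by (rule PiE_ext)

lemma Icube_restrictI: "(\<And>i. i \<in> {1..n} \<Longrightarrow> 0 \<le> f i \<and> f i \<le> 1) \<Longrightarrow> (\<lambda>i\<in>{1..n}. f i) \<in> Icube n"
  by (auto simp: Icube_def)

lemma Icube_0: "Icube 0 = {pt0}"
  by (auto simp: Icube_def pt0_def)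

lemma face_map_apply:
  "u \<in> Icube n \<Longrightarrow> j \<in> {1..Suc n} \<Longrightarrow>
    face_map n i k u j = (if j < i then u j else if j = i then real k else u (j - 1))"
  by (simp add: face_map_def)

text \<open>Deletion of coordinate \<open>i\<close>, a retraction of \<open>face_map m i k\<close>
  for either value of \<open>k\<close>.\<close>

definition face_del :: "nat \<Rightarrow> nat \<Rightarrow> (nat \<Rightarrow> real) \<Rightarrow> nat \<Rightarrow> real" where
  "face_del m i u = (\<lambda>j\<in>{1..m}. if j < i then u j else u (Suc j))"

lemma face_del_in: "u \<in> Icube (Suc m) \<Longrightarrow> face_del m i u \<in> Icube m"
  unfolding face_del_def by (rule Icube_restrictI) (simp add: Icube_le)

lemma face_map_del:
  assumes "u \<in> Icube (Suc m)" "i \<in> {1..Suc m}" "k \<in> {0,1}" "u i = real k"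
  shows "face_map m i k (face_del m i u) = u"
proof (rule Icube_eqI[OF face_map_in assms(1)])
  fix j assume "j \<in> {1..Suc m}"
  then show "face_map m i k (face_del m i u) j = u j"
    using assms by (auto simp: face_map_apply face_del_in) (auto simp: face_del_def)
qed (use assms face_del_in in auto)

lemma face_del_map:
  assumes "u \<in> Icube m" "i \<in> {1..Suc m}"
  shows "face_del m i (face_map m i k u) = u"
proof (rule Icube_eqI[OF _ assms(1)])
  show "face_del m i (face_map m i k u) j = u j" if "j \<in> {1..m}" for j
    using assms that by (auto simp: face_map_apply face_del_def)
  show "face_del m i (face_map m i k u) \<in> Icube m"
    unfolding face_del_def
    by (rule Icube_restrictI) (use assms Icube_le[OF assms(1)] in \<open>auto simp: face_map_apply\<close>)
qed

lemma face_map_inj: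
  "u \<in> Icube m \<Longrightarrow> v \<in> Icube m \<Longrightarrow> i \<in> {1..Suc m} \<Longrightarrow> face_map m i k u = face_map m i k v \<Longrightarrow> u = v"
  by (metis face_del_map)

text \<open>The cocubical identity, dual to the identity for the boundary operators.\<close>

lemma face_map_face_map:
  assumes "u \<in> Icube m" "1 \<le> i" "i < j" "j \<le> Suc (Suc m)" "k \<in> {0,1}" "l \<in> {0,1}"
  shows "face_map (Suc m) j l (face_map m i k u) = face_map (Suc m) i k (face_map m (j - 1) l u)"
proof (rule Icube_eqI)
  show "face_map (Suc m) j l (face_map m i k u) h = face_map (Suc m) i k (face_map m (j - 1) l u) h"
    if h: "h \<in> {1..Suc (Suc m)}" for h
  proof -
    obtain j' where j': "j = Suc j'"
      using assms(3) by (cases j) auto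
    have "face_map m i k u \<in> Icube (Suc m)" "face_map m j' l u \<in> Icube (Suc m)"
      using assms j' by (auto intro!: face_map_in)
    note * = this[THEN face_map_apply] face_map_apply[OF assms(1)]
    obtain h' where h': "h = Suc h'"
      using h by (cases h) auto
    consider "h < i" | "h = i" | "i < h" "h < j" | "h = j" | "j < h" by linarith
    then show ?thesis
      using h assms(2-4) unfolding j' h' by cases (auto simp: *)
  qed
qed (use assms in \<open>auto intro!: face_map_in\<close>)

lemma bd_in: "precubical_set P \<Longrightarrow> x \<in> cells P n \<Longrightarrow> 0 < n \<Longrightarrow> i \<in> {1..n} \<Longrightarrow> k \<in> {0,1} \<Longrightarrow> bd P n i k x \<in> cells P (n - 1)"
  by (auto simp: precubical_set_def)

lemma bd_bd:
  assumes "precubical_set P" "x \<in> cells P n" "1 \<le> i" "i < j" "j \<le> n" "k \<in> {0,1}" "l \<in> {0,1}"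
  shows "bd P (n - 1) i k (bd P n j l x) = bd P (n - 1) (j - 1) l (bd P n i k x)"
  using conjunct2[OF assms(1)[unfolded precubical_set_def], rule_format, of k l x n i j] assms(2-)
  by simp

text \<open>A point on two different faces of a cube lies on a common face of codimension two. The
  precubical identity makes the two ways of descending to this face agree.\<close>

lemma glue_diamond_less:
  assumes P: "precubical_set P" and x: "x \<in> cells P (Suc n)"
    and ij: "1 \<le> i" "i < j" "j \<le> Suc n" and kl: "k \<in> {0,1}" "l \<in> {0,1}"
    and u: "u \<in> Icube n" "u' \<in> Icube n" and eq: "face_map n i k u = face_map n j l u'"
  shows "\<exists>s. glue P s (n, bd P (Suc n) i k x, u) \<and> glue P s (n, bd P (Suc n) j l x, u')"
proof -
  obtain m where n: "n = Suc m"
    using ij by (cases n) auto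
  \<comment> \<open>As \<open>i < j\<close>, the coordinate \<open>i\<close> of \<open>u'\<close> is
    also a coordinate of the common point, hence equal to \<open>k\<close>; deleting it leads to the
    common face.\<close>
  define w where "w = face_del m i u'"
  have w: "w \<in> Icube m"
    using u(2) by (simp add: w_def n face_del_in)
  have "u' i = face_map n j l u' i" "face_map n i k u i = real k"
    using u ij by (simp_all add: face_map_apply)
  then have u': "u' = face_map m i k w"
    using eq face_map_del[of u' m i k] u ij kl by (simp add: w_def n)
  then have "face_map n i k u = face_map n i k (face_map m (j - 1) l w)"
    using eq face_map_face_map[OF w ij(1,2) _ kl] ij by (simp add: n)
  then have u_eq: "u = face_map m (j - 1) l w"
    using u(1) ij kl w unfolding n by (intro face_map_inj[of u "Suc m" _ i k] face_map_in) auto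
  have "bd P (Suc m) i k (bd P (Suc n) j l x) = bd P (Suc m) (j - 1) l (bd P (Suc n) i k x)"
    using bd_bd[OF P x ij kl] by (simp add: n)
  moreover have "glue P (m, bd P (Suc m) i k (bd P (Suc n) j l x), w) (n, bd P (Suc n) j l x, u')"
    unfolding n u' using ij kl w bd_in[OF P x, of j l] by (intro glue.intros) (auto simp: n)
  moreover have "glue P (m, bd P (Suc m) (j - 1) l (bd P (Suc n) i k x), w) (n, bd P (Suc n) i k x, u)"
    unfolding n u_eq using ij kl w bd_in[OF P x, of i k] by (intro glue.intros) (auto simp: n)
  ultimately show ?thesis by metis
qed

text \<open>\<open>glue\<close> points from a face up to the cube, so a reduction is a step of its
  converse. Two reductions of one triple either coincide or meet again after one more step
  each.\<close>

lemma glue_diamond: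
  assumes P: "precubical_set P" and "glue P q p" "glue P r p"
  shows "q = r \<or> (\<exists>s. glue P s q \<and> glue P s r)"
proof -
  obtain x n i k u where q: "q = (n, bd P (Suc n) i k x, u)" "p = (Suc n, x, face_map n i k u)"
    "x \<in> cells P (Suc n)" "i \<in> {1..Suc n}" "k \<in> {0,1}" "u \<in> Icube n"
    by (rule glue.cases[OF assms(2)])
  obtain y m j l u' where r0: "r = (m, bd P (Suc m) j l y, u')" "p = (Suc m, y, face_map m j l u')"
    "y \<in> cells P (Suc m)" "j \<in> {1..Suc m}" "l \<in> {0,1}" "u' \<in> Icube m"
    by (rule glue.cases[OF assms(3)])
  have "m = n" "y = x"
    using q(2) r0(2) by auto
  then have r: "face_map n i k u = face_map n j l u'" "r = (n, bd P (Suc n) j l x, u')"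
    "j \<in> {1..Suc n}" "l \<in> {0,1}" "u' \<in> Icube n"
    using q(2) r0 by auto
  consider "i < j" | "j < i" | "i = j" by linarith
  then show ?thesis
  proof cases
    case 1
    with glue_diamond_less[OF P q(3) _ 1 _ q(5) r(4) q(6) r(5) r(1)] q r show ?thesis by auto
  next
    case 2
    with glue_diamond_less[OF P q(3) _ 2 _ r(4) q(5) r(5) q(6) r(1)[symmetric]] q r show ?thesis by auto
  next
    case 3
    then have "real k = real l"
      using face_map_apply[OF q(6,4), of i k] face_map_apply[OF r(5,3), of i l] r(1) q(4) by simp
    then show ?thesis
      using 3 q r face_map_inj[of u n u' i k] by auto
  qed
qed

section \<open>Open cubes and uniqueness of representatives\<close>

definition open_cube :: "nat \<Rightarrow> (nat \<Rightarrow> real) set" where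
  "open_cube n = {u \<in> Icube n. \<forall>i\<in>{1..n}. 0 < u i \<and> u i < 1}"

text \<open>A point of a face has a coordinate 0 or 1, so points of open cubes are
  irreducible.\<close>

lemma not_glue_open_cube: "u \<in> open_cube n \<Longrightarrow> \<not> glue P q (n, x, u)"
proof
  assume u: "u \<in> open_cube n" and "glue P q (n, x, u)"
  from this(2) obtain m i k v where "n = Suc m" "u = face_map m i k v" "i \<in> {1..Suc m}" "k \<in> {0,1}" "v \<in> Icube m"
    by (auto elim!: glue.cases)
  then have "u i = real k"
    by (simp add: face_map_apply)
  moreover have "0 < u i \<and> u i < 1"
    using u \<open>n = Suc m\<close> \<open>i \<in> _\<close> by (simp add: open_cube_def)
  ultimately show False
    using \<open>k \<in> {0,1}\<close> by auto
qed

lemma point_class_eq_iff: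
  "point_class P n x u = point_class P m y v \<longleftrightarrow> equivclp (glue P) (n, x, u) (m, y, v)"
  unfolding point_class_def
  by (auto intro: equivclp_trans equivclp_sym dest: equivclp_sym)

lemma point_class_face:
  "x \<in> cells P (Suc n) \<Longrightarrow> i \<in> {1..Suc n} \<Longrightarrow> k \<in> {0,1} \<Longrightarrow> u \<in> Icube n \<Longrightarrow>
    point_class P n (bd P (Suc n) i k x) u = point_class P (Suc n) x (face_map n i k u)"
  unfolding point_class_eq_iff by (intro r_into_equivclp glue.intros)

text \<open>By confluence, equivalent triples have a common reduct, and a triple in an open cube is
  its own only reduct. The conclusion is a chain of reductions and not just an equivalence, so that
  one can argue by induction along it.\<close>

lemma point_class_eq_open_cube:
  assumes P: "precubical_set P" and eq: "point_class P n x u = point_class P m y v" and v: "v \<in> open_cube m"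
  shows "(glue P)\<inverse>\<inverse>\<^sup>*\<^sup>* (n, x, u) (m, y, v)"
proof -
  have "strong_confluentp (glue P)\<inverse>\<inverse>"
    using glue_diamond[OF P] by (intro strong_confluentpI) blast
  then have "equivclp (glue P)\<inverse>\<inverse> = (glue P)\<inverse>\<inverse>\<^sup>*\<^sup>* OO (glue P)\<inverse>\<inverse>\<inverse>\<inverse>\<^sup>*\<^sup>*"
    by (intro semiconfluentp_equivclp strong_confluentp_into_semiconfluentp)
  then obtain s where s: "(glue P)\<inverse>\<inverse>\<^sup>*\<^sup>* (n, x, u) s" "(glue P)\<inverse>\<inverse>\<^sup>*\<^sup>* (m, y, v) s"
    using eq unfolding point_class_eq_iff equivclp_conversep by (auto simp: OO_def rtranclp_conversep)
  from s(2) have "s = (m, y, v)"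
    using not_glue_open_cube[OF v, of P] by (cases rule: converse_rtranclpE) (blast elim: conversepE)+
  then show ?thesis using s(1) by simp
qed

lemma point_class_open_cube_unique:
  assumes P: "precubical_set P" and eq: "point_class P n x u = point_class P m y v"
    and u: "u \<in> open_cube n" and v: "v \<in> open_cube m"
  shows "(n, x, u) = (m, y, v)"
  using point_class_eq_open_cube[OF P eq v] not_glue_open_cube[OF u, of P]
  by (cases rule: converse_rtranclpE) (blast elim: conversepE)+

lemma precubical_subset_refl: "precubical_set P \<Longrightarrow> precubical_subset P P"
  by (simp add: precubical_subset_def)

text \<open>Descending to faces stays inside \<open>Q\<close>, which is closed under boundary
  operators, and stops in degree 0 at the latest.\<close>

lemma open_cube_representative:
  assumes Q: "precubical_subset Q P" and "x \<in> cells Q n" "u \<in> Icube n"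
  shows "\<exists>m y v. y \<in> cells Q m \<and> v \<in> open_cube m \<and> point_class P n x u = point_class P m y v"
  using assms(2,3)
proof (induction n arbitrary: x u)
  case 0
  then show ?case by (intro exI[of _ 0] exI[of _ x] exI[of _ u]) (auto simp: open_cube_def)
next
  case (Suc n)
  show ?case
  proof (cases "u \<in> open_cube (Suc n)")
    case False
    then obtain i where i: "i \<in> {1..Suc n}" "\<not> (0 < u i \<and> u i < 1)"
      using Suc.prems by (auto simp: open_cube_def)
    then have "u i = 0 \<or> u i = 1"
      using Icube_le[OF Suc.prems(2) i(1)] by linarith
    then obtain k :: nat where k: "k \<in> {0,1}" "u i = real k"
      by (metis insertI1 insertI2 of_nat_0 of_nat_1)
    have "point_class P (Suc n) x u = point_class P n (bd P (Suc n) i k x) (face_del n i u)"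
      using point_class_face[of x P n i k "face_del n i u"] Q Suc.prems i(1) k
      by (auto simp: face_del_in face_map_del precubical_subset_def)
    moreover have "bd P (Suc n) i k x \<in> cells Q n"
      using Q bd_in[of Q x "Suc n" i k] Suc.prems i(1) k by (auto simp: precubical_subset_def)
    ultimately show ?thesis
      using Suc.IH[OF _ face_del_in[OF Suc.prems(2)]] by metis
  qed (use Suc.prems in blast)
qed

section \<open>Topology of the geometric realization\<close>

lemma openin_prerealization_cell:
  assumes "x \<in> cells P n" "openin (cube_topology n) V"
  shows "openin (prerealization P) ((\<lambda>u. (n, x, u)) ` V)"
proof -
  have "openin (prod_topology (discrete_topology (cells P m)) (cube_topology m)) {z. (m, z) \<in> (\<lambda>u. (n, x, u)) ` V}" for m
  proof (cases "m = n")
    case True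
    then have "{z. (m, z) \<in> (\<lambda>u. (n, x, u)) ` V} = {x} \<times> V" by auto
    then show ?thesis using assms True by (simp add: openin_prod_Times_iff)
  next
    case False
    then have "{z. (m, z) \<in> (\<lambda>u. (n, x, u)) ` V} = {}" by auto
    then show ?thesis by (metis openin_empty)
  qed
  moreover have "(\<lambda>u. (n, x, u)) ` V \<subseteq> topspace (prerealization P)"
    using assms openin_subset[OF assms(2)] by (auto simp: prerealization_def)
  ultimately show ?thesis
    unfolding prerealization_def openin_sum_topology by (auto simp: topspace_cube_topology)
qed

lemma topspace_prerealization: "topspace (prerealization P) = {(n, x, u). x \<in> cells P n \<and> u \<in> Icube n}"
  by (auto simp: prerealization_def topspace_cube_topology)

lemma quotient_map_realization:
  "quotient_map (prerealization P) (realization_top P) (\<lambda>(n, x, u). point_class P n x u)"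
  unfolding realization_top_def by (rule quotient_map_quotient_topology)

lemma dtop_realization: "dtop (realization P) = realization_top P"
  by (simp add: realization_def)

lemma continuous_map_point_class:
  assumes "x \<in> cells P n"
  shows "continuous_map (cube_topology n) (realization_top P) (point_class P n x)"
proof -
  have "continuous_map (cube_topology n) (prod_topology (discrete_topology (cells P n)) (cube_topology n)) (\<lambda>u. (x, u))"
    using assms by (auto intro!: continuous_map_pairedI)
  then have "continuous_map (cube_topology n) (prerealization P) (Pair n \<circ> (\<lambda>u. (x, u)))"
    unfolding prerealization_def by (rule continuous_map_compose) (rule continuous_map_component_injection, simp)
  from continuous_map_compose[OF this quotient_imp_continuous_map[OF quotient_map_realization]]
  show ?thesis by (simp add: o_def)
qed

text \<open>The unit interval is locally compact and Hausdorff, so the product with it preserves the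
  quotient map. Hence a homotopy on the realization is continuous as soon as it is so on each
  cell.\<close>

lemma continuous_map_realization_prod:
  assumes f: "\<And>n x. x \<in> cells P n \<Longrightarrow>
    continuous_map (prod_topology (cube_topology n) unit_top) Z (\<lambda>w. f (point_class P n x (fst w), snd w))"
  shows "continuous_map (prod_topology (realization_top P) unit_top) Z f"
proof -
  have "locally_compact_space unit_top" "Hausdorff_space unit_top"
    by (auto intro!: compact_imp_locally_compact_space simp: compact_space_subtopology Hausdorff_space_subtopology)
  then have q: "quotient_map (prod_topology (prerealization P) unit_top) (prod_topology (realization_top P) unit_top)
      (\<lambda>(w, t). ((\<lambda>(n, x, u). point_class P n x u) w, t))"
    by (intro quotient_map_prod_left quotient_map_realization) auto
  let ?g = "\<lambda>((n, x, u), t). f (point_class P n x u, t)"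
  have "continuous_map (prod_topology (prerealization P) unit_top) Z ?g"
    unfolding continuous_map_def
  proof (intro conjI allI impI)
    show "?g \<in> topspace (prod_topology (prerealization P) unit_top) \<rightarrow> topspace Z"
      using continuous_map_funspace[OF f] 
      by (fastforce simp: topspace_prerealization topspace_cube_topology Pi_iff)
    fix W assume W: "openin Z W"
    let ?D = "{w \<in> topspace (prod_topology (prerealization P) unit_top). ?g w \<in> W}"
    show "openin (prod_topology (prerealization P) unit_top) ?D"
    proof (subst openin_subopen, intro ballI)
      fix w assume "w \<in> ?D"
      then obtain n x u t where w: "w = ((n, x, u), t)" and x: "x \<in> cells P n" and u: "u \<in> Icube n"
        and t: "t \<in> {0..1}" and g: "f (point_class P n x u, t) \<in> W"
        by (auto simp: topspace_prerealization)
      let ?E = "{w \<in> topspace (prod_topology (cube_topology n) unit_top). f (point_class P n x (fst w), snd w) \<in> W}"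
      have "openin (prod_topology (cube_topology n) unit_top) ?E"
        by (rule openin_continuous_map_preimage[OF f[OF x] W])
      have "(u, t) \<in> ?E"
        using u t g by (simp add: topspace_cube_topology)
      from \<open>openin _ ?E\<close>[unfolded openin_prod_topology_alt, rule_format, OF this]
      obtain U V where UV: "openin (cube_topology n) U" "openin unit_top V" "u \<in> U" "t \<in> V" "U \<times> V \<subseteq> ?E"
        by (elim exE conjE)
      have "openin (prod_topology (prerealization P) unit_top) ((\<lambda>u. (n, x, u)) ` U \<times> V)"
        using openin_prerealization_cell[OF x UV(1)] UV(2) by (simp add: openin_prod_Times_iff)
      moreover have "(\<lambda>u. (n, x, u)) ` U \<times> V \<subseteq> ?D"
        using UV(5) x by (auto simp: topspace_prerealization topspace_cube_topology)
      ultimately show "\<exists>T. openin (prod_topology (prerealization P) unit_top) T \<and> w \<in> T \<and> T \<subseteq> ?D"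
        using UV(3,4) w by (intro exI[of _ "(\<lambda>u. (n, x, u)) ` U \<times> V"]) auto
    qed
  qed
  moreover have "?g = f \<circ> (\<lambda>(w, t). ((\<lambda>(n, x, u). point_class P n x u) w, t))"
    by auto
  ultimately show ?thesis
    using q continuous_compose_quotient_map by metis
qed

section \<open>Piecewise description of d-paths\<close>

text \<open>Pieces live on arbitrary intervals, so that restriction, subdivision and joining need no
  rescaling. One-point intervals are allowed because an increasing reparametrization may be
  constant.\<close>

inductive piecewise_dpath ::
    "'a precubical \<Rightarrow> real \<Rightarrow> real \<Rightarrow> (real \<Rightarrow> (nat \<times> 'a \<times> (nat \<Rightarrow> real)) set) \<Rightarrow> bool"
  for P :: "'a precubical" where
  piece: "s \<le> t \<Longrightarrow> x \<in> cells P n \<Longrightarrow> (\<And>r. r \<in> {s..t} \<Longrightarrow> \<alpha> r \<in> Icube n) \<Longrightarrow>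
     (\<And>i. i \<in> {1..n} \<Longrightarrow> continuous_on {s..t} (\<lambda>r. \<alpha> r i)) \<Longrightarrow>
     (\<And>i. i \<in> {1..n} \<Longrightarrow> mono_on {s..t} (\<lambda>r. \<alpha> r i)) \<Longrightarrow>
     (\<And>r. r \<in> {s..t} \<Longrightarrow> \<omega> r = point_class P n x (\<alpha> r)) \<Longrightarrow> piecewise_dpath P s t \<omega>"
| join: "piecewise_dpath P r s \<omega> \<Longrightarrow> piecewise_dpath P s t \<omega> \<Longrightarrow> piecewise_dpath P r t \<omega>"

lemma piecewise_dpath_le: "piecewise_dpath P s t \<omega> \<Longrightarrow> s \<le> t"
  by (induction rule: piecewise_dpath.induct) auto

lemma piecewise_dpath_cong:
  "piecewise_dpath P s t \<omega> \<Longrightarrow> (\<And>r. r \<in> {s..t} \<Longrightarrow> \<omega> r = \<nu> r) \<Longrightarrow> piecewise_dpath P s t \<nu>"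
proof (induction rule: piecewise_dpath.induct)
  case (piece s t x n \<alpha> \<omega>)
  then show ?case by (intro piecewise_dpath.piece[of s t x P n \<alpha>]) auto
next
  case (join r s \<omega> t)
  then show ?case
    using piecewise_dpath_le[OF join.hyps(1)] piecewise_dpath_le[OF join.hyps(2)]
    by (rule_tac piecewise_dpath.join[of P r s \<nu> t]) auto
qed

lemma piecewise_dpath_subinterval:
  "piecewise_dpath P s t \<omega> \<Longrightarrow> s \<le> s' \<Longrightarrow> s' \<le> t' \<Longrightarrow> t' \<le> t \<Longrightarrow> piecewise_dpath P s' t' \<omega>"
proof (induction arbitrary: s' t' rule: piecewise_dpath.induct)
  case (piece s t x n \<alpha> \<omega>)
  have "{s'..t'} \<subseteq> {s..t}" using piece.prems by auto
  then show ?case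
    using piece.hyps piece.prems
    by (intro piecewise_dpath.piece[of s' t' x P n \<alpha>])
      (auto intro: continuous_on_subset[OF piece.hyps(4)] mono_on_subset[OF piece.hyps(5)])
next
  case (join r s \<omega> t)
  consider "t' \<le> s" | "s \<le> s'" | "s' \<le> s" "s \<le> t'" by linarith
  then show ?case
  proof cases
    case 3
    then show ?thesis
      using piecewise_dpath.join[OF join.IH(1)[of s' s] join.IH(2)[of s t']] join.prems by simp
  qed (use join.IH join.prems in auto)
qed

lemma piecewise_dpath_reparam:
  assumes "piecewise_dpath P s t \<omega>" "a \<le> b" "continuous_on {a..b} \<phi>" "mono_on {a..b} \<phi>" "\<phi> a = s" "\<phi> b = t"
  shows "piecewise_dpath P a b (\<lambda>r. \<omega> (\<phi> r))"
  using assms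
proof (induction arbitrary: a b rule: piecewise_dpath.induct)
  case (piece s t x n \<alpha> \<omega>)
  have im: "\<phi> ` {a..b} \<subseteq> {s..t}"
  proof
    fix y assume "y \<in> \<phi> ` {a..b}"
    then obtain r where r: "r \<in> {a..b}" "y = \<phi> r" by blast
    then have "\<phi> a \<le> \<phi> r" "\<phi> r \<le> \<phi> b"
      using piece.prems by (auto intro!: mono_onD[OF piece.prems(3)])
    then show "y \<in> {s..t}" using r piece.prems by simp
  qed
  show ?case
  proof (rule piecewise_dpath.piece[of a b x P n "\<lambda>r. \<alpha> (\<phi> r)"])
    fix i assume i: "i \<in> {1..n}"
    show "continuous_on {a..b} (\<lambda>r. \<alpha> (\<phi> r) i)"
      by (rule continuous_on_compose2[OF piece.hyps(4)[OF i] piece.prems(2) im])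
    show "mono_on {a..b} (\<lambda>r. \<alpha> (\<phi> r) i)"
      using piece.hyps(5)[OF i] piece.prems(3) im by (auto simp: mono_on_def image_subset_iff)
  qed (use piece im in \<open>auto simp: image_subset_iff\<close>)
next
  case (join r s \<omega> t)
  have "\<phi> a \<le> s" "s \<le> \<phi> b"
    using join piecewise_dpath_le by blast+
  \<comment> \<open>A time at which the joint is reached, by the intermediate value theorem. If
    \<open>\<phi>\<close> stands still there, any such time will do.\<close>
  then obtain c where c: "a \<le> c" "c \<le> b" "\<phi> c = s"
    using IVT'[of \<phi> a s b] join.prems by auto
  have sub: "{a..c} \<subseteq> {a..b}" "{c..b} \<subseteq> {a..b}" using c by auto
  then have "continuous_on {a..c} \<phi>" "continuous_on {c..b} \<phi>" "mono_on {a..c} \<phi>" "mono_on {c..b} \<phi>"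
    using sub[THEN continuous_on_subset[OF join.prems(2)]] sub[THEN mono_on_subset[OF join.prems(3)]]
    by auto
  then have "piecewise_dpath P a c (\<lambda>r. \<omega> (\<phi> r))" "piecewise_dpath P c b (\<lambda>r. \<omega> (\<phi> r))"
    using join.IH(1)[of a c] join.IH(2)[of c b] join.prems c by simp_all
  then show ?case by (rule piecewise_dpath.join)
qed

lemma continuous_map_interval_join:
  assumes "continuous_map (top_of_set {r..s}) X \<omega>" "continuous_map (top_of_set {s..t}) X \<omega>" "r \<le> s" "s \<le> (t::real)"
  shows "continuous_map (top_of_set {r..t}) X \<omega>"
proof -
  have "continuous_map (top_of_set {r..t}) X (\<lambda>q. if q \<le> s then \<omega> q else \<omega> q)"
  proof (rule continuous_map_cases_le)
    have "{r..t} \<inter> {q \<in> topspace (top_of_set {r..t}). q \<le> s} = {r..s}"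
      "{r..t} \<inter> {q \<in> topspace (top_of_set {r..t}). s \<le> q} = {s..t}"
      using assms(3,4) by auto
    then show "continuous_map (subtopology (top_of_set {r..t}) {q \<in> topspace (top_of_set {r..t}). q \<le> s}) X \<omega>"
      "continuous_map (subtopology (top_of_set {r..t}) {q \<in> topspace (top_of_set {r..t}). s \<le> q}) X \<omega>"
      using assms by (simp_all only: subtopology_subtopology)
  qed auto
  then show ?thesis by simp
qed

lemma continuous_map_into_cube:
  assumes "\<And>z. z \<in> topspace Z \<Longrightarrow> \<alpha> z \<in> Icube n" "\<And>i. i \<in> {1..n} \<Longrightarrow> continuous_map Z euclideanreal (\<lambda>z. \<alpha> z i)"
  shows "continuous_map Z (cube_topology n) \<alpha>"
  unfolding cube_topology_def continuous_map_componentwise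
  using assms Icube_le[OF assms(1)]
  by (auto simp: continuous_map_in_subtopology Icube_def PiE_def)

lemma continuous_map_cube_coordinate:
  "i \<in> {1..n} \<Longrightarrow> continuous_map (cube_topology n) euclideanreal (\<lambda>u. u i)"
  using continuous_map_product_projection[of i "{1..n}" "\<lambda>_. unit_top"]
  by (auto simp: cube_topology_def continuous_map_in_subtopology)

lemma piecewise_dpath_continuous:
  "piecewise_dpath P s t \<omega> \<Longrightarrow> continuous_map (top_of_set {s..t}) (realization_top P) \<omega>"
proof (induction rule: piecewise_dpath.induct)
  case (piece s t x n \<alpha> \<omega>)
  then have "continuous_map (top_of_set {s..t}) (cube_topology n) \<alpha>"
    by (intro continuous_map_into_cube) auto
  from continuous_map_compose[OF this continuous_map_point_class[OF piece.hyps(2)]]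
  show ?case
    by (rule continuous_map_eq) (use piece in auto)
next
  case (join r s \<omega> t)
  then show ?case
    using continuous_map_interval_join piecewise_dpath_le by blast
qed

lemma piecewise_dpath_affine:
  assumes "piecewise_dpath P 0 1 \<omega>" "(c::real) > 0"
  shows "piecewise_dpath P s (s + c) (\<lambda>r. \<omega> ((r - s) / c))"
  using assms(2) by (rule_tac piecewise_dpath_reparam[OF assms(1)])
    (auto intro!: continuous_intros mono_onI divide_right_mono)

lemma piecewise_dpath_concat:
  assumes "piecewise_dpath P 0 1 \<omega>" "piecewise_dpath P 0 1 \<nu>" "\<omega> 1 = \<nu> 0"
  shows "piecewise_dpath P 0 1 (concat_path \<omega> \<nu>)"
proof (rule piecewise_dpath.join[of P 0 "1/2"])
  have "piecewise_dpath P 0 (1/2) (\<lambda>r. \<omega> ((r - 0) / (1/2)))"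
    using piecewise_dpath_affine[OF assms(1), of "1/2" 0] by simp
  then show "piecewise_dpath P 0 (1/2) (concat_path \<omega> \<nu>)"
    by (rule piecewise_dpath_cong) (auto simp: concat_path_def mult.commute)
  have "piecewise_dpath P (1/2) 1 (\<lambda>r. \<nu> ((r - 1/2) / (1/2)))"
    using piecewise_dpath_affine[OF assms(2), of "1/2" "1/2"] by simp
  then show "piecewise_dpath P (1/2) 1 (concat_path \<omega> \<nu>)"
  proof (rule piecewise_dpath_cong)
    fix r :: real assume r: "r \<in> {1/2..1}"
    have eq: "(r - 1/2) / (1/2) = 2 * r - 1" by (simp add: field_simps)
    show "\<nu> ((r - 1/2) / (1/2)) = concat_path \<omega> \<nu> r"
    proof (cases "r = 1/2")
      case True
      show ?thesis unfolding True using assms(3) by (simp add: concat_path_def)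
    next
      case False
      then show ?thesis unfolding eq using r by (simp add: concat_path_def)
    qed
  qed
qed

lemma cube_path_concats_piecewise:
  "\<omega> \<in> cube_path_concats P \<Longrightarrow> piecewise_dpath P 0 1 \<omega>"
proof (induction rule: cube_path_concats.induct)
  case (cube_path x n \<alpha>)
  have "\<alpha> r \<in> Icube n" if "r \<in> {0..1}" for r
    using continuous_map_funspace[OF cube_path(2)] that by (auto simp: topspace_cube_topology)
  moreover have "continuous_on {0..1} (\<lambda>r. \<alpha> r i)" if "i \<in> {1..n}" for i
    using continuous_map_compose[OF cube_path(2) continuous_map_cube_coordinate[OF that]] by (simp add: o_def)
  ultimately show ?case
    using cube_path by (intro piecewise_dpath.piece[of 0 1 x P n \<alpha>]) (auto intro!: mono_onI)
next
  case (concat \<omega> \<nu>)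
  then show ?case by (rule_tac piecewise_dpath_concat)
qed

text \<open>\<open>concat_path\<close> always joins at 1/2, wherever the given joint lies, so a
  subdivided path is a concatenation only up to an increasing reparametrization. On a one-point
  interval no \<open>\<phi>\<close> could take both values 0 and 1, whence the strict
  inequality.\<close>

lemma piecewise_cube_path_concats:
  assumes "piecewise_dpath P s t \<omega>" "s < t"
  shows "\<exists>\<nu>\<in>cube_path_concats P. \<exists>\<phi>. continuous_on {s..t} \<phi> \<and> mono_on {s..t} \<phi> \<and> \<phi> s = 0 \<and> \<phi> t = 1 \<and>
      (\<forall>r\<in>{s..t}. \<omega> r = \<nu> (\<phi> r))"
  using assms
proof (induction rule: piecewise_dpath.induct)
  case (piece s t x n \<alpha> \<omega>)
  define \<beta> where "\<beta> = (\<lambda>r. \<alpha> (s + r * (t - s)))"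
  have in_st: "s + r * (t - s) \<in> {s..t}" if "r \<in> {0..1}" for r
  proof -
    have "r * (t - s) \<le> 1 * (t - s)" using that piece.prems by (intro mult_right_mono) auto
    moreover have "0 \<le> r * (t - s)" using that piece.prems by simp
    ultimately show ?thesis by simp
  qed
  have "continuous_map unit_top (cube_topology n) \<beta>"
  proof (rule continuous_map_into_cube)
    show "\<beta> r \<in> Icube n" if "r \<in> topspace unit_top" for r
      using piece.hyps(3)[OF in_st] that by (auto simp: \<beta>_def)
    show "continuous_map unit_top euclideanreal (\<lambda>r. \<beta> r i)" if "i \<in> {1..n}" for i
      unfolding \<beta>_def using in_st
      by (auto intro!: continuous_on_compose2[OF piece.hyps(4)[OF that]] continuous_intros)
  qed
  moreover have "\<beta> q i \<le> \<beta> r i" if "0 \<le> q" "q \<le> r" "r \<le> 1" "i \<in> {1..n}" for q r i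
    unfolding \<beta>_def using that piece.prems
    by (intro mono_onD[OF piece.hyps(5)[OF that(4)]] in_st) (auto intro!: mult_right_mono)
  ultimately have "(\<lambda>r\<in>{0..1}. point_class P n x (\<beta> r)) \<in> cube_path_concats P"
    using piece.hyps(2) by (intro cube_path_concats.cube_path)
  moreover have "(r - s) / (t - s) \<in> {0..1}" if "r \<in> {s..t}" for r
    using that piece.prems by (auto simp: field_simps)
  ultimately show ?case
    using piece.prems piece.hyps(6)
    by (intro bexI[of _ "\<lambda>r\<in>{0..1}. point_class P n x (\<beta> r)"] exI[of _ "\<lambda>r. (r - s) / (t - s)"])
      (auto intro!: continuous_intros mono_onI divide_right_mono simp: \<beta>_def)
next
  case (join r s \<omega> t)
  have le: "r \<le> s" "s \<le> t"
    using join.hyps piecewise_dpath_le by blast+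
  show ?case
  \<comment> \<open>If one half is a single point, the other half is the whole interval.\<close>
  proof (cases "r = s \<or> s = t")
    case True
    then show ?thesis using join.IH join.prems by auto
  next
    case False
    then have lt: "r < s" "s < t" using le by auto
    obtain \<nu> \<phi> where \<nu>: "\<nu> \<in> cube_path_concats P" "continuous_on {r..s} \<phi>" "mono_on {r..s} \<phi>" "\<phi> r = 0" "\<phi> s = 1"
      "\<And>q. q \<in> {r..s} \<Longrightarrow> \<omega> q = \<nu> (\<phi> q)"
      using join.IH(1)[OF lt(1)] by blast
    obtain \<mu> \<psi> where \<mu>: "\<mu> \<in> cube_path_concats P" "continuous_on {s..t} \<psi>" "mono_on {s..t} \<psi>" "\<psi> s = 0" "\<psi> t = 1"
      "\<And>q. q \<in> {s..t} \<Longrightarrow> \<omega> q = \<mu> (\<psi> q)"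
      using join.IH(2)[OF lt(2)] by blast
    \<comment> \<open>The joint \<open>s\<close> is moved to 1/2.\<close>
    define \<xi> where "\<xi> = (\<lambda>q. if q \<le> s then \<phi> q / 2 else (1 + \<psi> q) / 2)"
    have \<phi>_in: "0 \<le> \<phi> q \<and> \<phi> q \<le> 1" if "q \<in> {r..s}" for q
      using mono_onD[OF \<nu>(3), of r q] mono_onD[OF \<nu>(3), of q s] that \<nu>(4,5) le by auto
    have \<psi>_in: "0 \<le> \<psi> q \<and> \<psi> q \<le> 1" if "q \<in> {s..t}" for q
      using mono_onD[OF \<mu>(3), of s q] mono_onD[OF \<mu>(3), of q t] that \<mu>(4,5) le by auto
    have "\<nu> 1 = \<mu> 0"
      using \<nu>(5,6) \<mu>(4,6) le by (metis atLeastAtMost_iff order_refl)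
    then have c: "concat_path \<nu> \<mu> \<in> cube_path_concats P"
      using \<nu>(1) \<mu>(1) by (intro cube_path_concats.concat)
    have "continuous_on ({r..s} \<union> {s..t}) \<xi>"
      unfolding \<xi>_def
      by (rule continuous_on_cases) (use \<nu> \<mu> in \<open>auto intro!: continuous_intros\<close>)
    then have cont: "continuous_on {r..t} \<xi>"
      using le by (simp add: ivl_disj_un_two_touch)
    have mono: "mono_on {r..t} \<xi>"
    proof (rule mono_onI)
      fix p q assume pq: "p \<in> {r..t}" "q \<in> {r..t}" "p \<le> q"
      consider "q \<le> s" | "p \<le> s" "s < q" | "s < p" by linarith
      then show "\<xi> p \<le> \<xi> q"
      proof cases
        case 2
        then show ?thesis using pq \<phi>_in[of p] \<psi>_in[of q] by (simp add: \<xi>_def)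
      qed (use pq mono_onD[OF \<nu>(3), of p q] mono_onD[OF \<mu>(3), of p q] in \<open>auto simp: \<xi>_def\<close>)
    qed
    have "\<omega> q = concat_path \<nu> \<mu> (\<xi> q)" if q: "q \<in> {r..t}" for q
    proof (cases "q \<le> s")
      case True
      then show ?thesis using \<phi>_in[of q] \<nu>(6)[of q] q by (simp add: \<xi>_def concat_path_def)
    next
      case False
      then have "\<omega> q = \<mu> (\<psi> q)" "0 \<le> \<psi> q" "\<psi> q \<le> 1"
        using \<psi>_in[of q] \<mu>(6)[of q] q by auto
      \<comment> \<open>If \<open>\<psi>\<close> is still 0 after the joint,
        \<open>concat_path\<close> is evaluated at 1/2 and uses its first path, so the equality at
        the joint is needed.\<close>
      then show ?thesis
        using False \<open>\<nu> 1 = \<mu> 0\<close> by (cases "\<psi> q = 0") (simp_all add: \<xi>_def concat_path_def add_divide_distrib)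
    qed
    then show ?thesis
      using c cont mono \<nu>(4) \<mu>(5) lt
      by (intro bexI[OF _ c] exI[of _ \<xi>]) (auto simp: \<xi>_def)
  qed
qed

lemma dpaths_realization_iff:
  "\<omega> \<in> dpaths (realization P) \<longleftrightarrow> \<omega> \<in> extensional {0..1} \<and> piecewise_dpath P 0 1 \<omega>"
proof
  assume "\<omega> \<in> dpaths (realization P)"
  then obtain \<nu> \<phi> where \<omega>: "\<omega> = (\<lambda>t\<in>{0..1}. \<nu> (\<phi> t))" "\<nu> \<in> cube_path_concats P" "increasing_map \<phi>"
    by (auto simp: realization_def)
  have \<phi>: "continuous_on {0..1} \<phi>" "mono_on {0..1} \<phi>"
    using \<omega>(3) by (auto simp: increasing_map_def)
  have "\<phi> 0 \<le> \<phi> 1" "0 \<le> \<phi> 0" "\<phi> 1 \<le> 1"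
    using increasing_map_in[OF \<omega>(3)] mono_onD[OF \<phi>(2), of 0 1] by auto
  then have "piecewise_dpath P (\<phi> 0) (\<phi> 1) \<nu>"
    using piecewise_dpath_subinterval[OF cube_path_concats_piecewise[OF \<omega>(2)]] by blast
  from piecewise_dpath_reparam[OF this _ \<phi>] have "piecewise_dpath P 0 1 (\<lambda>t. \<nu> (\<phi> t))"
    by simp
  then have "piecewise_dpath P 0 1 \<omega>"
    by (rule piecewise_dpath_cong) (simp add: \<omega>)
  then show "\<omega> \<in> extensional {0..1} \<and> piecewise_dpath P 0 1 \<omega>"
    by (simp add: \<omega>)
next
  assume \<omega>: "\<omega> \<in> extensional {0..1} \<and> piecewise_dpath P 0 1 \<omega>"
  then obtain \<nu> \<phi> where \<nu>: "\<nu> \<in> cube_path_concats P" "continuous_on {0..1} \<phi>" "mono_on {0..1} \<phi>"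
      "\<phi> 0 = 0" "\<phi> 1 = 1" "\<forall>r\<in>{0..1}. \<omega> r = \<nu> (\<phi> r)"
    using piecewise_cube_path_concats[of P 0 1 \<omega>] by auto
  have "\<phi> r \<in> {0..1}" if "r \<in> {0..1}" for r
    using mono_onD[OF \<nu>(3), of 0 r] mono_onD[OF \<nu>(3), of r 1] that \<nu>(4,5) by auto
  then have "increasing_map \<phi>"
    using \<nu> by (auto simp: increasing_map_def)
  moreover have "\<omega> = (\<lambda>t\<in>{0..1}. \<nu> (\<phi> t))"
    using \<omega> \<nu>(6) by (intro ext) (simp add: extensional_def)
  ultimately show "\<omega> \<in> dpaths (realization P)"
    using \<nu>(1) by (auto simp: realization_def)
qed

lemma is_dspace_realization: "is_dspace (realization P)"
  unfolding is_dspace_def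
proof (intro conjI ballI allI impI subsetI)
  fix \<omega> assume "\<omega> \<in> dpaths (realization P)"
  then show "\<omega> \<in> cont_maps unit_top (dtop (realization P))"
    using piecewise_dpath_continuous by (auto simp: dpaths_realization_iff cont_maps_def dtop_realization)
next
  fix p assume "p \<in> topspace (dtop (realization P))"
  then obtain n x u where "p = point_class P n x u" "x \<in> cells P n" "u \<in> Icube n"
    by (auto simp: topspace_realization)
  then have "piecewise_dpath P 0 1 (const_path p)"
    by (intro piecewise_dpath.piece[of 0 1 x P n "\<lambda>_. u"]) (auto simp: const_path_def mono_on_def)
  then show "const_path p \<in> dpaths (realization P)"
    by (simp add: dpaths_realization_iff const_path_def)
next
  fix \<omega> \<phi> assume \<omega>: "\<omega> \<in> dpaths (realization P)" and "increasing_map \<phi>"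
  then obtain \<nu> \<psi> where \<nu>: "\<nu> \<in> cube_path_concats P" "\<omega> = (\<lambda>t\<in>{0..1}. \<nu> (\<psi> t))" "increasing_map \<psi>"
    by (auto simp: realization_def)
  have "increasing_map (\<lambda>t. \<psi> (\<phi> t))"
    using \<nu>(3) \<open>increasing_map \<phi>\<close> increasing_map_in[OF \<open>increasing_map \<phi>\<close>]
    by (auto simp: increasing_map_def mono_on_def intro: continuous_on_compose2[of "{0..1}" \<psi>])
  moreover have "(\<lambda>t\<in>{0..1}. \<omega> (\<phi> t)) = (\<lambda>t\<in>{0..1}. \<nu> (\<psi> (\<phi> t)))"
    unfolding \<nu>(2) using increasing_map_in[OF \<open>increasing_map \<phi>\<close>] by (intro restrict_ext) simp
  ultimately show "(\<lambda>t\<in>{0..1}. \<omega> (\<phi> t)) \<in> dpaths (realization P)"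
    using \<nu>(1) by (auto simp: realization_def)
next
  fix \<omega> \<nu> assume "\<omega> \<in> dpaths (realization P)" "\<nu> \<in> dpaths (realization P)" "\<omega> 1 = \<nu> 0"
  then show "concat_path \<omega> \<nu> \<in> dpaths (realization P)"
    using piecewise_dpath_concat by (auto simp: dpaths_realization_iff concat_path_def)
qed

text \<open>d-paths are joined from cube paths, so the image of a single cube path decides. That
  image may again consist of several pieces.\<close>

lemma dmap_realizationI:
  assumes cont: "continuous_map (realization_top P) (realization_top Q) f"
    and piece: "\<And>s t x n \<alpha>. s \<le> t \<Longrightarrow> x \<in> cells P n \<Longrightarrow> (\<And>r. r \<in> {s..t} \<Longrightarrow> \<alpha> r \<in> Icube n) \<Longrightarrow>
     (\<And>i. i \<in> {1..n} \<Longrightarrow> continuous_on {s..t} (\<lambda>r. \<alpha> r i)) \<Longrightarrow>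
     (\<And>i. i \<in> {1..n} \<Longrightarrow> mono_on {s..t} (\<lambda>r. \<alpha> r i)) \<Longrightarrow>
     piecewise_dpath Q s t (\<lambda>r. f (point_class P n x (\<alpha> r)))"
  shows "dmap (realization P) (realization Q) f"
proof -
  have "piecewise_dpath P s t \<omega> \<Longrightarrow> piecewise_dpath Q s t (\<lambda>r. f (\<omega> r))" for s t \<omega>
  proof (induction rule: piecewise_dpath.induct)
    case (piece s t x n \<alpha> \<omega>)
    then have "piecewise_dpath Q s t (\<lambda>r. f (point_class P n x (\<alpha> r)))"
      by (intro assms(2)) auto
    then show ?case
      by (rule piecewise_dpath_cong) (use piece in auto)
  next
    case (join r s \<omega> t)
    then show ?case by (rule_tac piecewise_dpath.join)
  qed
  then have "piecewise_dpath Q 0 1 (dpath_comp f \<omega>)" if "piecewise_dpath P 0 1 \<omega>" for \<omega>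
    by (rule piecewise_dpath_cong[OF _ dpath_comp_apply[symmetric]]) (use that in auto)
  then show ?thesis
    using cont is_dspace_realization[of P] is_dspace_realization[of Q]
    by (simp add: dmap_def dtop_realization dpaths_realization_iff dpath_comp_def)
qed

section \<open>Extremal points of the geometric realization\<close>

lemma pt0_Icube [simp]: "pt0 \<in> Icube 0"
  by (simp add: Icube_0)

lemma pt0_open_cube [simp]: "pt0 \<in> open_cube 0"
  by (simp add: open_cube_def)

text \<open>Read backwards, the reduction to the vertex starts with no coordinates and inserts one
  coordinate 0 or 1 at each step.\<close>

lemma point_class_vertex_coordinates:
  assumes P: "precubical_set P" and "point_class P n z u = point_class P 0 v pt0"
    and "i \<in> {1..n}" "u \<in> Icube n"
  shows "u i = 0 \<or> u i = 1"
proof -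
  have "(glue P)\<inverse>\<inverse>\<^sup>*\<^sup>* (n, z, u) (0, v, pt0)"
    using point_class_eq_open_cube[OF P assms(2)] by simp
  then have "\<forall>i\<in>{1..fst (n, z, u)}. snd (snd (n, z, u)) i \<in> {0, 1}"
  proof (induction rule: converse_rtranclp_induct)
    case (step p q)
    from step.hyps(1) have "glue P q p" by simp
    then obtain x n i k w where q: "q = (n, bd P (Suc n) i k x, w)" "p = (Suc n, x, face_map n i k w)"
      "i \<in> {1..Suc n}" "k \<in> {0,1}" "w \<in> Icube n"
      by (rule glue.cases)
    have "w j \<in> {0, 1}" if "j \<in> {1..n}" for j
      using step.IH that by (simp add: q)
    moreover have "j < i \<Longrightarrow> j \<in> {1..n}" "i < j \<Longrightarrow> j - 1 \<in> {1..n}" if "j \<in> {1..Suc n}" for j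
      using q(3) that by auto
    moreover have "real k \<in> {0, 1}"
      using q(4) by auto
    ultimately have "face_map n i k w j \<in> {0, 1}" if "j \<in> {1..Suc n}" for j
      using that by (simp only: face_map_apply[OF q(5) that]) (metis linorder_neqE_nat)
    then show ?case by (simp add: q)
  qed simp
  then show ?thesis using assms(3) by auto
qed

lemma face_map_0: "face_map 0 1 k pt0 = (\<lambda>j\<in>{1..1}. real k)"
  by (auto simp: face_map_def Icube_0 fun_eq_iff)

text \<open>Descending to faces that preserve the coordinate \<open>i\<close> leads to an edge on
  which the vertex is the end given by \<open>k\<close>.\<close>

lemma vertex_at_corner:
  assumes P: "precubical_set P"
    and "point_class P n z u = point_class P 0 v pt0" "z \<in> cells P n" "u \<in> Icube n"
      "i \<in> {1..n}" "k \<in> {0,1}" "u i = real k"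
  shows "\<exists>y\<in>cells P 1. bd P 1 1 k y = v"
  using assms(2-)
proof (induction n arbitrary: z u i)
  case (Suc n)
  show ?case
  proof (cases n)
    case 0
    then have "i = 1" using Suc.prems by auto
    then have u: "u = face_map 0 1 k pt0"
      using face_map_del[of u 0 1 k] Suc.prems 0 face_del_in[of u 0 1] by (auto simp: Icube_0)
    have "point_class P 0 (bd P 1 1 k z) pt0 = point_class P 0 v pt0"
      using point_class_face[of z P 0 1 k pt0] Suc.prems 0 by (simp add: u)
    then have "bd P 1 1 k z = v"
      using point_class_open_cube_unique[OF P] by fastforce
    then show ?thesis using Suc.prems 0 by auto
  next
    case (Suc m)
    \<comment> \<open>Any further coordinate is 0 or 1 as well, so the point lies on a face in
      direction \<open>j\<close>. Deleting coordinate \<open>j\<close> shifts the index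
      \<open>i\<close> by one if \<open>j < i\<close>.\<close>
    obtain j where j: "j \<in> {1..Suc n}" "j \<noteq> i"
      by (cases "i = 1") (auto intro: that[of 1] that[of 2] simp: Suc)
    obtain l :: nat where l: "l \<in> {0,1}" "u j = real l"
      using point_class_vertex_coordinates[OF P Suc.prems(1) j(1) Suc.prems(3)]
      by (metis insertI1 insertI2 of_nat_0 of_nat_1)
    let ?w = "face_del n j u" and ?i = "if i < j then i else i - 1"
    have "point_class P n (bd P (Suc n) j l z) ?w = point_class P (Suc n) z u"
      using point_class_face[of z P n j l ?w] Suc.prems j l by (simp add: face_del_in face_map_del)
    moreover have "bd P (Suc n) j l z \<in> cells P n"
      using bd_in[OF P Suc.prems(2), of j l] j l by simp
    moreover have "?i \<in> {1..n}"
      using Suc.prems(4) j by auto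
    moreover have "?w ?i = real k"
      using \<open>?i \<in> {1..n}\<close> Suc.prems(6) j(2) by (auto simp: face_del_def)
    ultimately show ?thesis
      using Suc.IH[of "bd P (Suc n) j l z" ?w ?i] Suc.prems by (simp add: face_del_in)
  qed
qed simp

text \<open>At the end of a cube path arriving at \<open>v\<close>, a coordinate 1 would produce an
  edge with final vertex \<open>v\<close>. So all coordinates end at 0 and, being increasing, are
  constant.\<close>

lemma piecewise_dpath_into_min_vertex:
  assumes P: "precubical_set P" and v: "\<not> (\<exists>y\<in>cells P 1. bd P 1 1 1 y = v)"
  shows "piecewise_dpath P s t \<omega> \<Longrightarrow> \<omega> t = point_class P 0 v pt0 \<Longrightarrow> \<omega> s = point_class P 0 v pt0"
proof (induction rule: piecewise_dpath.induct)
  case (piece s t x n \<alpha> \<omega>)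
  have "\<alpha> s = \<alpha> t"
  proof (rule Icube_eqI)
    fix i assume i: "i \<in> {1..n}"
    have eq: "point_class P n x (\<alpha> t) = point_class P 0 v pt0"
      using piece by simp
    have "\<alpha> t i = 0"
      using point_class_vertex_coordinates[OF P eq i] vertex_at_corner[OF P eq piece.hyps(2) _ i, of 1]
        piece.hyps(1,3) v by auto
    moreover have "\<alpha> s i \<le> \<alpha> t i"
      using mono_onD[OF piece.hyps(5)[OF i], of s t] piece.hyps(1) by simp
    ultimately show "\<alpha> s i = \<alpha> t i"
      using Icube_le[OF piece.hyps(3) i, of s] piece.hyps(1) by simp
  qed (use piece in auto)
  then show ?case using piece by auto
qed simp

lemma piecewise_dpath_from_max_vertex:
  assumes P: "precubical_set P" and v: "\<not> (\<exists>y\<in>cells P 1. bd P 1 1 0 y = v)"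
  shows "piecewise_dpath P s t \<omega> \<Longrightarrow> \<omega> s = point_class P 0 v pt0 \<Longrightarrow> \<omega> t = point_class P 0 v pt0"
proof (induction rule: piecewise_dpath.induct)
  case (piece s t x n \<alpha> \<omega>)
  have "\<alpha> s = \<alpha> t"
  proof (rule Icube_eqI)
    fix i assume i: "i \<in> {1..n}"
    have eq: "point_class P n x (\<alpha> s) = point_class P 0 v pt0"
      using piece by simp
    have "\<alpha> s i = 1"
      using point_class_vertex_coordinates[OF P eq i] vertex_at_corner[OF P eq piece.hyps(2) _ i, of 0]
        piece.hyps(1,3) v by auto
    moreover have "\<alpha> s i \<le> \<alpha> t i"
      using mono_onD[OF piece.hyps(5)[OF i], of s t] piece.hyps(1) by simp
    ultimately show "\<alpha> s i = \<alpha> t i"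
      using Icube_le[OF piece.hyps(3) i, of t] piece.hyps(1) by simp
  qed (use piece in auto)
  then show ?case using piece by auto
qed simp

section \<open>Extremal points versus extremal vertices\<close>

lemma is_dspace_sub_realization: "is_dspace (sub_realization P Q)"
  unfolding sub_realization_def by (rule is_dspace_dsub[OF is_dspace_realization])

lemma topspace_sub_realization:
  assumes "precubical_subset Q P"
  shows "topspace (dtop (sub_realization P Q)) = {point_class P n x u | n x u. x \<in> cells Q n \<and> u \<in> Icube n}"
  using assms unfolding sub_realization_def topspace_dsub topspace_realization
  by (auto simp: precubical_subset_def) blast

lemma sub_realization_segment:
  assumes Q: "precubical_subset Q P" and x: "x \<in> cells Q n" and u: "u \<in> Icube n"
    and j: "j \<in> {1..n}" and ab: "0 \<le> a" "a \<le> b" "b \<le> 1"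
  shows "\<exists>\<omega>\<in>dpaths (sub_realization P Q). \<omega> 0 = point_class P n x (u(j := a)) \<and> \<omega> 1 = point_class P n x (u(j := b))"
proof -
  define \<alpha> where "\<alpha> = (\<lambda>r. u(j := a + r * (b - a)))"
  let ?\<omega> = "\<lambda>r\<in>{0..1}. point_class P n x (\<alpha> r)"
  have "a + r * (b - a) \<in> {0..1}" if "r \<in> {0..1}" for r
  proof -
    have "r * (b - a) \<le> 1 * (b - a)" "0 \<le> r * (b - a)"
      using mult_right_mono[of r 1 "b - a"] that ab by auto
    then show ?thesis using ab by auto
  qed
  then have \<alpha>: "\<alpha> r \<in> Icube n" if "r \<in> {0..1}" for r
    using u j that by (auto simp: \<alpha>_def Icube_def PiE_iff extensional_def)
  have "piecewise_dpath P 0 1 ?\<omega>"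
  proof (rule piecewise_dpath.piece[of 0 1 x P n \<alpha>])
    fix i
    show "continuous_on {0..1} (\<lambda>r. \<alpha> r i)" "mono_on {0..1} (\<lambda>r. \<alpha> r i)"
      using ab by (cases "i = j"; auto simp: \<alpha>_def intro!: continuous_intros mono_onI mult_right_mono)+
  qed (use Q x \<alpha> in \<open>auto simp: precubical_subset_def\<close>)
  moreover have "?\<omega> ` {0..1} \<subseteq> {point_class P n x u | n x u. x \<in> cells Q n \<and> u \<in> Icube n}"
    using \<alpha> x by (auto intro!: exI[of _ n] exI[of _ x])
  ultimately have "?\<omega> \<in> dpaths (sub_realization P Q)"
    by (simp add: sub_realization_def dpaths_dsub dpaths_realization_iff)
  then show ?thesis
    by (intro bexI[of _ ?\<omega>]) (auto simp: \<alpha>_def)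
qed

lemma min_point_iff:
  "min_point X p \<longleftrightarrow> p \<in> topspace (dtop X) \<and> (\<forall>\<omega>\<in>dpaths X. \<omega> 0 \<in> topspace (dtop X) \<longrightarrow> \<omega> 1 = p \<longrightarrow> \<omega> 0 = p)"
  unfolding min_point_def fund_cat_simps by blast

lemma max_point_iff:
  "max_point X p \<longleftrightarrow> p \<in> topspace (dtop X) \<and> (\<forall>\<omega>\<in>dpaths X. \<omega> 1 \<in> topspace (dtop X) \<longrightarrow> \<omega> 0 = p \<longrightarrow> \<omega> 1 = p)"
  unfolding max_point_def fund_cat_simps by blast

text \<open>The segment parallel to axis \<open>j\<close> is a d-path into or out of
  \<open>p\<close>; extremality makes its other end equal to \<open>p\<close>.\<close>

lemma sub_realization_segment_ends:
  assumes P: "precubical_set P" and Q: "precubical_subset Q P" and x: "x \<in> cells Q n" and u: "u \<in> Icube n"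
    and j: "j \<in> {1..n}" and p: "p = point_class P n x u"
  shows "min_point (sub_realization P Q) p \<Longrightarrow> 0 \<le> a \<Longrightarrow> a \<le> u j \<Longrightarrow> point_class P n x (u(j := a)) = p"
    and "max_point (sub_realization P Q) p \<Longrightarrow> u j \<le> a \<Longrightarrow> a \<le> 1 \<Longrightarrow> point_class P n x (u(j := a)) = p"
proof -
  have d: "is_dspace (sub_realization P Q)" by (rule is_dspace_sub_realization)
  have u01: "0 \<le> u j" "u j \<le> 1" using Icube_le[OF u j] by auto
  have top: "\<omega> r \<in> topspace (dtop (sub_realization P Q))" if "\<omega> \<in> dpaths (sub_realization P Q)" "r \<in> {0..1}" for \<omega> r
    using dpaths_in_topspace[OF d that] .
  have u_eq: "u(j := u j) = u" by simp
  show "point_class P n x (u(j := a)) = p"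
    if m: "min_point (sub_realization P Q) p" and a: "0 \<le> a" "a \<le> u j"
  proof -
    obtain \<omega> where "\<omega> \<in> dpaths (sub_realization P Q)" "\<omega> 0 = point_class P n x (u(j := a))" "\<omega> 1 = p"
      using sub_realization_segment[OF Q x u j a u01(2)] unfolding u_eq p by blast
    then show ?thesis using m top[of \<omega> 0] unfolding min_point_iff by auto
  qed
  show "point_class P n x (u(j := a)) = p"
    if m: "max_point (sub_realization P Q) p" and a: "u j \<le> a" "a \<le> 1"
  proof -
    obtain \<omega> where "\<omega> \<in> dpaths (sub_realization P Q)" "\<omega> 0 = p" "\<omega> 1 = point_class P n x (u(j := a))"
      using sub_realization_segment[OF Q x u j u01(1) a] unfolding u_eq p by blast
    then show ?thesis using m top[of \<omega> 1] unfolding max_point_iff by auto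
  qed
qed

text \<open>In an open cube of positive degree, moving one coordinate down or up gives d-paths into
  and out of the point whose other end is a different point, since representatives in open cubes are
  unique.\<close>

lemma extremal_point_is_vertex:
  assumes P: "precubical_set P" and Q: "precubical_subset Q P"
    and p: "min_point (sub_realization P Q) p \<or> max_point (sub_realization P Q) p"
  shows "\<exists>v\<in>cells Q 0. p = point_class P 0 v pt0"
proof -
  have "p \<in> topspace (dtop (sub_realization P Q))"
    using p by (auto simp: min_point_iff max_point_iff)
  then obtain n x u where x: "x \<in> cells Q n" and u: "u \<in> open_cube n" and p_eq: "p = point_class P n x u"
    unfolding topspace_sub_realization[OF Q] using open_cube_representative[OF Q] by blast
  have uI: "u \<in> Icube n" using u by (simp add: open_cube_def)
  show ?thesis
  proof (cases n)
    case 0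
    then show ?thesis using x uI p_eq by (auto simp: Icube_0)
  next
    case (Suc m)
    then have j: "1 \<in> {1..n}" by simp
    have u1: "0 < u 1" "u 1 < 1" using u j by (auto simp: open_cube_def)
    have no: "point_class P n x (u(1 := a)) \<noteq> p" if "0 < a" "a < 1" "a \<noteq> u 1" for a
    proof
      assume "point_class P n x (u(1 := a)) = p"
      moreover have "u(1 := a) \<in> open_cube n"
        using that u j by (auto simp: open_cube_def Icube_def PiE_iff extensional_def)
      ultimately have "u(1 := a) = u"
        using point_class_open_cube_unique[OF P _ _ u] unfolding p_eq by blast
      then show False using that(3) by (metis fun_upd_same)
    qed
    \<comment> \<open>The first alternative serves minimal points, the second maximal points; both
      new coordinates stay strictly between 0 and 1.\<close>
    have "point_class P n x (u(1 := u 1 / 2)) = p \<or> point_class P n x (u(1 := (1 + u 1) / 2)) = p"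
      using p sub_realization_segment_ends[OF P Q x uI j p_eq] u1 by auto
    then show ?thesis using no[of "u 1 / 2"] no[of "(1 + u 1) / 2"] u1 by auto
  qed
qed

lemma vertex_edge_midpoint:
  assumes P: "precubical_set P" and y: "y \<in> cells P 1" and u: "u \<in> Icube 1"
  shows "point_class P 1 y (u(1 := 1/2)) \<noteq> point_class P 0 v pt0"
proof
  assume *: "point_class P 1 y (u(1 := 1/2)) = point_class P 0 v pt0"
  have "u(1 := 1/2) \<in> open_cube 1"
    using u by (auto simp: open_cube_def Icube_def PiE_iff extensional_def)
  from point_class_open_cube_unique[OF P * this pt0_open_cube] show False by simp
qed

text \<open>d-paths in the d-subspace are decomposed into cubes of \<open>P\<close>, so extremality
  of the vertex in \<open>P\<close> is used to exclude them. Conversely, only edges of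
  \<open>Q\<close> provide d-paths inside $|Q|$. The last two hypotheses bridge this
  difference.\<close>

lemma min_max_point_vertex_iff:
  assumes P: "precubical_set P" and Q: "precubical_subset Q P" and v: "v \<in> cells Q 0"
    and min: "min_vertex Q v \<longleftrightarrow> min_vertex P v" and max: "max_vertex Q v \<longleftrightarrow> max_vertex P v"
  shows "min_point (sub_realization P Q) (point_class P 0 v pt0) \<longleftrightarrow> min_vertex P v" (is "?L1 \<longleftrightarrow> ?R1")
    and "max_point (sub_realization P Q) (point_class P 0 v pt0) \<longleftrightarrow> max_vertex P v" (is "?L2 \<longleftrightarrow> ?R2")
proof -
  let ?v = "point_class P 0 v pt0"
  have top: "?v \<in> topspace (dtop (sub_realization P Q))"
    using v unfolding topspace_sub_realization[OF Q] by force
  have pd: "piecewise_dpath P 0 1 \<omega>" if "\<omega> \<in> dpaths (sub_realization P Q)" for \<omega>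
    using that by (simp add: sub_realization_def dpaths_dsub dpaths_realization_iff)
  have edge: "?v = point_class P 1 y (face_map 0 1 k pt0)" "y \<in> cells P 1" "face_map 0 1 k pt0 \<in> Icube 1"
    "bd P 1 1 k y = v" if "y \<in> cells Q 1" "bd Q 1 1 k y = v" "k \<in> {0,1}" for y k
  proof -
    show y: "y \<in> cells P 1" "bd P 1 1 k y = v"
      using that Q by (auto simp: precubical_subset_def)
    show "?v = point_class P 1 y (face_map 0 1 k pt0)"
      using point_class_face[of y P 0 1 k pt0] y that(3) by simp
    show "face_map 0 1 k pt0 \<in> Icube 1"
      using face_map_in[of pt0 0 1 k] that(3) by simp
  qed
  have fm: "face_map 0 1 k pt0 1 = real k" for k
    by (subst face_map_0) simp
  show "?L1 \<longleftrightarrow> ?R1"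
  proof
    assume ?R1
    then show ?L1
      using top pd piecewise_dpath_into_min_vertex[OF P] unfolding min_point_iff min_vertex_def by blast
  next
    assume L: ?L1
    have False if y: "y \<in> cells Q 1" "bd Q 1 1 1 y = v" for y
    proof -
      note e = edge[OF y insertI2[OF singletonI]]
      show False
        using sub_realization_segment_ends(1)[OF P Q y(1) _ _ e(1) L, of 1 "1/2"] e(3)
          vertex_edge_midpoint[OF P e(2,3), of v] fm[of 1] by simp
    qed
    then show ?R1 using v min by (auto simp: min_vertex_def)
  qed
  show "?L2 \<longleftrightarrow> ?R2"
  proof
    assume ?R2
    then show ?L2
      using top pd piecewise_dpath_from_max_vertex[OF P] unfolding max_point_iff max_vertex_def by blast
  next
    assume L: ?L2
    have False if y: "y \<in> cells Q 1" "bd Q 1 1 0 y = v" for y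
    proof -
      note e = edge[OF y insertI1]
      show False
        using sub_realization_segment_ends(2)[OF P Q y(1) _ _ e(1) L, of 1 "1/2"] e(3)
          vertex_edge_midpoint[OF P e(2,3), of v] fm[of 0] by simp
    qed
    then show ?R2 using v max by (auto simp: max_vertex_def)
  qed
qed

lemma topspace_dextrl_sub_realization:
  assumes P: "precubical_set P" and Q: "precubical_subset Q P"
    and min: "\<And>v. min_vertex Q v \<longleftrightarrow> min_vertex P v" and max: "\<And>v. max_vertex Q v \<longleftrightarrow> max_vertex P v"
  shows "topspace (dtop (dextrl (sub_realization P Q))) = {point_class P 0 v pt0 | v. v \<in> cells (extrl P) 0}"
proof -
  have ext: "min_point (sub_realization P Q) p \<or> max_point (sub_realization P Q) p \<longleftrightarrow>
      (\<exists>v. p = point_class P 0 v pt0 \<and> (min_vertex P v \<or> max_vertex P v))" for p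
  proof -
    have "v \<in> cells Q 0" if "min_vertex P v \<or> max_vertex P v" for v
      using that min[of v] max[of v] by (auto simp: min_vertex_def max_vertex_def)
    then show ?thesis
      using extremal_point_is_vertex[OF P Q] min_max_point_vertex_iff[OF P Q _ min max] by blast
  qed
  have "topspace (dtop (dextrl (sub_realization P Q))) = {p. min_point (sub_realization P Q) p \<or> max_point (sub_realization P Q) p}"
    by (auto simp: dextrl_def topspace_dsub min_point_iff max_point_iff)
  then show ?thesis
    unfolding ext by (auto simp: extrl_def)
qed

lemma sub_realization_self: "sub_realization P P = realization P"
  unfolding sub_realization_def topspace_realization[symmetric] by (rule dsub_topspace[OF is_dspace_realization])

section \<open>Regular squares\<close>

definition edge_pt :: "real \<Rightarrow> nat \<Rightarrow> real" where
  "edge_pt v = (\<lambda>j\<in>{1..1}. v)"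

lemma edge_pt_1 [simp]: "edge_pt v 1 = v" "edge_pt v (Suc 0) = v"
  by (simp_all add: edge_pt_def)

lemma edge_pt_in: "v \<in> {0..1} \<Longrightarrow> edge_pt v \<in> Icube 1"
  using Icube_restrictI[of 1 "\<lambda>_. v"] by (simp add: edge_pt_def)

lemma Icube_1_eq: "u \<in> Icube 1 \<Longrightarrow> u = edge_pt (u 1)"
  by (rule Icube_eqI[of _ 1], assumption, rule edge_pt_in) (use Icube_le[of u 1 1] in auto)

lemma face_map_0_edge: "face_map 0 1 k pt0 = edge_pt (real k)"
  unfolding edge_pt_def by (rule face_map_0)

text \<open>Degrees 0 and 1 of $x_\<sharp>$ are all that is extracted from regularity: the vertices
  and edges of \<open>x\<close> come injectively from those of the standard square.\<close>

lemma regular_square_faces: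
  assumes "regular_element P 2 x"
  obtains f0 f1 where
    "\<And>i k. i \<in> {1,2} \<Longrightarrow> k \<in> {0,1} \<Longrightarrow> f1 (face_map 1 i k) = bd P 2 i k x"
    "\<And>i k l. i \<in> {1,2} \<Longrightarrow> k \<in> {0,1} \<Longrightarrow> l \<in> {0,1} \<Longrightarrow>
       f0 (compose (Icube 0) (face_map 1 i k) (face_map 0 1 l)) = bd P 1 1 l (bd P 2 i k x)"
    "inj_on f0 (cells (std_cube 2) 0)" "inj_on f1 (cells (std_cube 2) 1)"
proof -
  obtain f where f: "precubical_morphism (std_cube 2) P f" and fx: "f 2 (\<lambda>u\<in>Icube 2. u) = x"
    and inj: "\<And>m. inj_on (f m) (cells (std_cube 2) m)"
    using assms by (auto simp: regular_element_def)
  have bdf: "f (n - 1) (compose (Icube (n - 1)) h (face_map (n - 1) i k)) = bd P n i k (f n h)"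
    if "n > 0" "i \<in> {1..n}" "k \<in> {0,1}" "box_mor n 2 h" for n i k h
    using conjunct2[OF f[unfolded precubical_morphism_def], rule_format, of n i k h] that
    by (simp add: std_cube_def)
  have edge: "f 1 (face_map 1 i k) = bd P 2 i k x" if "i \<in> {1,2}" "k \<in> {0,1}" for i k
  proof -
    have "compose (Icube 1) (\<lambda>u\<in>Icube 2. u) (face_map 1 i k) = face_map 1 i k"
      using face_map_in[of _ 1 i k] that by (auto simp: compose_def face_map_def fun_eq_iff numeral_2_eq_2)
    then show ?thesis
      using bdf[of 2 i k "\<lambda>u\<in>Icube 2. u"] that box_mor.ident[of 2] fx by auto
  qed
  moreover have "f 0 (compose (Icube 0) (face_map 1 i k) (face_map 0 1 l)) = bd P 1 1 l (bd P 2 i k x)"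
    if "i \<in> {1,2}" "k \<in> {0,1}" "l \<in> {0,1}" for i k l
    using bdf[of 1 1 l "face_map 1 i k"] box_mor.face[of i 1 k] that edge[OF that(1,2)]
    by (auto simp: numeral_2_eq_2)
  ultimately show ?thesis
    using inj by (intro that[of "f 1" "f 0"]) auto
qed

lemma regular_edges:
  assumes x: "regular_element P 2 x" and "i \<in> {1,2}" "j \<in> {1,2}" "k \<in> {0,1}" "l \<in> {0,1}"
    and eq: "bd P 2 i k x = bd P 2 j l x"
  shows "i = j \<and> k = l"
proof -
  obtain f0 f1 where f1: "\<And>i k. i \<in> {1,2} \<Longrightarrow> k \<in> {0,1} \<Longrightarrow> f1 (face_map 1 i k) = bd P 2 i k x"
    "inj_on f1 (cells (std_cube 2) 1)"
    using regular_square_faces[OF x] by metis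
  have "face_map 1 i k \<in> cells (std_cube 2) 1" "face_map 1 j l \<in> cells (std_cube 2) 1"
    using assms box_mor.face[of _ 1] by (auto simp: std_cube_def numeral_2_eq_2)
  then have eq: "face_map 1 i k = face_map 1 j l"
    using f1 assms inj_onD[OF f1(2)] by metis
  \<comment> \<open>The midpoint tells the four edges apart: its coordinate in the direction normal
    to the edge is 0 or 1, the other one is 1/2.\<close>
  have h: "edge_pt (1/2) \<in> Icube 1"
    by (rule edge_pt_in) auto
  have "face_map 1 i k (edge_pt (1/2)) i = face_map 1 j l (edge_pt (1/2)) i"
    by (simp only: eq)
  then show ?thesis
    using face_map_apply[OF h, of i i k] face_map_apply[OF h, of i j l] assms(2-5) by auto
qed

text \<open>Each vertex of a square is an end of two of its edges, so the conclusion compares points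
  of the square and not the indices.\<close>

lemma regular_vertices:
  assumes x: "regular_element P 2 x" and "i \<in> {1,2}" "j \<in> {1,2}" "k \<in> {0,1}" "l \<in> {0,1}" "k' \<in> {0,1}" "l' \<in> {0,1}"
    and eq: "bd P 1 1 l (bd P 2 i k x) = bd P 1 1 l' (bd P 2 j k' x)"
  shows "face_map 1 i k (edge_pt (real l)) = face_map 1 j k' (edge_pt (real l'))"
proof -
  obtain f0 f1 where f0: "\<And>i k l. i \<in> {1,2} \<Longrightarrow> k \<in> {0,1} \<Longrightarrow> l \<in> {0,1} \<Longrightarrow>
       f0 (compose (Icube 0) (face_map 1 i k) (face_map 0 1 l)) = bd P 1 1 l (bd P 2 i k x)"
    "inj_on f0 (cells (std_cube 2) 0)"
    using regular_square_faces[OF x] by metis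
  have "compose (Icube 0) (face_map 1 i k) (face_map 0 1 l) \<in> cells (std_cube 2) 0"
    if "i \<in> {1,2}" "k \<in> {0,1}" "l \<in> {0,1}" for i k l
  proof -
    have "box_mor 0 1 (face_map 0 1 l)" "box_mor 1 2 (face_map 1 i k)"
      using box_mor.face[of 1 0 l] box_mor.face[of i 1 k] that by (auto simp: numeral_2_eq_2)
    then show ?thesis
      using box_mor.comp[of 0 1 "face_map 0 1 l" 2] by (simp add: std_cube_def)
  qed
  then have "compose (Icube 0) (face_map 1 i k) (face_map 0 1 l) = compose (Icube 0) (face_map 1 j k') (face_map 0 1 l')"
    using f0 assms inj_onD[OF f0(2)] by metis
  then have "compose (Icube 0) (face_map 1 i k) (face_map 0 1 l) pt0
      = compose (Icube 0) (face_map 1 j k') (face_map 0 1 l') pt0"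
    by simp
  then show ?thesis
    by (simp only: compose_def restrict_apply pt0_Icube if_True face_map_0_edge)
qed

lemma precubical_subsetI:
  assumes P: "precubical_set P" and "\<And>n. C n \<subseteq> cells P n"
    and "\<And>n i k z. 0 < n \<Longrightarrow> i \<in> {1..n} \<Longrightarrow> k \<in> {0,1} \<Longrightarrow> z \<in> C n \<Longrightarrow> bd P n i k z \<in> C (n - 1)"
  shows "precubical_subset (P\<lparr>cells := C\<rparr>) P"
proof -
  have "bd P (n - 1) i k (bd P n j l z) = bd P (n - 1) (j - 1) l (bd P n i k z)"
    if "k \<in> {0,1}" "l \<in> {0,1}" "z \<in> C n" "1 \<le> i \<and> i < j \<and> j \<le> n" for n i j k l z
    using bd_bd[OF P, of z n i j k l] assms(2)[of n] that by auto
  then show ?thesis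
    unfolding precubical_subset_def precubical_set_def using assms(2,3) by simp
qed

text \<open>\<open>free\<close>, \<open>only\<close> and \<open>Y_free\<close> express hypotheses
  (i), (ii) and (iii) by single boundary operators, which reach every edge of a square.\<close>

locale collapsible_square =
  fixes P :: "'a precubical" and a b :: nat and x :: 'a and Y :: "'a set"
  assumes P: "precubical_set P"
    and a: "a \<in> {1,2}" and b: "b \<in> {0,1}"
    and x: "x \<in> cells P 2" and reg: "regular_element P 2 x"
    and Y: "Y = {y \<in> cells P 1 - {bd P 2 (3 - a) b x}.
           bd P 1 1 (1 - b) y = bd P 1 1 (1 - b) (bd P 2 (3 - a) b x)}"
    and free: "\<And>z i k. z \<in> cells P 2 \<Longrightarrow> z \<noteq> x \<Longrightarrow> i \<in> {1,2} \<Longrightarrow> k \<in> {0,1} \<Longrightarrow>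
       bd P 2 i k z \<noteq> bd P 2 a (1 - b) x \<and> bd P 2 i k z \<noteq> bd P 2 (3 - a) b x"
    and only: "\<And>y. y \<in> cells P 1 \<Longrightarrow> bd P 1 1 b y = bd P 1 1 b (bd P 2 a (1 - b) x) \<Longrightarrow> y = bd P 2 a (1 - b) x"
    and Y_free: "\<And>z i k. z \<in> cells P 2 \<Longrightarrow> i \<in> {1,2} \<Longrightarrow> k \<in> {0,1} \<Longrightarrow> bd P 2 i k z \<notin> Y"
begin

text \<open>In the coordinates \<open>s\<close>, \<open>t\<close> introduced below, the edges \<open>right\<close> and \<open>bottom\<close> are given by
  \<open>s = 1\<close> and \<open>t = 0\<close>, respectively.\<close>

definition right :: 'a where "right = bd P 2 a (1 - b) x"
definition bottom :: 'a where "bottom = bd P 2 (3 - a) b x"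
definition corner :: 'a where "corner = bd P 1 1 (1 - b) bottom"

definition Q :: "'a precubical" where
  "Q = P\<lparr>cells := (cells P)(1 := cells P 1 - {bottom}, 2 := cells P 2 - {x})\<rparr>"

definition R :: "'a precubical" where
  "R = Q\<lparr>cells := (cells Q)(0 := cells Q 0 - {corner}, 1 := cells Q 1 - ({right} \<union> Y))\<rparr>"

lemma a3 [simp]: "3 - a \<in> {1,2}" "3 - a \<noteq> a" "a \<noteq> 3 - a" "3 - (3 - a) = a"
  using a by auto

lemma b1 [simp]: "1 - b \<in> {0,1}" "1 - b \<noteq> b" "b \<noteq> 1 - b"
  using b by auto

lemma index_cases: "i \<in> {1,2} \<Longrightarrow> i = a \<or> i = 3 - a"
  using a by auto

lemma side_cases: "k \<in> {0,1} \<Longrightarrow> k = b \<or> k = 1 - b"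
  using b by auto

lemma square_bd: "i \<in> {1,2} \<Longrightarrow> k \<in> {0,1} \<Longrightarrow> z \<in> cells P 2 \<Longrightarrow> bd P 2 i k z \<in> cells P 1"
  using bd_in[OF P, of z 2 i k] by auto

lemma right_in: "right \<in> cells P 1" and bottom_in: "bottom \<in> cells P 1"
  using square_bd[OF _ _ x] a b unfolding right_def bottom_def by auto

lemma edges_eq_iff:
  assumes "i \<in> {1,2}" "k \<in> {0,1}"
  shows "bd P 2 i k x = right \<longleftrightarrow> i = a \<and> k = 1 - b" "bd P 2 i k x = bottom \<longleftrightarrow> i = 3 - a \<and> k = b"
  unfolding right_def bottom_def
  using regular_edges[OF reg assms(1) a assms(2) b1(1)] regular_edges[OF reg assms(1) a3(1) assms(2) b]
  by auto

lemma right_neq_bottom: "right \<noteq> bottom"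
  using edges_eq_iff(2)[OF a b1(1)] by (simp add: right_def)

lemma vertex_swap:
  assumes "k \<in> {0,1}" "l \<in> {0,1}"
  shows "bd P 1 1 l (bd P 2 a k x) = bd P 1 1 k (bd P 2 (3 - a) l x)"
  using bd_bd[OF P x, of 1 2 k l] bd_bd[OF P x, of 1 2 l k] a assms by auto

lemma corner_eq: "bd P 1 1 b right = corner"
  using vertex_swap[of "1 - b" b] b unfolding right_def corner_def bottom_def by auto

text \<open>By regularity the four vertices of \<open>x\<close> are distinct, and the two
  coordinates of a vertex of the standard square determine \<open>k\<close> and
  \<open>l\<close>.\<close>

lemma square_vertex_eq_corner:
  assumes "k \<in> {0,1}" "l \<in> {0,1}" "bd P 1 1 l (bd P 2 a k x) = corner"
  shows "k = 1 - b \<and> l = b"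
proof -
  have eq: "face_map 1 a k (edge_pt (real l)) = face_map 1 a (1 - b) (edge_pt (real b))"
    using regular_vertices[OF reg a a assms(1,2) b1(1) b] assms(3) corner_eq unfolding right_def by simp
  have lb: "edge_pt (real l) \<in> Icube 1" "edge_pt (real b) \<in> Icube 1"
    using assms b by (intro edge_pt_in; auto)+
  have "face_map 1 a k (edge_pt (real l)) a = face_map 1 a (1 - b) (edge_pt (real b)) a"
    "face_map 1 a k (edge_pt (real l)) (3 - a) = face_map 1 a (1 - b) (edge_pt (real b)) (3 - a)"
    by (simp_all only: eq)
  then show ?thesis
    using a lb by (auto simp: face_map_apply)
qed

lemma right_end: "bd P 1 1 (1 - b) right \<noteq> corner"
  using square_vertex_eq_corner[OF b1(1) b1(1)] b1(2) unfolding right_def by blast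

lemma Y_iff: "y \<in> Y \<longleftrightarrow> y \<in> cells P 1 \<and> y \<noteq> bottom \<and> bd P 1 1 (1 - b) y = corner"
  unfolding Y corner_def bottom_def by auto

lemma right_notin_Y: "right \<notin> Y"
  using right_end by (auto simp: Y_iff)

lemma bottom_notin_Y: "bottom \<notin> Y"
  by (auto simp: Y_iff)

text \<open>These are the edges that have to follow the moving corner. Hypothesis (ii) leaves only
  \<open>right\<close> on side \<open>b\<close>; on the other side everything but
  \<open>bottom\<close> is in \<open>Y\<close> by definition.\<close>

lemma edge_at_corner:
  assumes "y \<in> cells P 1" "k \<in> {0,1}" "bd P 1 1 k y = corner"
  shows "k = b \<and> y = right \<or> k = 1 - b \<and> (y = bottom \<or> y \<in> Y)"
  using side_cases[OF assms(2)]
proof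
  assume "k = b"
  then show ?thesis
    using only[OF assms(1)] assms(3) corner_eq unfolding right_def[symmetric] by auto
next
  assume "k = 1 - b"
  then show ?thesis using assms by (auto simp: Y_iff)
qed

lemma free':
  assumes "z \<in> cells P 2" "z \<noteq> x" "i \<in> {1,2}" "k \<in> {0,1}"
  shows "bd P 2 i k z \<noteq> right" "bd P 2 i k z \<noteq> bottom"
  using free[OF assms] unfolding right_def bottom_def by auto

text \<open>If \<open>x\<close> were a face of a 3-cube, then by freeness both faces through the edge \<open>right\<close> and both
  faces through \<open>bottom\<close> would be \<open>x\<close>, and regularity would force \<open>x\<close> to lie at contradictory
  positions.\<close>

lemma not_face_of_3_cell:
  assumes z: "z \<in> cells P 3" and i: "i \<in> {1..3}" and k: "k \<in> {0,1}"
  shows "bd P 3 i k z \<noteq> x"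
proof
  assume zx: "bd P 3 i k z = x"
  \<comment> \<open>The precubical identity exhibits the edge of \<open>x\<close> as a face of a
    second square of \<open>z\<close>, which freeness identifies with \<open>x\<close>. Regularity
    then compares the two positions of the edge in \<open>x\<close>.\<close>
  have key: "k = l" if j: "j \<in> {1,2}" and l: "l \<in> {0,1}"
    and fr: "\<And>w i k. w \<in> cells P 2 \<Longrightarrow> i \<in> {1,2} \<Longrightarrow> k \<in> {0,1} \<Longrightarrow> bd P 2 i k w = bd P 2 j l x \<Longrightarrow> w = x" for j l
  proof (cases "j < i")
    case True
    then have eq: "bd P 2 j l x = bd P 2 (i - 1) k (bd P 3 j l z)"
      using bd_bd[OF P z, of j i l k] i j k l zx by auto
    have i': "i - 1 \<in> {1,2}" using True i j by auto
    have "bd P 3 j l z \<in> cells P 2" using bd_in[OF P z, of j l] j l by auto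
    then have "bd P 3 j l z = x" using fr[OF _ i' k] eq by simp
    then show ?thesis
      using eq regular_edges[OF reg j i' l k] by simp
  next
    case False
    then have eq: "bd P 2 j l x = bd P 2 i k (bd P 3 (j + 1) l z)"
      using bd_bd[OF P z, of i "j + 1" k l] i j k l zx by auto
    have i': "i \<in> {1,2}" using False i j by auto
    have "bd P 3 (j + 1) l z \<in> cells P 2" using bd_in[OF P z, of "j + 1" l] j l by auto
    then have "bd P 3 (j + 1) l z = x" using fr[OF _ i' k] eq by simp
    then show ?thesis
      using eq regular_edges[OF reg j i' l k] by simp
  qed
  have "k = 1 - b"
  proof (rule key[OF a b1(1)], rule ccontr)
    fix w i k assume "w \<in> cells P 2" "i \<in> {1,2}" "k \<in> {0,1}" "bd P 2 i k w = bd P 2 a (1 - b) x" "w \<noteq> x"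
    then show False using free'(1) by (simp add: right_def)
  qed
  moreover have "k = b"
  proof (rule key[OF a3(1) b], rule ccontr)
    fix w i k assume "w \<in> cells P 2" "i \<in> {1,2}" "k \<in> {0,1}" "bd P 2 i k w = bd P 2 (3 - a) b x" "w \<noteq> x"
    then show False using free'(2) by (simp add: bottom_def)
  qed
  ultimately show False using b1(2) by simp
qed

section \<open>The precubical subsets \<open>Q\<close> and \<open>R\<close> and their extremal
  vertices\<close>

lemma cells_Q: "cells Q n = (if n = 1 then cells P 1 - {bottom} else if n = 2 then cells P 2 - {x} else cells P n)"
  by (simp add: Q_def)

lemma cells_R: "cells R n = (if n = 0 then cells P 0 - {corner} else if n = 1 then cells P 1 - ({bottom, right} \<union> Y)
    else cells Q n)"
  by (auto simp: R_def cells_Q)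

lemma bd_Q: "bd Q = bd P" and bd_R: "bd R = bd P"
  by (simp_all add: Q_def R_def)

text \<open>\<open>bottom\<close> bounds no square except the removed \<open>x\<close>, and
  \<open>x\<close> bounds no 3-cell.\<close>

lemma Q_subset: "precubical_subset Q P"
  unfolding Q_def
proof (rule precubical_subsetI[OF P])
  fix n i k :: nat and z
  let ?C = "(cells P)(1 := cells P 1 - {bottom}, 2 := cells P 2 - {x})"
  assume *: "0 < n" "i \<in> {1..n}" "k \<in> {0,1}" "z \<in> ?C n"
  then have z: "z \<in> cells P n" by (auto split: if_splits)
  consider "n = 1" | "n = 2" | "n = 3" | "n > 3" using *(1) by linarith
  then show "bd P n i k z \<in> ?C (n - 1)"
  proof cases
    case 2
    then have "i \<in> {1,2}" using *(2) by auto
    then show ?thesis using 2 bd_in[OF P z *(1-3)] free'(2)[of z i k] * by auto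
  next
    case 3
    then show ?thesis using bd_in[OF P z *(1-3)] not_face_of_3_cell[of z i k] * by auto
  qed (use bd_in[OF P z *(1-3)] in auto)
qed auto

text \<open>All edges at the corner are removed together with it, and no square of \<open>Q\<close>
  has \<open>right\<close> or an edge of \<open>Y\<close> as a face.\<close>

lemma R_subset: "precubical_subset R Q"
  unfolding R_def
proof (rule precubical_subsetI)
  show "precubical_set Q" using Q_subset by (simp add: precubical_subset_def)
  fix n i k :: nat and z
  let ?C = "(cells Q)(0 := cells Q 0 - {corner}, 1 := cells Q 1 - ({right} \<union> Y))"
  assume *: "0 < n" "i \<in> {1..n}" "k \<in> {0,1}" "z \<in> ?C n"
  then have z: "z \<in> cells Q n" by (auto split: if_splits)
  have bz: "bd P n i k z \<in> cells Q (n - 1)"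
    using bd_in[OF \<open>precubical_set Q\<close> z *(1-3)] by (simp add: bd_Q)
  consider "n = 1" | "n = 2" | "n \<ge> 3" using *(1) by linarith
  then show "bd Q n i k z \<in> ?C (n - 1)"
  proof cases
    case 1
    then show ?thesis using bz edge_at_corner[of z k] * by (auto simp: cells_Q bd_Q)
  next
    case 2
    then have "i \<in> {1,2}" using *(2) by auto
    then show ?thesis using 2 bz free'(1)[of z i k] Y_free[of z i k] * by (auto simp: cells_Q bd_Q)
  qed (use bz in \<open>auto simp: bd_Q\<close>)
qed auto

text \<open>Both ends of \<open>bottom\<close> are ends of the same kind of a remaining edge: one of
  the edge \<open>s = 0\<close>, the other, the corner, of any edge in \<open>Y\<close>. With
  \<open>Y\<close> empty the corner would become extremal in \<open>Q\<close>.\<close>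

lemma end_vertices_Q:
  assumes "Y \<noteq> {}" "k \<in> {0,1}"
  shows "(\<exists>y\<in>cells Q 1. bd P 1 1 k y = v) \<longleftrightarrow> (\<exists>y\<in>cells P 1. bd P 1 1 k y = v)"
proof
  assume "\<exists>y\<in>cells P 1. bd P 1 1 k y = v"
  then obtain y where y: "y \<in> cells P 1" "bd P 1 1 k y = v" by blast
  show "\<exists>y\<in>cells Q 1. bd P 1 1 k y = v"
  proof (cases "y = bottom")
    case True
    from side_cases[OF assms(2)] show ?thesis
    proof
      assume k: "k = b"
      have "bd P 1 1 b (bd P 2 a b x) = bd P 1 1 b bottom"
        using vertex_swap[of b b] b by (simp add: bottom_def)
      moreover have "bd P 2 a b x \<in> cells Q 1"
        using square_bd[OF a b x] edges_eq_iff(2)[OF a b] by (simp add: cells_Q)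
      ultimately show ?thesis using True y k by auto
    next
      assume "k = 1 - b"
      then show ?thesis using assms(1) True y by (auto simp: Y_iff cells_Q corner_def)
    qed
  qed (use y in \<open>auto simp: cells_Q\<close>)
qed (auto simp: cells_Q)

lemma min_max_vertex_Q:
  assumes "Y \<noteq> {}"
  shows "min_vertex Q v \<longleftrightarrow> min_vertex P v" "max_vertex Q v \<longleftrightarrow> max_vertex P v"
  using end_vertices_Q[OF assms, of 1 v] end_vertices_Q[OF assms, of 0 v]
  by (auto simp: min_vertex_def max_vertex_def bd_Q cells_Q)

lemma extrl_Q: "Y \<noteq> {} \<Longrightarrow> extrl P = extrl Q"
  using min_max_vertex_Q by (simp add: extrl_def Q_def fun_eq_iff)

text \<open>The corner is not extremal in \<open>P\<close>: \<open>right\<close> and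
  \<open>bottom\<close> meet it with opposite ends.\<close>

lemma extrl_in_R:
  assumes "v \<in> cells (extrl P) 0" shows "v \<in> cells R 0"
proof -
  have "\<exists>y\<in>cells P 1. bd P 1 1 k y = corner" if "k \<in> {0,1}" for k
    using side_cases[OF that] corner_eq corner_def right_in bottom_in by auto
  from this[of 0] this[of 1] show ?thesis
    using assms by (auto simp: extrl_def cells_R min_vertex_def max_vertex_def)
qed

lemma extrl_Q_subset_R:
  assumes "Y \<noteq> {}" shows "precubical_subset (extrl Q) R"
proof -
  have "cells (extrl Q) n \<subseteq> cells R n" for n
    using extrl_in_R[unfolded extrl_Q[OF assms]] by (cases n) (auto simp: extrl_def)
  moreover have "precubical_set (extrl Q)"
    by (auto simp: precubical_set_def extrl_def)
  moreover have "bd (extrl Q) = bd R"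
    by (simp add: extrl_def bd_R bd_Q)
  ultimately show ?thesis
    by (simp add: precubical_subset_def)
qed

end

section \<open>The deformation of the square\<close>

text \<open>With \<open>def_t\<close>, the linear homotopy from the identity to the retraction
  sending \<open>(s, t)\<close> to \<open>(0, t + 2s)\<close> if \<open>t + 2s \<le> 1\<close> and
  to \<open>(min s (2s + t - 1), 1)\<close> otherwise. The line \<open>t + 2s = 1\<close> goes to
  \<open>(0, 1)\<close>, the edge \<open>s = 1\<close> to \<open>(1, 1)\<close>. The minimum with
  \<open>s\<close> keeps the edge \<open>t = 1\<close> fixed, where \<open>2s + t - 1\<close> would
  be \<open>2s\<close>.\<close>

definition def_s :: "real \<Rightarrow> real \<Rightarrow> real \<Rightarrow> real" where
  "def_s \<tau> s t = (1 - \<tau>) * s + \<tau> * max 0 (min s (2 * s + t - 1))"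

definition def_t :: "real \<Rightarrow> real \<Rightarrow> real \<Rightarrow> real" where
  "def_t \<tau> s t = (1 - \<tau>) * t + \<tau> * min 1 (t + 2 * s)"

lemma def_s_0 [simp]: "t \<in> {0..1} \<Longrightarrow> def_s \<tau> 0 t = 0"
  and def_t_0 [simp]: "t \<in> {0..1} \<Longrightarrow> def_t \<tau> 0 t = t"
  and def_s_top [simp]: "s \<in> {0..1} \<Longrightarrow> def_s \<tau> s 1 = s"
  and def_t_top [simp]: "s \<in> {0..1} \<Longrightarrow> def_t \<tau> s 1 = 1"
  and def_s_1 [simp]: "t \<in> {0..1} \<Longrightarrow> def_s \<tau> 1 t = 1"
  and def_t_1: "t \<in> {0..1} \<Longrightarrow> def_t \<tau> 1 t = (1 - \<tau>) * t + \<tau>"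
  and def_s_start: "def_s 0 s t = s" and def_t_start: "def_t 0 s t = t"
  by (auto simp: def_s_def def_t_def min_def max_def algebra_simps)

lemma def_end: "s \<in> {0..1} \<Longrightarrow> t \<in> {0..1} \<Longrightarrow> def_s 1 s t = 0 \<or> def_t 1 s t = 1"
  by (auto simp: def_s_def def_t_def min_def max_def)

lemma convex_in: "\<tau> \<in> {0..1} \<Longrightarrow> y \<in> {0..1} \<Longrightarrow> z \<in> {0..1} \<Longrightarrow> (1 - \<tau>) * y + \<tau> * z \<in> {0..1 :: real}"
  using convex_bound_le[of y 1 z "1 - \<tau>" \<tau>] by auto

lemma def_in:
  assumes "\<tau> \<in> {0..1}" "s \<in> {0..1}" "t \<in> {0..1}"
  shows "def_s \<tau> s t \<in> {0..1}" "def_t \<tau> s t \<in> {0..1}"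
  unfolding def_s_def def_t_def using assms by (auto intro!: convex_in[OF assms(1)] simp del: atLeastAtMost_iff) auto

text \<open>Sums, minima and maxima of increasing functions are increasing, and so are their convex
  combinations. This is why every stage preserves d-paths.\<close>

lemma def_mono:
  assumes "\<tau> \<in> {0..1}" "s \<le> s'" "t \<le> t'"
  shows "def_s \<tau> s t \<le> def_s \<tau> s' t'" "def_t \<tau> s t \<le> def_t \<tau> s' t'"
  unfolding def_s_def def_t_def using assms by (auto intro!: add_mono mult_left_mono)

lemma continuous_map_real_compose3:
  assumes "continuous_map Z euclideanreal f" "continuous_map Z euclideanreal g" "continuous_map Z euclideanreal h"
    and "continuous_on UNIV (\<lambda>(r, s, t). F r s t :: real)"
  shows "continuous_map Z euclideanreal (\<lambda>z. F (f z) (g z) (h z))"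
proof -
  have "continuous_map Z (prod_topology euclideanreal (prod_topology euclideanreal euclideanreal)) (\<lambda>z. (f z, g z, h z))"
    using assms(1-3) by (intro continuous_map_pairedI)
  then have 1: "continuous_map Z euclidean (\<lambda>z. (f z, g z, h z))"
    by simp
  have 2: "continuous_map euclidean euclideanreal (\<lambda>(r, s, t). F r s t)"
    using assms(4) by simp
  show ?thesis
    using continuous_map_compose[OF 1 2] by (simp add: o_def)
qed

lemma continuous_on_def_s: "continuous_on UNIV (\<lambda>(\<tau>, s, t). def_s \<tau> s t)"
  and continuous_on_def_t: "continuous_on UNIV (\<lambda>(\<tau>, s, t). def_t \<tau> s t)"
  unfolding def_s_def def_t_def case_prod_beta by (intro continuous_intros)+

lemma stretch_in: "\<tau> \<in> {0..1} \<Longrightarrow> r \<in> {0..1} \<Longrightarrow> (1 + \<tau>) * r \<in> {0..2 :: real}"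
  using mult_mono[of "1 + \<tau>" 2 r 1] by auto

declare One_nat_def [simp del]

section \<open>Coordinates on the square and on its edges\<close>

context collapsible_square
begin

text \<open>The flip \<open>fl\<close> allows one to treat the two values of \<open>b\<close> simultaneously.\<close>

definition fl :: "real \<Rightarrow> real" where "fl r = (if b = 0 then r else 1 - r)"

text \<open>Both coordinates are flipped if \<open>b = 1\<close>, so that \<open>right\<close> is
  \<open>s = 1\<close> and \<open>bottom\<close> is \<open>t = 0\<close> for either value of
  \<open>b\<close>.\<close>

definition sq :: "real \<Rightarrow> real \<Rightarrow> nat \<Rightarrow> real" where
  "sq s t = (\<lambda>j\<in>{1..2}. if j = a then fl s else fl t)"

definition sq_pt :: "real \<Rightarrow> real \<Rightarrow> (nat \<times> 'a \<times> (nat \<Rightarrow> real)) set" where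
  "sq_pt s t = point_class P 2 x (sq s t)"

definition def_sq :: "real \<Rightarrow> real \<Rightarrow> real \<Rightarrow> (nat \<times> 'a \<times> (nat \<Rightarrow> real)) set" where
  "def_sq \<tau> s t = sq_pt (def_s \<tau> s t) (def_t \<tau> s t)"

lemma fl_fl [simp]: "fl (fl r) = r"
  by (simp add: fl_def)

lemma fl_in [simp]: "0 \<le> fl r \<and> fl r \<le> 1 \<longleftrightarrow> 0 \<le> r \<and> r \<le> 1"
  by (auto simp: fl_def)

lemma fl_b [simp]: "fl (real b) = 0" "fl (real (1 - b)) = 1"
  using b by (auto simp: fl_def)

lemma fl_01: "fl 0 = real b" "fl 1 = real (1 - b)"
  using b by (auto simp: fl_def)

lemma continuous_on_fl: "continuous_on S f \<Longrightarrow> continuous_on S (\<lambda>r. fl (f r))"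
  unfolding fl_def by (cases "b = 0") (auto intro: continuous_intros)

lemma continuous_map_fl: "continuous_map Z euclideanreal f \<Longrightarrow> continuous_map Z euclideanreal (\<lambda>r. fl (f r))"
  unfolding fl_def by (cases "b = 0") (auto intro: continuous_intros)

text \<open>If \<open>b = 1\<close>, the flipped parameters are decreasing along a d-path. An
  operation that is increasing in both arguments preserves increasing pairs and decreasing pairs
  alike.\<close>

lemma mono_on_fl:
  assumes "mono_on S (\<lambda>r. fl (f r))" "mono_on S (\<lambda>r. fl (g r))"
    "\<And>u v u' v'. u \<le> u' \<Longrightarrow> v \<le> v' \<Longrightarrow> H u v \<le> H u' v'"
  shows "mono_on S (\<lambda>r. fl (H (f r) (g r)))"
  using assms by (auto simp: mono_on_def fl_def split: if_splits)

lemma sq_in: "s \<in> {0..1} \<Longrightarrow> t \<in> {0..1} \<Longrightarrow> sq s t \<in> Icube 2"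
  unfolding sq_def by (rule Icube_restrictI) auto

lemma sq_a [simp]: "sq s t a = fl s" "sq s t (3 - a) = fl t"
  using a by (auto simp: sq_def)

lemma sq_eq:
  assumes "u \<in> Icube 2" shows "sq (fl (u a)) (fl (u (3 - a))) = u"
proof (rule Icube_eqI[OF sq_in assms])
  fix i :: nat assume "i \<in> {1..2}"
  then have "i \<in> {1,2}" by auto
  then have "i = a \<or> i = 3 - a" by (rule index_cases)
  then show "sq (fl (u a)) (fl (u (3 - a))) i = u i"
    by auto
qed (use Icube_le[OF assms, of a] Icube_le[OF assms, of "3 - a"] a in auto)

lemma face_map_sq:
  assumes "v \<in> {0..1}" "k \<in> {0,1}"
  shows "face_map 1 a k (edge_pt v) = sq (fl (real k)) (fl v)"
    and "face_map 1 (3 - a) k (edge_pt v) = sq (fl v) (fl (real k))"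
proof -
  have e: "edge_pt v \<in> Icube 1" by (rule edge_pt_in[OF assms(1)])
  have e2: "face_map 1 i k (edge_pt v) \<in> Icube 2" if "i \<in> {1,2}" for i
    using face_map_in[OF e, of i k] assms(2) that by (auto simp: numeral_2_eq_2 One_nat_def)
  have ap: "face_map 1 i k (edge_pt v) j = (if j < i then edge_pt v j else if j = i then real k else edge_pt v (j - 1))"
    if "j \<in> {1,2}" for i j
    using face_map_apply[OF e, of j i k] that by (auto simp: numeral_2_eq_2 One_nat_def)
  have "face_map 1 a k (edge_pt v) a = real k" "face_map 1 a k (edge_pt v) (3 - a) = v"
    using a by (auto simp: ap)
  then show "face_map 1 a k (edge_pt v) = sq (fl (real k)) (fl v)"
    using sq_eq[OF e2[OF a]] by simp
  have "face_map 1 (3 - a) k (edge_pt v) a = v" "face_map 1 (3 - a) k (edge_pt v) (3 - a) = real k"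
    using a by (auto simp: ap)
  then show "face_map 1 (3 - a) k (edge_pt v) = sq (fl v) (fl (real k))"
    using sq_eq[OF e2[OF a3(1)]] by simp
qed

lemma edge_class:
  assumes "v \<in> {0..1}" "k \<in> {0,1}"
  shows "point_class P 1 (bd P 2 a k x) (edge_pt v) = sq_pt (fl (real k)) (fl v)"
    and "point_class P 1 (bd P 2 (3 - a) k x) (edge_pt v) = sq_pt (fl v) (fl (real k))"
proof -
  have "point_class P 1 (bd P 2 i k x) (edge_pt v) = point_class P 2 x (face_map 1 i k (edge_pt v))"
    if "i \<in> {1,2}" for i
    using point_class_face[of x P 1 i k "edge_pt v"] x that assms edge_pt_in[OF assms(1)]
    by (auto simp: numeral_2_eq_2 One_nat_def)
  from this[OF a] this[OF a3(1)]
  show "point_class P 1 (bd P 2 a k x) (edge_pt v) = sq_pt (fl (real k)) (fl v)"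
    "point_class P 1 (bd P 2 (3 - a) k x) (edge_pt v) = sq_pt (fl v) (fl (real k))"
    unfolding face_map_sq[OF assms] sq_pt_def .
qed

lemma right_class: "v \<in> {0..1} \<Longrightarrow> point_class P 1 right (edge_pt v) = sq_pt 1 (fl v)"
  and bottom_class: "v \<in> {0..1} \<Longrightarrow> point_class P 1 bottom (edge_pt v) = sq_pt (fl v) 0"
  using edge_class(1)[of v "1 - b"] edge_class(2)[of v b] b1(1) b fl_b
  unfolding right_def bottom_def by metis+

lemma vertex_class:
  "y \<in> cells P 1 \<Longrightarrow> k \<in> {0,1} \<Longrightarrow> point_class P 0 (bd P 1 1 k y) pt0 = point_class P 1 y (edge_pt (real k))"
  using point_class_face[of y P 0 1 k pt0] unfolding face_map_0_edge by (simp add: One_nat_def)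

lemma corner_class: "point_class P 0 corner pt0 = sq_pt 1 0"
  using vertex_class[OF right_in b] right_class[of "real b"] b corner_eq by auto

text \<open>Paths along an edge in \<open>Y\<close> and \<open>right\<close> are parametrized by \<open>[0, 2]\<close>, with the corner at 1.\<close>

definition tail :: "'a \<Rightarrow> real \<Rightarrow> (nat \<times> 'a \<times> (nat \<Rightarrow> real)) set" where
  "tail y w = (if w \<le> 1 then point_class P 1 y (edge_pt (fl w)) else sq_pt 1 (w - 1))"

text \<open>On \<open>bottom\<close>, \<open>right\<close> and \<open>corner\<close> this is the
  formula for the square restricted to its boundary. An edge in \<open>Y\<close> is stretched by
  \<open>1 + \<tau>\<close>, so that its end follows the corner to \<open>(1, \<tau>)\<close>. Every
  test includes the degree because cells of different degrees may be equal as elements of the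
  type.\<close>

definition deform :: "real \<Rightarrow> nat \<Rightarrow> 'a \<Rightarrow> (nat \<Rightarrow> real) \<Rightarrow> (nat \<times> 'a \<times> (nat \<Rightarrow> real)) set" where
  "deform \<tau> n z u =
    (if n = 2 \<and> z = x then def_sq \<tau> (fl (u a)) (fl (u (3 - a)))
     else if n = 1 \<and> z = bottom then def_sq \<tau> (fl (u 1)) 0
     else if n = 1 \<and> z = right then def_sq \<tau> 1 (fl (u 1))
     else if n = 0 \<and> z = corner then def_sq \<tau> 1 0
     else if n = 1 \<and> z \<in> Y then tail z ((1 + \<tau>) * fl (u 1))
     else point_class P n z u)"

lemma deform_x: "deform \<tau> 2 x u = def_sq \<tau> (fl (u a)) (fl (u (3 - a)))"
  and deform_bottom: "deform \<tau> 1 bottom u = def_sq \<tau> (fl (u 1)) 0"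
  and deform_right: "deform \<tau> 1 right u = def_sq \<tau> 1 (fl (u 1))"
  and deform_corner: "deform \<tau> 0 corner u = def_sq \<tau> 1 0"
  and deform_Y: "y \<in> Y \<Longrightarrow> deform \<tau> 1 y u = tail y ((1 + \<tau>) * fl (u 1))"
  and deform_other: "(n = 2 \<Longrightarrow> z \<noteq> x) \<Longrightarrow> (n = 1 \<Longrightarrow> z \<noteq> bottom \<and> z \<noteq> right \<and> z \<notin> Y) \<Longrightarrow>
    (n = 0 \<Longrightarrow> z \<noteq> corner) \<Longrightarrow> deform \<tau> n z u = point_class P n z u"
  using right_neq_bottom right_notin_Y bottom_notin_Y by (auto simp: deform_def)

lemma tail_corner: "y \<in> Y \<Longrightarrow> point_class P 1 y (edge_pt (fl 1)) = sq_pt 1 0"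
  using vertex_class[OF _ b1(1), of y] corner_class by (auto simp: Y_iff fl_01)

section \<open>Compatibility of the deformation with the gluing\<close>

lemma deform_cases:
  assumes "n = 2 \<Longrightarrow> z = x \<Longrightarrow> T" "n = 1 \<Longrightarrow> z = bottom \<Longrightarrow> T" "n = 1 \<Longrightarrow> z = right \<Longrightarrow> T"
    "n = 0 \<Longrightarrow> z = corner \<Longrightarrow> T" "n = 1 \<Longrightarrow> z \<in> Y \<Longrightarrow> T"
    "(n = 2 \<Longrightarrow> z \<noteq> x) \<Longrightarrow> (n = 1 \<Longrightarrow> z \<noteq> bottom) \<Longrightarrow>
      (\<And>\<tau> u. deform \<tau> n z u = point_class P n z u) \<Longrightarrow> T"
  shows T
  using assms deform_other[of n z] by blast

text \<open>For \<open>right\<close> and \<open>bottom\<close> the formulas agree by construction.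
  The other two edges are not moved, by regularity and hypothesis (iii), and the formula for the
  square is the identity on \<open>s = 0\<close> and \<open>t = 1\<close>.\<close>

lemma deform_square_face:
  assumes \<tau>: "\<tau> \<in> {0..1}" and i: "i \<in> {1,2}" and k: "k \<in> {0,1}" and v: "v \<in> {0..1}"
  shows "deform \<tau> 1 (bd P 2 i k x) (edge_pt v) = deform \<tau> 2 x (face_map 1 i k (edge_pt v))"
proof -
  have notY: "bd P 2 i k x \<notin> Y" using Y_free[OF x i k] .
  have v': "fl v \<in> {0..1}" using v by simp
  from index_cases[OF i] show ?thesis
  proof
    assume ia: "i = a"
    have R: "deform \<tau> 2 x (face_map 1 i k (edge_pt v)) = def_sq \<tau> (fl (real k)) (fl v)"
      unfolding ia face_map_sq[OF v k] deform_x by simp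
    from side_cases[OF k] show ?thesis
    proof
      assume kb: "k = b"
      have "deform \<tau> 1 (bd P 2 i k x) (edge_pt v) = point_class P 1 (bd P 2 i k x) (edge_pt v)"
        using notY edges_eq_iff[OF i k] ia kb by (intro deform_other) auto
      then show ?thesis
        unfolding R using v' edge_class(1)[OF v k] by (simp add: ia kb def_sq_def)
    next
      assume kb: "k = 1 - b"
      then have "bd P 2 i k x = right" by (simp add: ia right_def)
      then show ?thesis
        unfolding R by (simp add: deform_right kb)
    qed
  next
    assume ia: "i = 3 - a"
    have R: "deform \<tau> 2 x (face_map 1 i k (edge_pt v)) = def_sq \<tau> (fl v) (fl (real k))"
      unfolding ia face_map_sq[OF v k] deform_x by simp
    from side_cases[OF k] show ?thesis
    proof
      assume kb: "k = 1 - b"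
      have "deform \<tau> 1 (bd P 2 i k x) (edge_pt v) = point_class P 1 (bd P 2 i k x) (edge_pt v)"
        using notY edges_eq_iff[OF i k] ia kb by (intro deform_other) auto
      then show ?thesis
        unfolding R using v' edge_class(2)[OF v k] by (simp add: ia kb def_sq_def)
    next
      assume kb: "k = b"
      then have "bd P 2 i k x = bottom" by (simp add: ia bottom_def)
      then show ?thesis
        unfolding R by (simp add: deform_bottom kb)
    qed
  qed
qed

lemma def_sq_corner: "\<tau> \<in> {0..1} \<Longrightarrow> def_sq \<tau> 1 0 = sq_pt 1 \<tau>"
  by (simp add: def_sq_def def_t_1)

text \<open>At the corner the formulas for all three kinds of adjacent edges give
  \<open>(1, \<tau>)\<close>. At any other vertex a moved edge has its fixed end:
  \<open>t = 1\<close> on \<open>right\<close>, \<open>s = 0\<close> on \<open>bottom\<close>,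
  parameter 0 on an edge in \<open>Y\<close>.\<close>

lemma deform_vertex:
  assumes \<tau>: "\<tau> \<in> {0..1}" and y: "y \<in> cells P 1" and k: "k \<in> {0,1}"
  shows "deform \<tau> 0 (bd P 1 1 k y) pt0 = deform \<tau> 1 y (edge_pt (real k))"
proof -
  have e: "edge_pt (real k) 1 = real k" by simp
  have cl: "point_class P 0 (bd P 1 1 k y) pt0 = point_class P 1 y (edge_pt (real k))"
    by (rule vertex_class[OF y k])
  have k01: "real k \<in> {0..1}" using k by auto
  consider "bd P 1 1 k y = corner" | "bd P 1 1 k y \<noteq> corner" by blast
  then show ?thesis
  proof cases
    case 1
    have L: "deform \<tau> 0 (bd P 1 1 k y) pt0 = def_sq \<tau> 1 0"
      unfolding 1 by (rule deform_corner)
    from edge_at_corner[OF y k 1] consider "k = b" "y = right" | "k = 1 - b" "y = bottom" | "k = 1 - b" "y \<in> Y"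
      by blast
    then show ?thesis
    proof cases
      case 1
      show ?thesis unfolding L unfolding 1 deform_right by simp
    next
      case 2
      show ?thesis unfolding L unfolding 2 deform_bottom by simp
    next
      case 3
      have "deform \<tau> 1 y (edge_pt (real k)) = tail y (1 + \<tau>)"
        unfolding deform_Y[OF 3(2)] by (simp add: 3(1))
      \<comment> \<open>For \<open>\<tau> = 0\<close> the parameter is exactly 1 and
        \<open>tail\<close> still uses the edge in \<open>Y\<close>; the two descriptions of the
        corner agree.\<close>
      also have "\<dots> = sq_pt 1 \<tau>"
        using \<tau> tail_corner[OF 3(2)] by (cases "\<tau> = 0") (auto simp: tail_def)
      finally show ?thesis
        unfolding L using def_sq_corner[OF \<tau>] by simp
    qed
  next
    case 2
    have L: "deform \<tau> 0 (bd P 1 1 k y) pt0 = point_class P 1 y (edge_pt (real k))"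
      using 2 cl by (subst deform_other) auto
    \<comment> \<open>Each special edge has the corner as one end, so the end at hand is the
      opposite one.\<close>
    have kk: "y \<noteq> right \<and> y \<noteq> bottom \<and> y \<notin> Y \<or> y = right \<and> k = 1 - b \<or> y = bottom \<and> k = b \<or> y \<in> Y \<and> k = b"
      using side_cases[OF k] 2 corner_eq corner_def Y_iff by auto
    then show ?thesis
    proof (elim disjE conjE)
      assume "y = right" "k = 1 - b"
      then show ?thesis
        unfolding L using right_class[OF k01] deform_right[of \<tau> "edge_pt (real k)"] by (simp add: def_sq_def)
    next
      assume "y = bottom" "k = b"
      then show ?thesis
        unfolding L using bottom_class[OF k01] deform_bottom[of \<tau> "edge_pt (real k)"] by (simp add: def_sq_def)
    next
      assume "y \<in> Y" "k = b"
      then show ?thesis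
        unfolding L using deform_Y[of y \<tau> "edge_pt (real k)"] by (simp add: tail_def fl_01)
    next
      assume "y \<noteq> right" "y \<noteq> bottom" "y \<notin> Y"
      then show ?thesis
        unfolding L by (subst deform_other) auto
    qed
  qed
qed

text \<open>Squares other than \<open>x\<close> have no moved edge by hypotheses (i) and (iii). From
  degree 2 on, the only moved cell is \<open>x\<close>, which is no face of a 3-cell.\<close>

lemma deform_glue:
  assumes \<tau>: "\<tau> \<in> {0..1}" and "glue P p q"
  shows "(\<lambda>(n, z, u). deform \<tau> n z u) p = (\<lambda>(n, z, u). deform \<tau> n z u) q"
  using assms(2)
proof cases
  case (1 z n i k u)
  have cl: "point_class P n (bd P (Suc n) i k z) u = point_class P (Suc n) z (face_map n i k u)"
    using 1 by (intro point_class_face)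
  consider "n = 0" | "n = 1" "z = x" | "n = 1" "z \<noteq> x" | "n \<ge> 2" by linarith
  then show ?thesis
  proof cases
    case a: 1
    then have "u = pt0" "i = 1" using 1 by (auto simp: Icube_0)
    then show ?thesis
      using deform_vertex[OF \<tau>, of z k, folded face_map_0_edge] 1 a by (simp add: One_nat_def)
  next
    case a: 2
    have u: "u = edge_pt (u 1)" using Icube_1_eq[of u] 1 a by simp
    have u1: "u 1 \<in> {0..1}" using Icube_le[of u 1 1] 1 a by auto
    then show ?thesis
      using deform_square_face[OF \<tau> _ _ u1, of i k, folded u] 1 a
      by (fastforce simp: numeral_2_eq_2 One_nat_def)
  next
    case a: 3
    have i: "i \<in> {1,2}" and z: "z \<in> cells P 2" using 1 a by (auto simp: numeral_2_eq_2 One_nat_def)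
    have "deform \<tau> n (bd P (Suc n) i k z) u = point_class P n (bd P (Suc n) i k z) u"
      using free'[OF z a(2) i, of k] Y_free[OF z i, of k] 1 a by (intro deform_other) (auto simp: numeral_2_eq_2)
    moreover have "deform \<tau> (Suc n) z (face_map n i k u) = point_class P (Suc n) z (face_map n i k u)"
      using a by (intro deform_other) auto
    ultimately show ?thesis using 1 cl by simp
  next
    case a: 4
    have "bd P (Suc n) i k z \<noteq> x" if "n = 2"
      using not_face_of_3_cell[of z i k] 1 that by (simp add: numeral_3_eq_3 numeral_2_eq_2 One_nat_def)
    then have "deform \<tau> n (bd P (Suc n) i k z) u = point_class P n (bd P (Suc n) i k z) u"
      using a by (intro deform_other) auto
    moreover have "deform \<tau> (Suc n) z (face_map n i k u) = point_class P (Suc n) z (face_map n i k u)"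
      using a by (intro deform_other) auto
    ultimately show ?thesis using 1 cl by simp
  qed
qed

text \<open>The choice of a representative is harmless by \<open>deform_glue\<close>.\<close>

definition deformation :: "(nat \<times> 'a \<times> (nat \<Rightarrow> real)) set \<times> real \<Rightarrow> (nat \<times> 'a \<times> (nat \<Rightarrow> real)) set" where
  "deformation = (\<lambda>(p, \<tau>). case SOME r. r \<in> p of (n, z, u) \<Rightarrow> deform \<tau> n z u)"

lemma deformation_point_class:
  assumes "\<tau> \<in> {0..1}"
  shows "deformation (point_class P n z u, \<tau>) = deform \<tau> n z u"
proof -
  have inv: "(\<lambda>(n, z, u). deform \<tau> n z u) p = (\<lambda>(n, z, u). deform \<tau> n z u) q" if "equivclp (glue P) p q" for p q
    using that by (induction rule: equivclp_induct) (use deform_glue[OF assms] in metis)+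
  have "(n, z, u) \<in> point_class P n z u"
    by (simp add: point_class_def)
  then have "(SOME r. r \<in> point_class P n z u) \<in> point_class P n z u"
    by (rule someI)
  then have "equivclp (glue P) (n, z, u) (SOME r. r \<in> point_class P n z u)"
    by (simp add: point_class_def)
  from inv[OF this] show ?thesis
    by (simp add: deformation_def)
qed

section \<open>Continuity of the deformation\<close>

lemma continuous_map_sq_pt:
  assumes "continuous_map Z euclideanreal f" "continuous_map Z euclideanreal g"
    and "\<And>z. z \<in> topspace Z \<Longrightarrow> f z \<in> {0..1}" "\<And>z. z \<in> topspace Z \<Longrightarrow> g z \<in> {0..1}"
  shows "continuous_map Z (realization_top P) (\<lambda>z. sq_pt (f z) (g z))"
proof -
  have "continuous_map Z (cube_topology 2) (\<lambda>z. sq (f z) (g z))"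
  proof (rule continuous_map_into_cube)
    show "continuous_map Z euclideanreal (\<lambda>z. sq (f z) (g z) i)" if "i \<in> {1..2}" for i
      using that assms(1,2) by (cases "i = a") (auto simp: sq_def intro: continuous_map_fl)
  qed (use assms(3,4) sq_in in blast)
  from continuous_map_compose[OF this continuous_map_point_class[OF x]] show ?thesis
    by (simp add: o_def sq_pt_def)
qed

lemma continuous_map_def_sq:
  assumes "continuous_map Z euclideanreal f" "continuous_map Z euclideanreal g" "continuous_map Z euclideanreal \<sigma>"
    and "\<And>z. z \<in> topspace Z \<Longrightarrow> f z \<in> {0..1}" "\<And>z. z \<in> topspace Z \<Longrightarrow> g z \<in> {0..1}"
      "\<And>z. z \<in> topspace Z \<Longrightarrow> \<sigma> z \<in> {0..1}"
  shows "continuous_map Z (realization_top P) (\<lambda>z. def_sq (\<sigma> z) (f z) (g z))"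
  unfolding def_sq_def
  using continuous_map_real_compose3[OF assms(3,1,2) continuous_on_def_s]
    continuous_map_real_compose3[OF assms(3,1,2) continuous_on_def_t] def_in[OF assms(6,4,5)]
  by (intro continuous_map_sq_pt) blast+

lemma continuous_map_edge_class:
  assumes y: "y \<in> cells P 1" and f: "continuous_map Z euclideanreal f" "\<And>z. z \<in> topspace Z \<Longrightarrow> f z \<in> {0..1}"
  shows "continuous_map Z (realization_top P) (\<lambda>z. point_class P 1 y (edge_pt (f z)))"
proof -
  have "continuous_map Z (cube_topology 1) (\<lambda>z. edge_pt (f z))"
    using f by (intro continuous_map_into_cube edge_pt_in) (auto simp: edge_pt_def)
  from continuous_map_compose[OF this continuous_map_point_class[OF y]] show ?thesis
    by (simp add: o_def)
qed

lemma continuous_map_tail: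
  assumes y: "y \<in> Y" and w: "continuous_map Z euclideanreal w" "\<And>z. z \<in> topspace Z \<Longrightarrow> w z \<in> {0..2}"
  shows "continuous_map Z (realization_top P) (\<lambda>z. tail y (w z))"
proof -
  \<comment> \<open>Truncation at the corner makes both branches continuous on all of
    \<open>Z\<close>, and not merely where they are used.\<close>
  let ?f = "\<lambda>z. point_class P 1 y (edge_pt (fl (min (w z) 1)))" and ?g = "\<lambda>z. sq_pt 1 (max (w z - 1) 0)"
  have yP: "y \<in> cells P 1" using y by (simp add: Y_iff)
  have f: "continuous_map Z (realization_top P) ?f"
    using w by (intro continuous_map_edge_class[OF yP] continuous_map_fl continuous_map_real_min) auto
  have g: "continuous_map Z (realization_top P) ?g"
    using w by (intro continuous_map_sq_pt continuous_map_real_max continuous_map_diff) auto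
  have "continuous_map Z (realization_top P) (\<lambda>z. if w z \<le> 1 then ?f z else ?g z)"
    by (rule continuous_map_cases_le) (use w(1) f g tail_corner[OF y] in \<open>auto intro: continuous_map_from_subtopology\<close>)
  moreover have "(if w z \<le> 1 then ?f z else ?g z) = tail y (w z)" for z
    by (simp add: tail_def)
  ultimately show ?thesis by simp
qed

lemma continuous_map_deformation:
  "continuous_map (prod_topology (realization_top P) unit_top) (realization_top P) deformation"
proof (rule continuous_map_realization_prod)
  fix n z assume z: "z \<in> cells P n"
  let ?Z = "prod_topology (cube_topology n) unit_top"
  have top: "fst w \<in> Icube n" "snd w \<in> {0..1}" if "w \<in> topspace ?Z" for w
    using that by (auto simp: topspace_cube_topology)
  have co: "continuous_map ?Z euclideanreal (\<lambda>w. fst w i)" if "i \<in> {1..n}" for i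
    using continuous_map_compose[OF continuous_map_fst continuous_map_cube_coordinate[OF that]] by (simp add: o_def)
  have sn: "continuous_map ?Z euclideanreal snd"
    by (rule continuous_map_into_fulltopology[OF continuous_map_snd])
  have in01: "fl (fst w i) \<in> {0..1}" if "w \<in> topspace ?Z" "i \<in> {1..n}" for w i
    using Icube_le[OF top(1)[OF that(1)] that(2)] by simp
  have "continuous_map ?Z (realization_top P) (\<lambda>w. deform (snd w) n z (fst w))"
  proof (rule deform_cases[of n z])
    assume n: "n = 2" and "z = x"
    have "a \<in> {1..2}" "3 - a \<in> {1..2}" using a by auto
    then show ?thesis
      unfolding \<open>n = 2\<close> \<open>z = x\<close> deform_x using co sn in01 top(2)
      by (intro continuous_map_def_sq continuous_map_fl) (simp_all add: n)
  next
    assume n: "n = 1" and "z = bottom"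
    then show ?thesis
      unfolding \<open>n = 1\<close> \<open>z = bottom\<close> deform_bottom using co sn in01 top(2)
      by (intro continuous_map_def_sq continuous_map_fl) (simp_all add: n)
  next
    assume n: "n = 1" and "z = right"
    then show ?thesis
      unfolding \<open>n = 1\<close> \<open>z = right\<close> deform_right using co sn in01 top(2)
      by (intro continuous_map_def_sq continuous_map_fl) (simp_all add: n)
  next
    assume n: "n = 0" and "z = corner"
    then show ?thesis
      unfolding \<open>n = 0\<close> \<open>z = corner\<close> deform_corner using sn top(2)
      by (intro continuous_map_def_sq) (simp_all add: n)
  next
    assume n: "n = 1" and y: "z \<in> Y"
    have "(1 + snd w) * fl (fst w 1) \<in> {0..2}" if "w \<in> topspace ?Z" for w
      using stretch_in[OF top(2)[OF that] in01[OF that, of 1]] n by simp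
    then show ?thesis
      unfolding \<open>n = 1\<close> deform_Y[OF y] using co[of 1] sn
      by (intro continuous_map_tail[OF y] continuous_map_real_mult continuous_map_add continuous_map_fl) (simp_all add: n)
  next
    assume d: "\<And>\<tau> u. deform \<tau> n z u = point_class P n z u"
    show ?thesis
      unfolding d using continuous_map_compose[OF continuous_map_fst continuous_map_point_class[OF z]]
      by (simp add: o_def)
  qed
  then show "continuous_map ?Z (realization_top P) (\<lambda>w. deformation (point_class P n z (fst w), snd w))"
    by (rule continuous_map_eq) (use top(2) deformation_point_class in auto)
qed

section \<open>Preservation of d-paths\<close>

lemma piecewise_dpath_sq_pt:
  assumes "p \<le> q" "continuous_on {p..q} f" "continuous_on {p..q} g"
    "\<And>r. r \<in> {p..q} \<Longrightarrow> f r \<in> {0..1}" "\<And>r. r \<in> {p..q} \<Longrightarrow> g r \<in> {0..1}"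
    "mono_on {p..q} (\<lambda>r. fl (f r))" "mono_on {p..q} (\<lambda>r. fl (g r))"
  shows "piecewise_dpath P p q (\<lambda>r. sq_pt (f r) (g r))"
proof (rule piecewise_dpath.piece[of p q x P 2 "\<lambda>r. sq (f r) (g r)"])
  fix i :: nat assume "i \<in> {1..2}"
  then show "continuous_on {p..q} (\<lambda>r. sq (f r) (g r) i)" "mono_on {p..q} (\<lambda>r. sq (f r) (g r) i)"
    using assms by (cases "i = a"; auto simp: sq_def intro: continuous_on_fl)+
qed (use assms x sq_in in \<open>auto simp: sq_pt_def\<close>)

lemma piecewise_dpath_def_sq:
  assumes "\<tau> \<in> {0..1}" "p \<le> q" "continuous_on {p..q} f" "continuous_on {p..q} g"
    "\<And>r. r \<in> {p..q} \<Longrightarrow> f r \<in> {0..1}" "\<And>r. r \<in> {p..q} \<Longrightarrow> g r \<in> {0..1}"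
    "mono_on {p..q} (\<lambda>r. fl (f r))" "mono_on {p..q} (\<lambda>r. fl (g r))"
  shows "piecewise_dpath P p q (\<lambda>r. def_sq \<tau> (f r) (g r))"
  unfolding def_sq_def
proof (rule piecewise_dpath_sq_pt)
  show "continuous_on {p..q} (\<lambda>r. def_s \<tau> (f r) (g r))" "continuous_on {p..q} (\<lambda>r. def_t \<tau> (f r) (g r))"
    unfolding def_s_def def_t_def using assms(3,4) by (auto intro!: continuous_intros)
  show "mono_on {p..q} (\<lambda>r. fl (def_s \<tau> (f r) (g r)))" "mono_on {p..q} (\<lambda>r. fl (def_t \<tau> (f r) (g r)))"
    by (rule mono_on_fl[OF assms(7,8)], rule def_mono[OF assms(1)], assumption+)+
qed (use assms(2) def_in[OF assms(1,5,6)] in blast)+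

text \<open>On one side of the corner the path stays in a single cube: the edge \<open>y\<close>, or
  the edge \<open>s = 1\<close> seen in the square \<open>x\<close>.\<close>

lemma piecewise_dpath_tail_one_side:
  assumes y: "y \<in> Y" and pq: "p \<le> q" and w: "continuous_on {p..q} w" "mono_on {p..q} (\<lambda>r. fl (w r))"
    "\<And>r. r \<in> {p..q} \<Longrightarrow> w r \<in> {0..2}"
    and side: "(\<forall>r\<in>{p..q}. w r \<le> 1) \<or> (\<forall>r\<in>{p..q}. 1 \<le> w r)"
  shows "piecewise_dpath P p q (\<lambda>r. tail y (w r))"
  using side
proof
  assume le: "\<forall>r\<in>{p..q}. w r \<le> 1"
  show ?thesis
  proof (rule piecewise_dpath.piece[of p q y P 1 "\<lambda>r. edge_pt (fl (w r))"])
    show "edge_pt (fl (w r)) \<in> Icube 1" if "r \<in> {p..q}" for r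
      using le w(3) that by (intro edge_pt_in) auto
  qed (use w pq y le in \<open>auto simp: edge_pt_def tail_def Y_iff intro: continuous_on_fl\<close>)
next
  assume ge: "\<forall>r\<in>{p..q}. 1 \<le> w r"
  have "piecewise_dpath P p q (\<lambda>r. sq_pt 1 (w r - 1))"
  proof (rule piecewise_dpath_sq_pt[OF pq])
    show "mono_on {p..q} (\<lambda>r. fl (w r - 1))"
      using w(2) by (auto simp: mono_on_def fl_def split: if_splits)
    show "w r - 1 \<in> {0..1}" if "r \<in> {p..q}" for r
      using ge w(3)[OF that] that by auto
  qed (use w(1) in \<open>auto intro!: continuous_intros mono_onI\<close>)
  then show ?thesis
  proof (rule piecewise_dpath_cong)
    fix r assume "r \<in> {p..q}"
    then have "1 \<le> w r" using ge by blast
    then show "sq_pt 1 (w r - 1) = tail y (w r)"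
      using tail_corner[OF y] by (cases "w r = 1") (auto simp: tail_def)
  qed
qed

text \<open>\<open>w\<close> is increasing or decreasing according to \<open>b\<close>, so it
  changes sides at 1 at most once, and one cut at a time with value 1 is enough.\<close>

lemma piecewise_dpath_tail:
  assumes y: "y \<in> Y" and pq: "p \<le> q" and w: "continuous_on {p..q} w" "mono_on {p..q} (\<lambda>r. fl (w r))"
    "\<And>r. r \<in> {p..q} \<Longrightarrow> w r \<in> {0..2}"
  shows "piecewise_dpath P p q (\<lambda>r. tail y (w r))"
proof (cases "(\<forall>r\<in>{p..q}. w r \<le> 1) \<or> (\<forall>r\<in>{p..q}. 1 \<le> w r)")
  case True
  then show ?thesis using piecewise_dpath_tail_one_side[OF y pq w] by blast
next
  case False
  \<comment> \<open>There are values on both sides of 1, and the image of an interval is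
    connected.\<close>
  then have "1 \<in> w ` {p..q}"
    using connectedD_interval[OF connected_continuous_image[OF w(1) connected_Icc], of _ _ 1] by force
  then obtain m where m: "m \<in> {p..q}" "w m = 1" by force
  have sub: "{p..m} \<subseteq> {p..q}" "{m..q} \<subseteq> {p..q}" using m by auto
  have "fl (w r) \<le> fl 1" if "r \<in> {p..m}" for r
    using mono_onD[OF w(2), of r m] m that by auto
  then have "(\<forall>r\<in>{p..m}. w r \<le> 1) \<or> (\<forall>r\<in>{p..m}. 1 \<le> w r)"
    unfolding fl_def by (cases "b = 0") simp_all
  then have 1: "piecewise_dpath P p m (\<lambda>r. tail y (w r))"
    using m w(3) by (intro piecewise_dpath_tail_one_side[OF y _ continuous_on_subset[OF w(1) sub(1)]
          mono_on_subset[OF w(2) sub(1)]]) auto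
  have "fl 1 \<le> fl (w r)" if "r \<in> {m..q}" for r
    using mono_onD[OF w(2), of m r] m that by auto
  then have "(\<forall>r\<in>{m..q}. w r \<le> 1) \<or> (\<forall>r\<in>{m..q}. 1 \<le> w r)"
    unfolding fl_def by (cases "b = 0") simp_all
  then have 2: "piecewise_dpath P m q (\<lambda>r. tail y (w r))"
    using m w(3) by (intro piecewise_dpath_tail_one_side[OF y _ continuous_on_subset[OF w(1) sub(2)]
          mono_on_subset[OF w(2) sub(2)]]) auto
  show ?thesis using 1 2 by (rule piecewise_dpath.join)
qed

text \<open>Every moved cell is either inside the square, where monotonicity of the formula
  suffices, or an edge of \<open>Y\<close>, the only case in which a cube path may have to be
  cut.\<close>

lemma dmap_deformation:
  assumes \<tau>: "\<tau> \<in> {0..1}"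
  shows "dmap (realization P) (realization P) (\<lambda>p. deformation (p, \<tau>))"
proof (rule dmap_realizationI)
  show "continuous_map (realization_top P) (realization_top P) (\<lambda>p. deformation (p, \<tau>))"
    using continuous_map_slice[OF continuous_map_deformation \<tau>] .
  fix p q :: real and z n \<alpha>
  assume pq: "p \<le> q" and z: "z \<in> cells P n" and \<alpha>: "\<And>r. r \<in> {p..q} \<Longrightarrow> \<alpha> r \<in> Icube n"
    and cont: "\<And>i. i \<in> {1..n} \<Longrightarrow> continuous_on {p..q} (\<lambda>r. \<alpha> r i)"
    and mono: "\<And>i. i \<in> {1..n} \<Longrightarrow> mono_on {p..q} (\<lambda>r. \<alpha> r i)"
  have in01: "fl (\<alpha> r i) \<in> {0..1}" if "r \<in> {p..q}" "i \<in> {1..n}" for r i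
    using Icube_le[OF \<alpha>[OF that(1)] that(2)] by simp
  have const: "mono_on {p..q} (\<lambda>r. fl c)" for c by (rule mono_onI) simp
  have "piecewise_dpath P p q (\<lambda>r. deform \<tau> n z (\<alpha> r))"
  proof (rule deform_cases[of n z])
    assume n: "n = 2" and "z = x"
    have "a \<in> {1..2}" "3 - a \<in> {1..2}" using a by auto
    then show ?thesis
      unfolding \<open>n = 2\<close> \<open>z = x\<close> deform_x using cont mono in01
      by (intro piecewise_dpath_def_sq[OF \<tau> pq] continuous_on_fl) (simp_all add: n)
  next
    assume n: "n = 1" and "z = bottom"
    then show ?thesis
      unfolding \<open>n = 1\<close> \<open>z = bottom\<close> deform_bottom using cont mono in01 const
      by (intro piecewise_dpath_def_sq[OF \<tau> pq] continuous_on_fl) (simp_all add: n)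
  next
    assume n: "n = 1" and "z = right"
    then show ?thesis
      unfolding \<open>n = 1\<close> \<open>z = right\<close> deform_right using cont mono in01 const
      by (intro piecewise_dpath_def_sq[OF \<tau> pq] continuous_on_fl) (simp_all add: n)
  next
    assume n: "n = 0" and "z = corner"
    then show ?thesis
      unfolding \<open>n = 0\<close> \<open>z = corner\<close> deform_corner using const
      by (intro piecewise_dpath_def_sq[OF \<tau> pq]) simp_all
  next
    assume n: "n = 1" and y: "z \<in> Y"
    have "(1 + \<tau>) * fl (\<alpha> r 1) \<in> {0..2}" if "r \<in> {p..q}" for r
      using stretch_in[OF \<tau> in01[OF that, of 1]] n by simp
    moreover have "mono_on {p..q} (\<lambda>r. fl ((1 + \<tau>) * fl (\<alpha> r 1)))"
      using mono[of 1] \<tau> n by (intro mono_on_fl[where H = "\<lambda>u v. (1 + \<tau>) * u" and g = "\<lambda>_. 0"] const)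
        (auto intro: mult_left_mono)
    ultimately show ?thesis
      unfolding \<open>n = 1\<close> deform_Y[OF y] using cont[of 1] n
      by (intro piecewise_dpath_tail[OF y pq]) (auto intro!: continuous_intros continuous_on_fl)
  next
    assume d: "\<And>\<tau> u. deform \<tau> n z u = point_class P n z u"
    show ?thesis
      unfolding d by (rule piecewise_dpath.piece[of p q z P n \<alpha>]) (use pq z \<alpha> cont mono in auto)
  qed
  then show "piecewise_dpath P p q (\<lambda>r. deformation (point_class P n z (\<alpha> r), \<tau>))"
    by (simp add: deformation_point_class[OF \<tau>])
qed

section \<open>Invariance of the realization of \<open>Q\<close> and the end stages\<close>

definition real_Q :: "(nat \<times> 'a \<times> (nat \<Rightarrow> real)) set set" where
  "real_Q = {point_class P n z u | n z u. z \<in> cells Q n \<and> u \<in> Icube n}"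

lemma real_QI: "z \<in> cells Q n \<Longrightarrow> u \<in> Icube n \<Longrightarrow> point_class P n z u \<in> real_Q"
  unfolding real_Q_def by blast

text \<open>Of the four edges of \<open>x\<close>, only \<open>bottom\<close> is missing from
  \<open>Q\<close>.\<close>

lemma sq_pt_in_real_Q:
  assumes "r \<in> {0..1}"
  shows "sq_pt 1 r \<in> real_Q" "sq_pt 0 r \<in> real_Q" "sq_pt r 1 \<in> real_Q"
proof -
  have e: "edge_pt (fl r) \<in> Icube 1" using assms by (intro edge_pt_in) simp
  have Q1: "bd P 2 i k x \<in> cells Q 1" if "i \<in> {1,2}" "k \<in> {0,1}" "i = a \<or> k = 1 - b" for i k
    using square_bd[OF that(1,2) x] edges_eq_iff(2)[OF that(1,2)] that(3) by (auto simp: cells_Q)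
  show "sq_pt 1 r \<in> real_Q"
    using real_QI[OF Q1[OF a b1(1)] e] edge_class(1)[of "fl r" "1 - b"] assms b1(1) by simp
  show "sq_pt 0 r \<in> real_Q"
    using real_QI[OF Q1[OF a b] e] edge_class(1)[of "fl r" b] assms b by simp
  show "sq_pt r 1 \<in> real_Q"
    using real_QI[OF Q1[OF a3(1) b1(1)] e] edge_class(2)[of "fl r" "1 - b"] assms b1(1) by simp
qed

lemma def_sq_right_in_real_Q: "\<tau> \<in> {0..1} \<Longrightarrow> t \<in> {0..1} \<Longrightarrow> def_sq \<tau> 1 t \<in> real_Q"
  using def_in(2)[of \<tau> 1 t] by (simp add: def_sq_def sq_pt_in_real_Q)

lemma def_sq_end_in_real_Q: "s \<in> {0..1} \<Longrightarrow> t \<in> {0..1} \<Longrightarrow> def_sq 1 s t \<in> real_Q"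
  using def_end[of s t] def_in[of 1 s t] by (auto simp: def_sq_def sq_pt_in_real_Q)

lemma tail_in_real_Q: "y \<in> Y \<Longrightarrow> w \<in> {0..2} \<Longrightarrow> tail y w \<in> real_Q"
  by (auto simp: tail_def Y_iff cells_Q intro!: sq_pt_in_real_Q real_QI edge_pt_in)

text \<open>This covers both the invariance of $|Q|$ at all times and the arrival of $|P|$ in it at
  time 1. Only \<open>x\<close> and \<open>bottom\<close> lie outside \<open>Q\<close>; the other
  moved cells travel within \<open>right\<close> and the edges of \<open>Y\<close>.\<close>

lemma deform_in_real_Q:
  assumes \<tau>: "\<tau> \<in> {0..1}" and u: "u \<in> Icube n" and z: "z \<in> cells P n" and "z \<in> cells Q n \<or> \<tau> = 1"
  shows "deform \<tau> n z u \<in> real_Q"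
proof (rule deform_cases[of n z])
  assume n: "n = 2" and zx: "z = x"
  then have "\<tau> = 1" using assms(4) by (simp add: cells_Q)
  then show ?thesis
    unfolding n zx deform_x using Icube_le[OF u, of a] Icube_le[OF u, of "3 - a"] a n
    by (auto intro!: def_sq_end_in_real_Q)
next
  assume n: "n = 1" and zx: "z = bottom"
  then have "\<tau> = 1" using assms(4) by (simp add: cells_Q)
  then show ?thesis
    unfolding n zx deform_bottom using Icube_le[OF u, of 1] n
    by (auto intro!: def_sq_end_in_real_Q)
next
  assume n: "n = 1" and zx: "z = right"
  then show ?thesis
    unfolding n zx deform_right using Icube_le[OF u, of 1] \<tau> n
    by (auto intro!: def_sq_right_in_real_Q)
next
  assume n: "n = 0" and zx: "z = corner"
  then show ?thesis
    unfolding n zx deform_corner using \<tau> by (auto intro!: def_sq_right_in_real_Q)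
next
  assume n: "n = 1" and y: "z \<in> Y"
  have "fl (u 1) \<in> {0..1}" using Icube_le[OF u, of 1] n by simp
  then have "(1 + \<tau>) * fl (u 1) \<in> {0..2}"
    using stretch_in[OF \<tau>] by blast
  then show ?thesis
    unfolding n deform_Y[OF y] by (rule tail_in_real_Q[OF y])
next
  assume d: "\<And>\<tau> u. deform \<tau> n z u = point_class P n z u"
  assume "n = 2 \<Longrightarrow> z \<noteq> x" "n = 1 \<Longrightarrow> z \<noteq> bottom"
  then have "z \<in> cells Q n"
    using z by (auto simp: cells_Q)
  then show ?thesis
    unfolding d using u by (rule real_QI)
qed

lemma deform_start:
  assumes z: "z \<in> cells P n" and u: "u \<in> Icube n"
  shows "deform 0 n z u = point_class P n z u"
proof (rule deform_cases[of n z])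
  assume n: "n = 2" and zx: "z = x"
  show ?thesis
    unfolding n zx deform_x def_sq_def def_s_start def_t_start sq_pt_def
    using sq_eq[of u] u n by simp
next
  assume n: "n = 1" and zx: "z = bottom"
  show ?thesis
    unfolding n zx deform_bottom def_sq_def def_s_start def_t_start
    using bottom_class[of "u 1"] Icube_1_eq[of u] Icube_le[of u 1 1] u n by simp
next
  assume n: "n = 1" and zx: "z = right"
  show ?thesis
    unfolding n zx deform_right def_sq_def def_s_start def_t_start
    using right_class[of "u 1"] Icube_1_eq[of u] Icube_le[of u 1 1] u n by simp
next
  assume n: "n = 0" and zx: "z = corner"
  show ?thesis
    unfolding n zx deform_corner def_sq_def def_s_start def_t_start
    using corner_class u n by (simp add: Icube_0)
next
  assume n: "n = 1" and y: "z \<in> Y"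
  have "fl (u 1) \<le> 1" using Icube_le[of u 1 1] u n by (auto simp: fl_def)
  then show ?thesis
    unfolding n deform_Y[OF y] using Icube_1_eq[of u] u n by (simp add: tail_def)
next
  assume "\<And>\<tau> u. deform \<tau> n z u = point_class P n z u"
  then show ?thesis .
qed

text \<open>Points of sub-realizations are classes with respect to \<open>P\<close>, so the
  inclusion is literally \<open>id\<close>.\<close>

lemma inclusion_dihomotopy_equivalence:
  "dihomotopy_equivalence_rel (sub_realization P R) (sub_realization P Q) (realization P) id"
proof -
  let ?R = "{point_class P n z u | n z u. z \<in> cells R n \<and> u \<in> Icube n}"
  have RQ: "cells R n \<subseteq> cells Q n" "cells Q n \<subseteq> cells P n" for n
    using R_subset Q_subset by (simp_all add: precubical_subset_def)
  have top: "topspace (dtop (realization P)) = {point_class P n z u | n z u. z \<in> cells P n \<and> u \<in> Icube n}"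
    by (rule topspace_realization)
  have "dihomotopy_equivalence_rel (dsub (realization P) ?R) (dsub (realization P) real_Q) (realization P) id"
  proof (rule deformation_dihomotopy_equivalence[where K = deformation])
    show "is_dspace (realization P)" by (rule is_dspace_realization)
    show "real_Q \<subseteq> topspace (dtop (realization P))"
      unfolding top real_Q_def using RQ(2) by blast
    show "?R \<subseteq> real_Q"
      unfolding real_Q_def using RQ(1) by blast
    show "continuous_map (prod_topology (dtop (realization P)) unit_top) (dtop (realization P)) deformation"
      unfolding dtop_realization by (rule continuous_map_deformation)
    show "dmap (realization P) (realization P) (\<lambda>p. deformation (p, \<tau>))" if "\<tau> \<in> {0..1}" for \<tau>
      by (rule dmap_deformation[OF that])
    show "deformation (p, 0) = p" if tp: "p \<in> topspace (dtop (realization P))" for p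
    proof -
      obtain n z u where p: "p = point_class P n z u" "z \<in> cells P n" "u \<in> Icube n"
        using tp unfolding top by blast
      then show ?thesis by (simp add: deformation_point_class deform_start)
    qed
    show "deformation (p, \<tau>) = p" if tp: "p \<in> ?R" and \<tau>: "\<tau> \<in> {0..1}" for p \<tau>
    proof -
      obtain n z u where p: "p = point_class P n z u" "z \<in> cells R n" "u \<in> Icube n"
        using tp by blast
      \<comment> \<open>\<open>R\<close> was chosen to contain none of the moved cells.\<close>
      have "deform \<tau> n z u = point_class P n z u"
        by (rule deform_other) (use p(2) in \<open>auto simp: cells_R cells_Q\<close>)
      then show ?thesis using p \<tau> by (simp add: deformation_point_class)
    qed
    show "deformation (p, \<tau>) \<in> real_Q" if tp: "p \<in> real_Q" and \<tau>: "\<tau> \<in> {0..1}" for p \<tau>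
    proof -
      obtain n z u where p: "p = point_class P n z u" "z \<in> cells Q n" "u \<in> Icube n"
        using tp unfolding real_Q_def by blast
      then have "deform \<tau> n z u \<in> real_Q"
        using deform_in_real_Q[OF \<tau>] RQ(2) by blast
      then show ?thesis using p \<tau> by (simp add: deformation_point_class)
    qed
    show "deformation (p, 1) \<in> real_Q" if tp: "p \<in> topspace (dtop (realization P))" for p
    proof -
      obtain n z u where p: "p = point_class P n z u" "z \<in> cells P n" "u \<in> Icube n"
        using tp unfolding top by blast
      then have "deform 1 n z u \<in> real_Q"
        by (intro deform_in_real_Q) auto
      then show ?thesis using p by (simp add: deformation_point_class)
    qed
  qed
  then show ?thesis
    unfolding sub_realization_def real_Q_def .
qed

section \<open>Extremal points and d-path spaces under the inclusion\<close>

lemma extremal_points_in_R: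
  "v \<in> cells (extrl P) 0 \<Longrightarrow> point_class P 0 v pt0 \<in> topspace (dtop (sub_realization P R))"
proof -
  assume v: "v \<in> cells (extrl P) 0"
  have "precubical_subset R P"
    using R_subset Q_subset by (auto simp: precubical_subset_def bd_Q bd_R)
  then show ?thesis
    using extrl_in_R[OF v] pt0_Icube unfolding topspace_sub_realization[OF \<open>precubical_subset R P\<close>] by blast
qed

text \<open>If \<open>Y\<close> is nonempty, \<open>P\<close> and \<open>Q\<close> have the same
  extremal vertices, hence both realizations have the same extremal points. These lie in $|R|$,
  where the equivalence is relative.\<close>

lemma inclusion_equivalences:
  assumes "Y \<noteq> {}"
  shows "is_cat_iso (fund_bipartite_graph (sub_realization P Q)) (fund_bipartite_graph (realization P))
      id (fund_mor (sub_realization P Q) (realization P) id)"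
    and "v \<in> cells (extrl P) 0 \<Longrightarrow> w \<in> cells (extrl P) 0 \<Longrightarrow>
      homotopy_equivalence_map
        (dpath_space (sub_realization P Q) (point_class P 0 v pt0) (point_class P 0 w pt0))
        (dpath_space (realization P) (point_class P 0 v pt0) (point_class P 0 w pt0))
        (dpath_comp id)"
proof -
  have "topspace (dtop (dextrl (sub_realization P Q))) = {point_class P 0 v pt0 | v. v \<in> cells (extrl P) 0}"
    by (rule topspace_dextrl_sub_realization[OF P Q_subset min_max_vertex_Q[OF assms]])
  moreover have "topspace (dtop (dextrl (realization P))) = {point_class P 0 v pt0 | v. v \<in> cells (extrl P) 0}"
    using topspace_dextrl_sub_realization[OF P precubical_subset_refl[OF P]] by (simp add: sub_realization_self)
  ultimately show "is_cat_iso (fund_bipartite_graph (sub_realization P Q)) (fund_bipartite_graph (realization P))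
      id (fund_mor (sub_realization P Q) (realization P) id)"
    using extremal_points_in_R by (intro fund_bipartite_graph_iso[OF inclusion_dihomotopy_equivalence]) auto
  show "homotopy_equivalence_map
      (dpath_space (sub_realization P Q) (point_class P 0 v pt0) (point_class P 0 w pt0))
      (dpath_space (realization P) (point_class P 0 v pt0) (point_class P 0 w pt0))
      (dpath_comp id)"
    if "v \<in> cells (extrl P) 0" "w \<in> cells (extrl P) 0"
    using that extremal_points_in_R
    by (intro dpath_space_homotopy_equivalence[OF inclusion_dihomotopy_equivalence])
qed

end

theorem theorem6p1:
  fixes P Q R :: "'a precubical" and a b :: nat and x :: 'a and Y :: "'a set"
  assumes "precubical_set P"
    and "a \<in> {1,2}" and "b \<in> {0,1}"
    and "x \<in> cells P 2" and "regular_element P 2 x"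
    and Y_def: "Y = {y \<in> cells P 1 - {bd P 2 (3 - a) b x}.
           bd P 1 1 (1 - b) y = bd P 1 1 (1 - b) (bd P 2 (3 - a) b x)}"
    and i: "\<not> (\<exists>z\<in>cells P 2 - {x}. in_boundary P 2 z 1 (bd P 2 a (1 - b) x) \<or>
                                    in_boundary P 2 z 1 (bd P 2 (3 - a) b x))"
    and ii: "\<not> (\<exists>y\<in>cells P 1 - {bd P 2 a (1 - b) x}.
                   bd P 1 1 b y = bd P 1 1 b (bd P 2 a (1 - b) x))"
    and iii: "\<not> (\<exists>y\<in>Y. \<exists>z\<in>cells P 2. in_boundary P 2 z 1 y)"
    and Q_def: "Q = P\<lparr>cells := (cells P)(1 := cells P 1 - {bd P 2 (3 - a) b x},
                                          2 := cells P 2 - {x})\<rparr>"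
    and R_def: "R = Q\<lparr>cells := (cells Q)(0 := cells Q 0 - {bd P 1 1 (1 - b) (bd P 2 (3 - a) b x)},
                                          1 := cells Q 1 - ({bd P 2 a (1 - b) x} \<union> Y))\<rparr>"
  shows "precubical_subset Q P \<and> precubical_subset R Q \<and>
     dihomotopy_equivalence_rel (sub_realization P R) (sub_realization P Q) (realization P) id \<and>
     (Y \<noteq> {} \<longrightarrow>
        extrl P = extrl Q \<and> precubical_subset (extrl Q) R \<and>
        is_cat_iso (fund_bipartite_graph (sub_realization P Q)) (fund_bipartite_graph (realization P))
          id (fund_mor (sub_realization P Q) (realization P) id) \<and>
        (\<forall>v\<in>cells (extrl P) 0. \<forall>w\<in>cells (extrl P) 0.
           homotopy_equivalence_map
             (dpath_space (sub_realization P Q) (point_class P 0 v pt0) (point_class P 0 w pt0))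
             (dpath_space (realization P) (point_class P 0 v pt0) (point_class P 0 w pt0))
             (dpath_comp id)))"
proof -
  \<comment> \<open>This turns the boundary hypotheses on squares into statements about their
    faces.\<close>
  have face: "in_boundary P 2 z 1 (bd P 2 i k z)" if "i \<in> {1,2}" "k \<in> {0,1}" for z i k
    using in_boundary.face[of 2 i k P z] that by (auto simp: One_nat_def)
  interpret C: collapsible_square P a b x Y
  proof
    show "bd P 2 i k z \<noteq> bd P 2 a (1 - b) x \<and> bd P 2 i k z \<noteq> bd P 2 (3 - a) b x"
      if "z \<in> cells P 2" "z \<noteq> x" "i \<in> {1,2}" "k \<in> {0,1}" for z i k
      using face[OF that(3,4), of z] i that(1,2) by auto
    show "y = bd P 2 a (1 - b) x" if "y \<in> cells P 1" "bd P 1 1 b y = bd P 1 1 b (bd P 2 a (1 - b) x)" for y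
      using ii that by blast
    show "bd P 2 i k z \<notin> Y" if "z \<in> cells P 2" "i \<in> {1,2}" "k \<in> {0,1}" for z i k
      using face[OF that(2,3), of z] iii that(1) by blast
  qed (fact assms)+
  have Q: "Q = C.Q"
    unfolding Q_def C.Q_def C.bottom_def ..
  have R: "R = C.R"
    unfolding R_def Q C.R_def C.corner_def C.right_def C.bottom_def ..
  show ?thesis
    unfolding Q R
    using C.Q_subset C.R_subset C.inclusion_dihomotopy_equivalence C.extrl_Q C.extrl_Q_subset_R
      C.inclusion_equivalences by blast
qed

end
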